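(* Let $H$ be a semisimple Hopf algebra over an algebraically closed field $k$ of characteristic $0$, with irreducible characters $\chi_i$ of degrees $d_i$, and let $n\ge2$. Let $z_n\in H$ be the element built from the idempotent integral of $H$ (defined in the context). Then $z_n$ is the central Casimir element of the symmetric form $\tilde\beta_n$ on $H$ defined through $$\tilde t_n=\sum_i d_i^{\,n+1-(n\bmod 2)}\chi_i,\qquad \tilde\beta_n(h,h')=\langle\tilde t_n,hh'\rangle\quad\text{for all }h,h'\in H .$$ The Higman map defined by this form is $$\tau_{\tilde\beta_n}(h)=Z_{n+1-(n\bmod2)}(h)\quad\text{for all }h\in H,$$ where the maps $Z_m$ are defined in the context.
   Context: $H$ is finite dimensional with comultiplication $\Delta(h)=\sum h_1\otimes h_2$ (Sweedler notation), counit $\varepsilon$ and antipode $S$. $\Lambda$ is the idempotent integral: $h\Lambda=\varepsilon(h)\Lambda=\Lambda h$ for all $h\in H$, $\varepsilon(\Lambda)=1$. Let $\Lambda^1,\Lambda^2,\dots$ be copies of $\Lambda$ with $\Delta(\Lambda^i)=\sum\Lambda^i_1\otimes\Lambda^i_2$. For $m\ge1$ and $h\in H$, $$z_m=\sum\Lambda^1_1\cdots\Lambda^m_1\,S(\Lambda^1_2)\cdots S(\Lambda^m_2),\qquad Z_m(h)=\sum\Lambda^1_1\cdots\Lambda^m_1\,h\,S(\Lambda^1_2)\cdots S(\Lambda^m_2).$$ For a finite-dimensional algebra $A$ with a non-degenerate associative symmetric bilinear form $\beta$, let $\{r_i\},\{l_i\}$ be dual bases for $\beta$, i.e. $\beta(r_i,l_j)=\delta_{ij}$.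 The central Casimir element of $\beta$ is $\sum_i r_il_i\in Z(A)$, and the Higman map of $\beta$ is $\tau_\beta:A\to Z(A)$, $\tau_\beta(h)=\sum_i r_ihl_i$; both are independent of the choice of dual bases. Here $n\bmod2\in\{0,1\}$. *)

theory Defs
  imports
    "HOL-Computational_Algebra.Polynomial"
    "HOL-Library.Poly_Mapping"
    "Jordan_Normal_Form.Matrix"
begin

section \<open>Tensors\<close>

text \<open>
  The \<open>n\<close>-th tensor power of a \<open>k\<close>-space \<open>V\<close> is the free \<open>k\<close>-space on words of length \<open>n\<close> over
  \<open>V\<close>, modulo the span of the multilinearity relators. A tensor is written as a list of words,
  \<open>[[x, y], [x', y']]\<close> standing for \<open>x \<otimes> y + x' \<otimes> y'\<close> (scalars can be absorbed into the
  letters), and equality of tensors is the relation \<open>tensor_eq\<close>.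
  The relators never relate words of different lengths, so one relation serves all \<open>n\<close>.
\<close>

definition multilinear_relators ::
  "('k::field \<Rightarrow> 'v::ab_group_add \<Rightarrow> 'v) \<Rightarrow> ('v list \<Rightarrow>\<^sub>0 'k) set" where
  "multilinear_relators scale =
     {Poly_Mapping.single (u @ (x + y) # w) 1
        - Poly_Mapping.single (u @ x # w) 1 - Poly_Mapping.single (u @ y # w) 1 | u x y w. True}
   \<union> {Poly_Mapping.single (u @ scale c x # w) 1 - Poly_Mapping.single (u @ x # w) c | u c x w. True}"

definition formal_sum :: "'v list list \<Rightarrow> ('v list \<Rightarrow>\<^sub>0 'k::field)" where
  "formal_sum ws = (\<Sum>w\<leftarrow>ws. Poly_Mapping.single w 1)"

definition tensor_eq ::
  "('k::field \<Rightarrow> 'v::ab_group_add \<Rightarrow> 'v) \<Rightarrow> 'v list list \<Rightarrow> 'v list list \<Rightarrow> bool" where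
  "tensor_eq scale ws ws' \<longleftrightarrow>
     formal_sum ws - formal_sum ws' \<in>
       module.span (\<lambda>(c::'k) p. Poly_Mapping.map ((*) c) p) (multilinear_relators scale)"

section \<open>Finite-dimensional Hopf algebras\<close>

text \<open>
  \<open>comult h\<close> is a chosen list of pairs \<open>(h\<^sub>1, h\<^sub>2)\<close> with \<open>\<Delta>(h) = \<Sum> h\<^sub>1 \<otimes> h\<^sub>2\<close> (Sweedler notation).
  Only the tensor it represents matters: every axiom on it is up to \<open>tensor_eq\<close>.
\<close>

locale hopf_algebra = vector_space scale
  for scale :: "'k::field \<Rightarrow> 'h::ring_1 \<Rightarrow> 'h" +
  fixes comult :: "'h \<Rightarrow> ('h \<times> 'h) list"
    and counit :: "'h \<Rightarrow> 'k"
    and antipode :: "'h \<Rightarrow> 'h"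
  assumes finite_dim: "\<exists>B. finite B \<and> span B = UNIV"
    and scale_mult_left: "scale c x * y = scale c (x * y)"
    and scale_mult_right: "x * scale c y = scale c (x * y)"
    and comult_add:
      "tensor_eq scale [[a, b]. (a, b) \<leftarrow> comult (x + y)] [[a, b]. (a, b) \<leftarrow> comult x @ comult y]"
    and comult_scale:
      "tensor_eq scale [[a, b]. (a, b) \<leftarrow> comult (scale c x)] [[scale c a, b]. (a, b) \<leftarrow> comult x]"
    and comult_mult:
      "tensor_eq scale [[a, b]. (a, b) \<leftarrow> comult (x * y)]
         [[a * a', b * b']. (a, b) \<leftarrow> comult x, (a', b') \<leftarrow> comult y]"
    and comult_one: "tensor_eq scale [[a, b]. (a, b) \<leftarrow> comult 1] [[1, 1]]"
    and coassoc:
      "tensor_eq scale [[a1, a2, b]. (a, b) \<leftarrow> comult x, (a1, a2) \<leftarrow> comult a]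
         [[a, b1, b2]. (a, b) \<leftarrow> comult x, (b1, b2) \<leftarrow> comult b]"
    and counit_linear: "Vector_Spaces.linear scale (*) counit"
    and counit_mult: "counit (x * y) = counit x * counit y"
    and counit_one: "counit 1 = 1"
    and counit_left: "(\<Sum>(a, b)\<leftarrow>comult x. scale (counit a) b) = x"
    and counit_right: "(\<Sum>(a, b)\<leftarrow>comult x. scale (counit b) a) = x"
    and antipode_linear: "Vector_Spaces.linear scale scale antipode"
    and antipode_left: "(\<Sum>(a, b)\<leftarrow>comult x. antipode a * b) = scale (counit x) 1"
    and antipode_right: "(\<Sum>(a, b)\<leftarrow>comult x. a * antipode b) = scale (counit x) 1"

definition idempotent_integral ::
  "('k::field \<Rightarrow> 'h::ring_1 \<Rightarrow> 'h) \<Rightarrow> ('h \<Rightarrow> 'k) \<Rightarrow> 'h \<Rightarrow> bool" where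
  "idempotent_integral scale counit L \<longleftrightarrow>
     (\<forall>h. h * L = scale (counit h) L \<and> L * h = scale (counit h) L) \<and> counit L = 1"

text \<open>
  The lists in \<open>product_lists (replicate m (comult L))\<close> are the \<open>m\<close>-tuples
  \<open>(\<Lambda>\<^sup>1\<^sub>1, \<Lambda>\<^sup>1\<^sub>2), \<dots>, (\<Lambda>\<^sup>m\<^sub>1, \<Lambda>\<^sup>m\<^sub>2)\<close> of terms of \<open>\<Delta>(\<Lambda>)\<close>, chosen independently.
\<close>

definition z_elem ::
  "('h::ring_1 \<Rightarrow> ('h \<times> 'h) list) \<Rightarrow> ('h \<Rightarrow> 'h) \<Rightarrow> 'h \<Rightarrow> nat \<Rightarrow> 'h" where
  "z_elem comult antipode L m =
     (\<Sum>ps\<leftarrow>product_lists (replicate m (comult L)).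
        prod_list (map fst ps) * prod_list (map (\<lambda>p. antipode (snd p)) ps))"

definition Z_map ::
  "('h::ring_1 \<Rightarrow> ('h \<times> 'h) list) \<Rightarrow> ('h \<Rightarrow> 'h) \<Rightarrow> 'h \<Rightarrow> nat \<Rightarrow> 'h \<Rightarrow> 'h" where
  "Z_map comult antipode L m h =
     (\<Sum>ps\<leftarrow>product_lists (replicate m (comult L)).
        prod_list (map fst ps) * h * prod_list (map (\<lambda>p. antipode (snd p)) ps))"

section \<open>Semisimplicity\<close>

definition left_ideal :: "'h::ring_1 set \<Rightarrow> bool" where
  "left_ideal I \<longleftrightarrow> 0 \<in> I \<and> (\<forall>x\<in>I. \<forall>y\<in>I. x + y \<in> I) \<and> (\<forall>h. \<forall>x\<in>I. h * x \<in> I)"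

definition minimal_left_ideal :: "'h::ring_1 set \<Rightarrow> bool" where
  "minimal_left_ideal I \<longleftrightarrow>
     left_ideal I \<and> I \<noteq> {0} \<and> (\<forall>J. left_ideal J \<and> J \<subseteq> I \<longrightarrow> J = {0} \<or> J = I)"

text \<open>
  The regular left module is the sum of its simple submodules. Left ideals of a unital
  \<open>k\<close>-algebra are \<open>k\<close>-subspaces, so their sum is the \<open>k\<close>-span of their union.
\<close>

definition semisimple_algebra :: "('k::field \<Rightarrow> 'h::ring_1 \<Rightarrow> 'h) \<Rightarrow> bool" where
  "semisimple_algebra scale \<longleftrightarrow> module.span scale (\<Union> {I. minimal_left_ideal I}) = UNIV"

section \<open>Irreducible characters\<close>

definition matrix_rep ::
  "('k::field \<Rightarrow> 'h::ring_1 \<Rightarrow> 'h) \<Rightarrow> nat \<Rightarrow> ('h \<Rightarrow> 'k mat) \<Rightarrow> bool" where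
  "matrix_rep scale d \<rho> \<longleftrightarrow>
     (\<forall>x. \<rho> x \<in> carrier_mat d d) \<and>
     (\<forall>x y. \<rho> (x + y) = \<rho> x + \<rho> y) \<and>
     (\<forall>c x. \<rho> (scale c x) = c \<cdot>\<^sub>m \<rho> x) \<and>
     (\<forall>x y. \<rho> (x * y) = \<rho> x * \<rho> y) \<and>
     \<rho> 1 = 1\<^sub>m d"

definition invariant_subspace :: "nat \<Rightarrow> ('h \<Rightarrow> 'k::field mat) \<Rightarrow> 'k vec set \<Rightarrow> bool" where
  "invariant_subspace d \<rho> W \<longleftrightarrow>
     W \<subseteq> carrier_vec d \<and> 0\<^sub>v d \<in> W \<and>
     (\<forall>v\<in>W. \<forall>w\<in>W. v + w \<in> W) \<and> (\<forall>c. \<forall>v\<in>W. c \<cdot>\<^sub>v v \<in> W) \<and>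
     (\<forall>h. \<forall>v\<in>W. \<rho> h *\<^sub>v v \<in> W)"

definition irreducible_rep ::
  "('k::field \<Rightarrow> 'h::ring_1 \<Rightarrow> 'h) \<Rightarrow> nat \<Rightarrow> ('h \<Rightarrow> 'k mat) \<Rightarrow> bool" where
  "irreducible_rep scale d \<rho> \<longleftrightarrow>
     matrix_rep scale d \<rho> \<and> d > 0 \<and>
     (\<forall>W. invariant_subspace d \<rho> W \<longrightarrow> W = {0\<^sub>v d} \<or> W = carrier_vec d)"

definition mat_trace :: "'k::field mat \<Rightarrow> 'k" where
  "mat_trace A = (\<Sum>i<dim_row A. A $$ (i, i))"

definition irreducible_characters ::
  "('k::field \<Rightarrow> 'h::ring_1 \<Rightarrow> 'h) \<Rightarrow> ('h \<Rightarrow> 'k) set" where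
  "irreducible_characters scale =
     {\<chi>. \<exists>d \<rho>. irreducible_rep scale d \<rho> \<and> \<chi> = (\<lambda>h. mat_trace (\<rho> h))}"

text \<open>
  Well defined in characteristic 0, where \<open>\<chi>(1)\<close> determines the degree.
\<close>

definition character_degree ::
  "('k::field \<Rightarrow> 'h::ring_1 \<Rightarrow> 'h) \<Rightarrow> ('h \<Rightarrow> 'k) \<Rightarrow> nat" where
  "character_degree scale \<chi> =
     (THE d. \<exists>\<rho>. irreducible_rep scale d \<rho> \<and> \<chi> = (\<lambda>h. mat_trace (\<rho> h)))"

section \<open>Symmetric forms, Casimir elements and Higman maps\<close>

definition nondegenerate_symmetric_form ::
  "('k::field \<Rightarrow> 'h::ring_1 \<Rightarrow> 'h) \<Rightarrow> ('h \<Rightarrow> 'h \<Rightarrow> 'k) \<Rightarrow> bool" where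
  "nondegenerate_symmetric_form scale \<beta> \<longleftrightarrow>
     (\<forall>x. Vector_Spaces.linear scale (*) (\<beta> x)) \<and>
     (\<forall>y. Vector_Spaces.linear scale (*) (\<lambda>x. \<beta> x y)) \<and>
     (\<forall>x y. \<beta> x y = \<beta> y x) \<and>
     (\<forall>x y w. \<beta> (x * y) w = \<beta> x (y * w)) \<and>
     (\<forall>x. (\<forall>y. \<beta> x y = 0) \<longrightarrow> x = 0)"

definition indexed_basis ::
  "('k::field \<Rightarrow> 'h::ab_group_add \<Rightarrow> 'h) \<Rightarrow> nat \<Rightarrow> (nat \<Rightarrow> 'h) \<Rightarrow> bool" where
  "indexed_basis scale N b \<longleftrightarrow>
     inj_on b {..<N} \<and> \<not> module.dependent scale (b ` {..<N}) \<and>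
     module.span scale (b ` {..<N}) = UNIV"

definition dual_bases ::
  "('k::field \<Rightarrow> 'h::ring_1 \<Rightarrow> 'h) \<Rightarrow> ('h \<Rightarrow> 'h \<Rightarrow> 'k) \<Rightarrow> nat \<Rightarrow> (nat \<Rightarrow> 'h) \<Rightarrow> (nat \<Rightarrow> 'h) \<Rightarrow> bool"
  where
  "dual_bases scale \<beta> N r l \<longleftrightarrow>
     indexed_basis scale N r \<and> indexed_basis scale N l \<and>
     (\<forall>i<N. \<forall>j<N. \<beta> (r i) (l j) = (if i = j then 1 else 0))"

definition center :: "'h::ring_1 set" where
  "center = {z. \<forall>x. z * x = x * z}"

text \<open>
  Both notions ask that dual bases exist and that every choice of them gives the stated value.
\<close>

definition is_central_casimir_element ::
  "('k::field \<Rightarrow> 'h::ring_1 \<Rightarrow> 'h) \<Rightarrow> ('h \<Rightarrow> 'h \<Rightarrow> 'k) \<Rightarrow> 'h \<Rightarrow> bool" where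
  "is_central_casimir_element scale \<beta> z \<longleftrightarrow>
     z \<in> center \<and>
     (\<exists>N r l. dual_bases scale \<beta> N r l) \<and>
     (\<forall>N r l. dual_bases scale \<beta> N r l \<longrightarrow> z = (\<Sum>i<N. r i * l i))"

definition is_higman_map ::
  "('k::field \<Rightarrow> 'h::ring_1 \<Rightarrow> 'h) \<Rightarrow> ('h \<Rightarrow> 'h \<Rightarrow> 'k) \<Rightarrow> ('h \<Rightarrow> 'h) \<Rightarrow> bool" where
  "is_higman_map scale \<beta> \<tau> \<longleftrightarrow>
     range \<tau> \<subseteq> center \<and>
     (\<exists>N r l. dual_bases scale \<beta> N r l) \<and>
     (\<forall>N r l. dual_bases scale \<beta> N r l \<longrightarrow> (\<forall>h. \<tau> h = (\<Sum>i<N. r i * h * l i)))"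

definition t_tilde ::
  "('k::field \<Rightarrow> 'h::ring_1 \<Rightarrow> 'h) \<Rightarrow> nat \<Rightarrow> 'h \<Rightarrow> 'k" where
  "t_tilde scale n h =
     (\<Sum>\<chi>\<in>irreducible_characters scale.
        of_nat (character_degree scale \<chi>) ^ (n + 1 - n mod 2) * \<chi> h)"

definition beta_tilde ::
  "('k::field \<Rightarrow> 'h::ring_1 \<Rightarrow> 'h) \<Rightarrow> nat \<Rightarrow> 'h \<Rightarrow> 'h \<Rightarrow> 'k" where
  "beta_tilde scale n h h' = t_tilde scale n (h * h')"

end

theory Submission
  imports Defs "Jordan_Normal_Form.Char_Poly"
begin

text \<open>
  On an irreducible representation of degree \<open>d\<close>, the tensor \<open>\<Sum> \<Lambda>\<^sub>1 \<otimes> S(\<Lambda>\<^sub>2)\<close> commutes with \<open>H\<close>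
  (\<open>casimir_central\<close>), so Schur's lemma determines it. Once \<open>S\<^sup>2 = id\<close> is known it is
  \<open>(1/d) \<Sum> e\<^sub>i\<^sub>j \<otimes> e\<^sub>j\<^sub>i\<close> in terms of matrix units. One copy of \<open>\<Lambda>\<close> around \<open>h\<close> then yields the scalar
  \<open>tr(h)/d\<close>, and two interleaved copies yield \<open>h/d\<^sup>2\<close>, since \<open>\<Sum> e\<^sub>i\<^sub>j e\<^sub>k\<^sub>l h e\<^sub>j\<^sub>i e\<^sub>l\<^sub>k = h\<close>. Passing
  from \<open>Z\<^sub>m\<close> to \<open>Z\<^sub>m\<^sub>+\<^sub>2\<close> therefore multiplies by the central element \<open>z\<^sub>2\<close>, which acts by \<open>d\<^sup>-\<^sup>2\<close>
  (\<open>Z_map_Suc_Suc\<close>), and with \<open>j = n div 2\<close> both \<open>z\<^sub>n = z\<^sub>2\<^sup>j\<close> and \<open>Z\<^sub>2\<^sub>j\<^sub>+\<^sub>1(h) = z\<^sub>2\<^sup>j Z\<^sub>1(h)\<close>. The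
  form with weights \<open>d\<^sup>2\<^sup>j\<^sup>+\<^sup>1\<close> has the Casimir tensor \<open>\<Sum> \<Lambda>\<^sub>1 z\<^sub>2\<^sup>j \<otimes> S(\<Lambda>\<^sub>2)\<close>, and contracting it gives
  exactly these two values.

  The substance of the proof is \<open>S\<^sup>2 = id\<close>, the theorem of Larson and Radford. Without it the
  tensor is controlled by \<open>u = \<Sum> S(\<Lambda>\<^sub>2) \<Lambda>\<^sub>1\<close>, an invertible element with \<open>S\<^sup>2(h) = u h u\<^sup>-\<^sup>1\<close> and
  \<open>tr \<rho>(u) = d\<close>. The functional \<open>\<lambda>(h) = \<Sum>\<^sub>\<chi> d\<^sub>\<chi> \<chi>(u\<^sup>-\<^sup>1 h)\<close> is an integral of the dual Hopf algebra, and
  both halves of the argument are about the number \<open>\<lambda>(1)\<close>, the trace of \<open>S\<^sup>2\<close> on \<open>H\<close>.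

  First, \<open>\<lambda>(1) \<noteq> 0\<close> (\<open>lam_1_nonzero\<close>). Let \<open>g\<close> be the grouplike element comparing \<open>\<lambda>\<close> as a left and as
  a right integral. By Radford's formula \<open>S\<^sup>4\<close> is conjugation with \<open>g\<close> (\<open>antipode4\<close>), so \<open>u\<^sup>2\<close> is \<open>g\<close> up
  to a central factor, and on each irreducible representation some multiple \<open>w\<close> of \<open>\<rho>(u)\<close> is a
  square root of \<open>\<rho>(g)\<close>. Then \<open>\<lambda>(g\<^sup>j) = \<Sum>\<^sub>\<chi> tr(w\<^sub>\<chi>) tr(w\<^sub>\<chi>\<^sup>2\<^sup>j\<^sup>-\<^sup>1)\<close>. If \<open>\<lambda>(1) = 0\<close>, the integral property at
  \<open>g\<^sup>j\<close> makes all these sums vanish, and a positivity argument over \<open>\<rat>\<close>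
  (\<open>sums_zero_if_odd_power_sums_zero\<close>) gives \<open>tr(w\<^sub>\<chi>) = 0\<close>, against \<open>tr \<rho>(u) = d\<close>. This argument
  stands in for the estimate \<open>\<lambda>(1) = \<Sum>\<^sub>\<chi> \<bar>tr(w\<^sub>\<chi>)\<bar>\<^sup>2 > 0\<close> over the complex numbers. Comparing the two integral
  properties at \<open>1\<close> now gives \<open>g = 1\<close>, hence \<open>S\<^sup>4 = id\<close>.

  Second, \<open>dim H\<close> divides \<open>\<lambda>(1)\<close> (\<open>antipode_involution\<close>): the regular character divided by \<open>dim H\<close> is
  idempotent in the dual algebra, and \<open>\<lambda>(1)/dim H\<close> is the trace of \<open>S\<^sup>2\<close> on the image of the corresponding
  projection of \<open>H\<close>. As \<open>\<lambda>(1)\<close> is also a non-zero sum of \<open>dim H\<close> signs, all signs agree, and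
  they are \<open>1\<close> because \<open>S\<^sup>2(1) = 1\<close>.
\<close>

section \<open>Multilinear maps on tensors\<close>

lemma vector_space_field: "vector_space ((*) :: 'k::field \<Rightarrow> 'k \<Rightarrow> 'k)"
  by unfold_locales (auto simp: algebra_simps)

lemma lookup_map_mult:
  "Poly_Mapping.lookup (Poly_Mapping.map ((*) (c::'k::field)) p) w = c * Poly_Mapping.lookup p w"
  by (simp add: Poly_Mapping.map.rep_eq when_def)

lemma module_poly_mapping: "Modules.module (\<lambda>(c::'k::field) (p::'a \<Rightarrow>\<^sub>0 'k). Poly_Mapping.map ((*) c) p)"
  by unfold_locales (auto intro!: poly_mapping_eqI simp: lookup_map_mult lookup_add algebra_simps)

text \<open>
  The universal property of the tensor power: a map on words that is linear in each letter
  takes the same value on equal tensors, because its linear extension to the free space on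
  words kills the multilinearity relators.
\<close>

lemma tensor_eq_sum_eq:
  fixes \<Phi> :: "'v::ab_group_add list \<Rightarrow> 'w::ab_group_add"
    and scale :: "'k::field \<Rightarrow> 'v \<Rightarrow> 'v"
  assumes eq: "tensor_eq scale ws ws'"
    and lin: "\<And>u w. Vector_Spaces.linear scale sW (\<lambda>x. \<Phi> (u @ x # w))"
  shows "(\<Sum>w\<leftarrow>ws. \<Phi> w) = (\<Sum>w\<leftarrow>ws'. \<Phi> w)"
proof -
  interpret W: vector_space sW
    using lin[of "[]" "[]"] by (simp add: Vector_Spaces.linear_iff)
  interpret PM: Modules.module "\<lambda>(c::'k) (p::'v list \<Rightarrow>\<^sub>0 'k). Poly_Mapping.map ((*) c) p"
    by (rule module_poly_mapping)
  define ext where "ext p = (\<Sum>w\<in>Poly_Mapping.keys p. sW (Poly_Mapping.lookup p w) (\<Phi> w))" for p :: "'v list \<Rightarrow>\<^sub>0 'k"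
  have ext_superset: "ext p = (\<Sum>w\<in>A. sW (Poly_Mapping.lookup p w) (\<Phi> w))" 
    if "finite A" "Poly_Mapping.keys p \<subseteq> A" for p A
    unfolding ext_def using that by (intro sum.mono_neutral_left) (auto simp: in_keys_iff)
  have ext_add: "ext (p + q) = ext p + ext q" for p q
  proof -
    let ?A = "Poly_Mapping.keys p \<union> Poly_Mapping.keys q"
    have "ext (p + q) = (\<Sum>w\<in>?A. sW (Poly_Mapping.lookup (p + q) w) (\<Phi> w))"
      using Poly_Mapping.keys_add[of p q] by (intro ext_superset) auto
    also have "\<dots> = (\<Sum>w\<in>?A. sW (Poly_Mapping.lookup p w) (\<Phi> w)) + (\<Sum>w\<in>?A. sW (Poly_Mapping.lookup q w) (\<Phi> w))"
      by (simp add: lookup_add W.scale_left_distrib sum.distrib)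
    also have "\<dots> = ext p + ext q"
      by (simp add: ext_superset[of ?A])
    finally show ?thesis .
  qed
  have ext_scale: "ext (Poly_Mapping.map ((*) c) p) = sW c (ext p)" for c p
  proof -
    have "Poly_Mapping.keys (Poly_Mapping.map ((*) c) p) \<subseteq> Poly_Mapping.keys p"
      by (auto simp: in_keys_iff lookup_map_mult)
    then have "ext (Poly_Mapping.map ((*) c) p)
        = (\<Sum>w\<in>Poly_Mapping.keys p. sW (Poly_Mapping.lookup (Poly_Mapping.map ((*) c) p) w) (\<Phi> w))"
      by (intro ext_superset) auto
    also have "\<dots> = (\<Sum>w\<in>Poly_Mapping.keys p. sW c (sW (Poly_Mapping.lookup p w) (\<Phi> w)))"
      by (intro sum.cong) (auto simp: lookup_map_mult)
    finally show ?thesis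
      by (simp add: ext_def W.scale_sum_right)
  qed
  have ext_0: "ext 0 = 0"
    by (simp add: ext_def)
  have ext_diff: "ext (p - q) = ext p - ext q" for p q
    using ext_add[of "p - q" q] by simp
  have ext_single: "ext (Poly_Mapping.single w c) = sW c (\<Phi> w)" for w c
    by (simp add: ext_superset[of "{w}"])
  have formal: "ext (formal_sum vs) = (\<Sum>w\<leftarrow>vs. \<Phi> w)" for vs
    by (induction vs) (simp_all add: formal_sum_def ext_0 ext_add ext_single)
  have "ext p = 0" if "p \<in> PM.span (multilinear_relators scale)" for p
    using that
  proof (induction rule: PM.span_induct)
    show "PM.subspace {p. ext p = 0}"
      by (auto simp: PM.subspace_def ext_0 ext_add ext_scale)
  next
    fix p assume "p \<in> multilinear_relators scale"
    then show "ext p = 0"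
      using lin by (auto simp: multilinear_relators_def ext_diff ext_single Vector_Spaces.linear_iff)
  qed
  from this[of "formal_sum ws - formal_sum ws'"] eq show ?thesis
    by (simp add: tensor_eq_def ext_diff formal)
qed

lemma tensor_eq_bilinear:
  assumes eq: "tensor_eq scale ws ws'"
    and lin1: "\<And>b. Vector_Spaces.linear scale sW (\<lambda>a. B a b)"
    and lin2: "\<And>a. Vector_Spaces.linear scale sW (\<lambda>b. B a b)"
  shows "(\<Sum>w\<leftarrow>ws. case w of [a, b] \<Rightarrow> B a b | _ \<Rightarrow> 0) = (\<Sum>w\<leftarrow>ws'. case w of [a, b] \<Rightarrow> B a b | _ \<Rightarrow> 0)"
proof (rule tensor_eq_sum_eq[OF eq])
  fix u w
  have lin0: "Vector_Spaces.linear scale sW (\<lambda>x. 0)"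
    using lin1[of 0]
    by (auto simp: Vector_Spaces.linear_iff module.scale_zero_right module_iff_vector_space)
  show "Vector_Spaces.linear scale sW (\<lambda>x. case u @ x # w of [a, b] \<Rightarrow> B a b | _ \<Rightarrow> 0)"
  proof (cases "length (u @ w) = 1")
    case True
    then consider a where "u = [a]" "w = []" | b where "u = []" "w = [b]"
      by (cases u; cases w) auto
    then show ?thesis
      using lin1 lin2 by cases auto
  next
    case False
    then have "(case u @ x # w of [a, b] \<Rightarrow> B a b | _ \<Rightarrow> 0) = 0" for x
      by (auto split: list.splits dest!: arg_cong[where f = length])
    then show ?thesis
      using lin0 by simp
  qed
qed

lemma tensor_eq_trilinear:
  assumes eq: "tensor_eq scale ws ws'"
    and lin1: "\<And>b c. Vector_Spaces.linear scale sW (\<lambda>a. T a b c)"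
    and lin2: "\<And>a c. Vector_Spaces.linear scale sW (\<lambda>b. T a b c)"
    and lin3: "\<And>a b. Vector_Spaces.linear scale sW (\<lambda>c. T a b c)"
  shows "(\<Sum>w\<leftarrow>ws. case w of [a, b, c] \<Rightarrow> T a b c | _ \<Rightarrow> 0) =
    (\<Sum>w\<leftarrow>ws'. case w of [a, b, c] \<Rightarrow> T a b c | _ \<Rightarrow> 0)"
proof (rule tensor_eq_sum_eq[OF eq])
  fix u w
  have lin0: "Vector_Spaces.linear scale sW (\<lambda>x. 0)"
    using lin1[of 0]
    by (auto simp: Vector_Spaces.linear_iff module.scale_zero_right module_iff_vector_space)
  show "Vector_Spaces.linear scale sW (\<lambda>x. case u @ x # w of [a, b, c] \<Rightarrow> T a b c | _ \<Rightarrow> 0)"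
  proof (cases "length (u @ w) = 2")
    case True
    then consider a b where "u = [a, b]" "w = []" | a b where "u = [a]" "w = [b]"
      | a b where "u = []" "w = [a, b]"
      by (cases u; cases "tl u"; cases w; cases "tl w") (auto simp: numeral_2_eq_2)
    then show ?thesis
      using lin1 lin2 lin3 by cases auto
  next
    case False
    then have "(case u @ x # w of [a, b, c] \<Rightarrow> T a b c | _ \<Rightarrow> 0) = 0" for x
      by (auto split: list.splits dest!: arg_cong[where f = length])
    then show ?thesis
      using lin0 by simp
  qed
qed

section \<open>Sweedler calculus\<close>

lemma sum_list_concat_map:
  "(\<Sum>x\<leftarrow>concat (map f xs). g x) = (\<Sum>y\<leftarrow>xs. \<Sum>x\<leftarrow>f y. g x :: 'a::monoid_add)"
  by (induction xs) auto

context hopf_algebra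
begin

abbreviation lin :: "('k \<Rightarrow> 'w::ab_group_add \<Rightarrow> 'w) \<Rightarrow> ('h \<Rightarrow> 'w) \<Rightarrow> bool" where
  "lin \<equiv> Vector_Spaces.linear scale"

text \<open>
  \<open>sw h B\<close> is the Sweedler sum \<open>\<Sum> B h\<^sub>1 h\<^sub>2\<close>. For bilinear \<open>B\<close> it depends only on the tensor \<open>\<Delta>(h)\<close> and not
  on the list that represents it, which is what makes the Hopf algebra axioms available as
  equations between such sums.
\<close>

definition sw :: "'h \<Rightarrow> ('h \<Rightarrow> 'h \<Rightarrow> 'w::ab_group_add) \<Rightarrow> 'w" where
  "sw h B = (\<Sum>(a, b)\<leftarrow>comult h. B a b)"

lemma lin_vs: "lin sW f \<Longrightarrow> vector_space sW"
  by (simp add: Vector_Spaces.linear_iff)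

lemma lin_id: "lin scale (\<lambda>x. x)"
  by (simp add: Vector_Spaces.linear_iff vector_space_axioms)

lemma lin_compose: "lin sW g \<Longrightarrow> lin scale f \<Longrightarrow> lin sW (\<lambda>x. g (f x))"
  by (simp add: Vector_Spaces.linear_iff)



lemma lin_scale: "lin sW f \<Longrightarrow> lin sW (\<lambda>x. sW c (f x))"
proof -
  assume f: "lin sW f"
  interpret W: vector_space sW by (rule lin_vs[OF f])
  show ?thesis using f by (simp add: Vector_Spaces.linear_iff W.scale_right_distrib mult.commute)
qed

lemma lin_scale_arg: "lin (*) \<phi> \<Longrightarrow> lin scale (\<lambda>x. scale (\<phi> x) c)"
  by (simp add: Vector_Spaces.linear_iff scale_left_distrib)

lemma lin_mult_arg: "lin (*) \<phi> \<Longrightarrow> lin (*) (\<lambda>x. \<phi> x * c)"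
  by (simp add: Vector_Spaces.linear_iff distrib_right)

lemma lin_times_left: "lin scale f \<Longrightarrow> lin scale (\<lambda>x. c * f x)"
  by (simp add: Vector_Spaces.linear_iff distrib_left scale_mult_right)

lemma lin_times_right: "lin scale f \<Longrightarrow> lin scale (\<lambda>x. f x * c)"
  by (simp add: Vector_Spaces.linear_iff distrib_right scale_mult_left)

lemmas lin_antipode = lin_compose[OF antipode_linear]
lemmas lin_counit = lin_compose[OF counit_linear]

lemma lin_sum_list:
  assumes "vector_space sW" "\<And>z. z \<in> set zs \<Longrightarrow> lin sW (\<lambda>x. F x z)"
  shows "lin sW (\<lambda>x. \<Sum>z\<leftarrow>zs. F x z)"
proof -
  interpret W: vector_space sW by fact
  show ?thesis using assms(2)
    by (induction zs)
      (auto simp: Vector_Spaces.linear_iff vector_space_axioms W.vector_space_axioms W.scale_right_distrib)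
qed

lemma lin_sw: "(\<And>a b. lin sW (\<lambda>x. B x a b)) \<Longrightarrow> lin sW (\<lambda>x. sw y (\<lambda>a b. B x a b))"
  unfolding sw_def by (intro lin_sum_list) (auto intro: lin_vs)

lemma linear_sw: "Vector_Spaces.linear sV sW f \<Longrightarrow> f (sw x B) = sw x (\<lambda>a b. f (B a b))"
proof -
  assume f: "Vector_Spaces.linear sV sW f"
  interpret f: Vector_Spaces.linear sV sW f by fact
  have "f (\<Sum>(a, b)\<leftarrow>ps. B a b) = (\<Sum>(a, b)\<leftarrow>ps. f (B a b))" for ps
    by (induction ps) (auto simp: f.add f.zero)
  then show ?thesis by (simp add: sw_def)
qed

lemma sw_add:
  assumes "\<And>b. lin sW (\<lambda>a. B a b)" "\<And>a. lin sW (\<lambda>b. B a b)"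
  shows "sw (x + y) B = sw x B + sw y B"
  using tensor_eq_bilinear[OF comult_add assms, of x y]
  by (simp add: sw_def o_def case_prod_unfold)

lemma sw_scale:
  assumes "\<And>b. lin sW (\<lambda>a. B a b)" "\<And>a. lin sW (\<lambda>b. B a b)"
  shows "sw (scale c x) B = sW c (sw x B)"
proof -
  have "sw (scale c x) B = sw x (\<lambda>a b. B (scale c a) b)"
    using tensor_eq_bilinear[OF comult_scale assms, of c x]
    by (simp add: sw_def o_def case_prod_unfold)
  also have "\<dots> = sw x (\<lambda>a b. sW c (B a b))"
    using assms by (simp add: Vector_Spaces.linear_iff)
  also have "\<dots> = sW c (sw x B)"
    using lin_vs[OF assms(1)] by (intro linear_sw[symmetric])
      (auto simp: Vector_Spaces.linear_iff vector_space.vector_space_assms mult.commute)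
  finally show ?thesis .
qed

lemma lin_sw_arg:
  assumes "\<And>b. lin sW (\<lambda>a. B a b)" "\<And>a. lin sW (\<lambda>b. B a b)" "lin scale f"
  shows "lin sW (\<lambda>x. sw (f x) B)"
  using lin_vs[OF assms(1)] assms(3) 
  by (auto simp: Vector_Spaces.linear_iff sw_add[OF assms(1,2)] sw_scale[OF assms(1,2)])

text \<open>
  These rules decompose the multilinear expressions that occur as summands. The composition
  rule is left out: its conclusion matches every goal, so it is instantiated with each
  given map separately.
\<close>

lemmas lin_intros =
  lin_id lin_scale lin_scale_arg lin_mult_arg lin_times_left lin_times_right lin_antipode lin_counit
  lin_sw lin_sw_arg

lemma sw_mult:
  assumes "\<And>b. lin sW (\<lambda>a. B a b)" "\<And>a. lin sW (\<lambda>b. B a b)"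
  shows "sw (x * y) B = sw x (\<lambda>a b. sw y (\<lambda>a' b'. B (a * a') (b * b')))"
  using tensor_eq_bilinear[OF comult_mult assms, of x y]
  by (simp add: sw_def o_def case_prod_unfold sum_list_concat_map)

lemma sw_one:
  assumes "\<And>b. lin sW (\<lambda>a. B a b)" "\<And>a. lin sW (\<lambda>b. B a b)"
  shows "sw 1 B = B 1 1"
  using tensor_eq_bilinear[OF comult_one assms]
  by (simp add: sw_def o_def case_prod_unfold)

lemma sw_coassoc:
  assumes "\<And>b c. lin sW (\<lambda>a. T a b c)" "\<And>a c. lin sW (\<lambda>b. T a b c)" "\<And>a b. lin sW (\<lambda>c. T a b c)"
  shows "sw x (\<lambda>p c. sw p (\<lambda>a b. T a b c)) = sw x (\<lambda>a q. sw q (\<lambda>b c. T a b c))"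
  using tensor_eq_trilinear[OF coassoc assms, of x]
  by (simp add: sw_def o_def case_prod_unfold sum_list_concat_map)

lemma sw_cong: "(\<And>a b. B a b = B' a b) \<Longrightarrow> sw x B = sw x B'"
  by (simp add: sw_def)

lemma sw_swap:
  fixes B :: "'h \<Rightarrow> 'h \<Rightarrow> 'h \<Rightarrow> 'h \<Rightarrow> 'w::ab_group_add"
  shows "sw x (\<lambda>a b. sw y (\<lambda>c d. B a b c d)) = sw y (\<lambda>c d. sw x (\<lambda>a b. B a b c d))"
proof -
  have "(\<Sum>p\<leftarrow>ps. \<Sum>q\<leftarrow>qs. F p q) = (\<Sum>q\<leftarrow>qs. \<Sum>p\<leftarrow>ps. F p q)"
    for F :: "'h \<times> 'h \<Rightarrow> 'h \<times> 'h \<Rightarrow> 'w" and ps qs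
    by (induction ps) (auto simp: sum_list_addf)
  then show ?thesis by (simp add: sw_def case_prod_unfold)
qed

lemma sw_sum: "(\<Sum>i\<in>A. sw x (F i)) = sw x (\<lambda>a b. \<Sum>i\<in>A. F i a b)"
  for F :: "'i \<Rightarrow> 'h \<Rightarrow> 'h \<Rightarrow> 'w::ab_group_add"
proof -
  have "(\<Sum>i\<in>A. \<Sum>p\<leftarrow>ps. F i (fst p) (snd p)) = (\<Sum>p\<leftarrow>ps. \<Sum>i\<in>A. F i (fst p) (snd p))" for ps
    by (induction ps) (auto simp: sum.distrib)
  then show ?thesis by (simp add: sw_def case_prod_unfold)
qed

lemma lin_zero: "lin sW f \<Longrightarrow> f 0 = 0"
  using module_hom.zero[of scale sW f] by (simp add: module_hom_iff_linear)

lemma lin_diff: "lin sW f \<Longrightarrow> f (x - y) = f x - f y"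
  using module_hom.diff[of scale sW f] by (simp add: module_hom_iff_linear)

lemma lin_scaleD: "lin sW f \<Longrightarrow> f (scale c x) = sW c (f x)"
  by (simp add: Vector_Spaces.linear_iff)

lemma sw_counit_left: "lin sW f \<Longrightarrow> sw x (\<lambda>a b. sW (counit a) (f b)) = f x"
  using linear_sw[of scale sW f x "\<lambda>a b. scale (counit a) b"] counit_left[of x]
  by (simp add: lin_scaleD sw_def)

lemma sw_counit_right: "lin sW f \<Longrightarrow> sw x (\<lambda>a b. sW (counit b) (f a)) = f x"
  using linear_sw[of scale sW f x "\<lambda>a b. scale (counit b) a"] counit_right[of x]
  by (simp add: lin_scaleD sw_def)

lemma sw_antipode_left: "lin sW f \<Longrightarrow> sw x (\<lambda>a b. f (antipode a * b)) = sW (counit x) (f 1)"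
  using linear_sw[of scale sW f x "\<lambda>a b. antipode a * b"] antipode_left[of x]
  by (simp add: lin_scaleD sw_def)

lemma sw_antipode_right: "lin sW f \<Longrightarrow> sw x (\<lambda>a b. f (a * antipode b)) = sW (counit x) (f 1)"
  using linear_sw[of scale sW f x "\<lambda>a b. a * antipode b"] antipode_right[of x]
  by (simp add: lin_scaleD sw_def)

text \<open>
  The antipode axiom under an iterated coproduct. The sums below are regrouped by coassociativity
  until adjacent legs meet, on the inner right or on the inner left, and cancel in this form.
\<close>

lemma sw_cancel:
  assumes "\<And>b. lin sW (\<lambda>a. F a b)" "\<And>a. lin sW (\<lambda>b. F a b)"
  shows sw_cancel_right_left: "sw x (\<lambda>a q. sw q (\<lambda>b c. F a (antipode b * c))) = F x 1"
    and sw_cancel_right_right: "sw x (\<lambda>a q. sw q (\<lambda>b c. F a (b * antipode c))) = F x 1"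
    and sw_cancel_left_left: "sw x (\<lambda>p c. sw p (\<lambda>a b. F (antipode a * b) c)) = F 1 x"
    and sw_cancel_left_right: "sw x (\<lambda>p c. sw p (\<lambda>a b. F (a * antipode b) c)) = F 1 x"
  using assms
  by (simp_all add: sw_antipode_left[of sW "F _"] sw_antipode_right[of sW "F _"]
      sw_antipode_left[of sW "\<lambda>a. F a _"] sw_antipode_right[of sW "\<lambda>a. F a _"]
      sw_counit_left sw_counit_right[of sW "\<lambda>a. F a _"])

lemma antipode_one: "antipode 1 = 1"
proof -
  have "antipode 1 = sw 1 (\<lambda>a b. antipode a * b)"
    by (subst sw_one[where sW = scale]) (intro lin_intros | simp)+
  also have "\<dots> = 1"
    using sw_antipode_left[OF lin_id, of 1] by (simp add: counit_one)
  finally show ?thesis .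
qed

text \<open>
  Both \<open>(x, y) \<mapsto> S(x y)\<close> and \<open>(x, y) \<mapsto> S(y) S(x)\<close> invert the multiplication for convolution:
  evaluate \<open>\<Sum> S(x\<^sub>1 y\<^sub>1) x\<^sub>2 y\<^sub>2 S(y\<^sub>3) S(x\<^sub>3)\<close> in the two possible orders.
\<close>

lemma antipode_mult: "antipode (x * y) = antipode y * antipode x"
proof -
  define M where "M x1 x2 x3 y1 y2 y3 =
    antipode (x1 * y1) * (x2 * y2) * (antipode y3 * antipode x3)" for x1 x2 x3 y1 y2 y3
  have "sw x (\<lambda>x1 q. sw q (\<lambda>x2 x3. sw y (\<lambda>y1 r. sw r (\<lambda>y2 y3. M x1 x2 x3 y1 y2 y3))))
      = sw x (\<lambda>x1 q. sw q (\<lambda>x2 x3. sw y (\<lambda>y1 r. sw r (\<lambda>y2 y3.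
          (\<lambda>a b. antipode (x1 * a) * (x2 * b * antipode x3)) y1 (y2 * antipode y3)))))"
    by (simp add: M_def mult.assoc)
  also have "\<dots> = sw x (\<lambda>x1 q. sw q (\<lambda>x2 x3. antipode (x1 * y) * (x2 * antipode x3)))"
    by (rule sw_cong, rule sw_cong, rule sw_cancel_right_right[where sW = scale, THEN trans])
      ((intro lin_intros)+, simp)
  also have "\<dots> = antipode (x * y)"
    by (rule sw_cancel_right_right[where sW = scale and F = "\<lambda>a b. antipode (a * y) * b", THEN trans])
      ((intro lin_intros)+, simp)
  finally have 1: "sw x (\<lambda>x1 q. sw q (\<lambda>x2 x3. sw y (\<lambda>y1 r. sw r (\<lambda>y2 y3. M x1 x2 x3 y1 y2 y3))))
    = antipode (x * y)" .
  have "sw x (\<lambda>x1 q. sw q (\<lambda>x2 x3. sw y (\<lambda>y1 r. sw r (\<lambda>y2 y3. M x1 x2 x3 y1 y2 y3))))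
      = sw x (\<lambda>x1 q. sw q (\<lambda>x2 x3. sw y (\<lambda>r y3. sw r (\<lambda>y1 y2. M x1 x2 x3 y1 y2 y3))))"
    by (rule sw_cong, rule sw_cong, rule sw_coassoc[symmetric, where sW = scale])
      (unfold M_def, (intro lin_intros)+)
  also have "\<dots> = sw x (\<lambda>q x3. sw q (\<lambda>x1 x2. sw y (\<lambda>r y3. sw r (\<lambda>y1 y2. M x1 x2 x3 y1 y2 y3))))"
    by (rule sw_coassoc[symmetric, where sW = scale]) (unfold M_def, (intro lin_intros)+)
  also have "\<dots> = sw x (\<lambda>q x3. sw y (\<lambda>r y3. sw q (\<lambda>x1 x2. sw r (\<lambda>y1 y2. M x1 x2 x3 y1 y2 y3))))"
    by (rule sw_cong, rule sw_swap)
  also have "\<dots> = sw x (\<lambda>q x3. sw y (\<lambda>r y3. sw (q * r) (\<lambda>a b. antipode a * b * (antipode y3 * antipode x3))))"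
    unfolding M_def
    by (rule sw_cong, rule sw_cong, rule sw_mult[symmetric, where sW = scale]) (intro lin_intros)+
  also have "\<dots> = sw x (\<lambda>q x3. sw y (\<lambda>r y3. scale (counit q) (scale (counit r) (antipode y3 * antipode x3))))"
    by (rule sw_cong, rule sw_cong,
        rule sw_antipode_left[where sW = scale and f = "\<lambda>a. a * _", THEN trans])
      ((intro lin_intros)+, simp add: counit_mult)
  also have "\<dots> = sw x (\<lambda>q x3. scale (counit q) (antipode y * antipode x3))"
    by (rule sw_cong, subst linear_sw[symmetric, where sV = scale and sW = scale and f = "scale _"],
        (intro lin_intros)+,
        subst sw_counit_left[where sW = scale and f = "\<lambda>y3. antipode y3 * antipode _"],
        (intro lin_intros)+, simp)
  also have "\<dots> = antipode y * antipode x"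
    by (rule sw_counit_left[where sW = scale]) (intro lin_intros)+
  finally show ?thesis using 1 by simp
qed

text \<open>
  Dually, \<open>\<Delta> \<circ> S\<close> and the flipped \<open>(S \<otimes> S) \<circ> \<Delta>\<close> both invert \<open>\<Delta>\<close> for convolution: evaluate
  \<open>\<Sum> S(x\<^sub>1)\<^sub>1 x\<^sub>2 S(x\<^sub>5) \<otimes> S(x\<^sub>1)\<^sub>2 x\<^sub>3 S(x\<^sub>4)\<close> in two orders.
\<close>

lemma antipode_comult:
  assumes B1: "\<And>b. lin sW (\<lambda>a. B a b)" and B2: "\<And>a. lin sW (\<lambda>b. B a b)"
  shows "sw (antipode x) B = sw x (\<lambda>a b. B (antipode b) (antipode a))"
proof -
  note li = lin_intros lin_compose[OF B1] lin_compose[OF B2]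
  define G where "G x1 x2 x3 x4 x5 =
    sw (antipode x1) (\<lambda>u v. B (u * (x2 * antipode x5)) (v * (x3 * antipode x4)))" for x1 x2 x3 x4 x5
  define M where "M = sw x (\<lambda>x1 r. sw r (\<lambda>q s. sw q (\<lambda>x2 x3. sw s (\<lambda>x4 x5. G x1 x2 x3 x4 x5))))"
  have "M = sw x (\<lambda>x1 r. sw r (\<lambda>x2 t. sw t (\<lambda>x3 s. sw s (\<lambda>x4 x5. G x1 x2 x3 x4 x5))))"
    unfolding M_def by (rule sw_cong, rule sw_coassoc[where sW = sW]) (unfold G_def, (intro li)+)
  also have "\<dots> = sw x (\<lambda>x1 r. sw r (\<lambda>x2 t. sw t (\<lambda>p x5. sw p (\<lambda>x3 x4. G x1 x2 x3 x4 x5))))"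
    by (rule sw_cong, rule sw_cong, rule sw_coassoc[symmetric, where sW = sW])
      (unfold G_def, (intro li)+)
  also have "\<dots> = sw x (\<lambda>x1 r. sw r (\<lambda>x2 t. sw (antipode x1) (\<lambda>u v. B (u * (x2 * antipode t)) (v * 1))))"
    unfolding G_def
    by (rule sw_cong, rule sw_cong, rule sw_cancel_left_right[where sW = sW
        and F = "\<lambda>w x5. sw (antipode _) (\<lambda>u v. B (u * (_ * antipode x5)) (v * w))"])
      (intro li)+
  also have "\<dots> = sw (antipode x) (\<lambda>u v. B (u * 1) (v * 1))"
    by (rule sw_cancel_right_right[where sW = sW
        and F = "\<lambda>x1 w. sw (antipode x1) (\<lambda>u v. B (u * w) (v * 1))"])
      (intro li)+
  finally have 1: "M = sw (antipode x) B" by simp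
  have "M = sw x (\<lambda>p s. sw p (\<lambda>x1 q. sw q (\<lambda>x2 x3. sw s (\<lambda>x4 x5. G x1 x2 x3 x4 x5))))"
    unfolding M_def by (rule sw_coassoc[symmetric, where sW = sW]) (unfold G_def, (intro li)+)
  also have "\<dots> = sw x (\<lambda>p s. sw p (\<lambda>x1 q. sw s (\<lambda>x4 x5. sw q (\<lambda>x2 x3. G x1 x2 x3 x4 x5))))"
    by (rule sw_cong, rule sw_cong, rule sw_swap)
  also have "\<dots> = sw x (\<lambda>p s. sw p (\<lambda>x1 q. sw s (\<lambda>x4 x5. sw (antipode x1) (\<lambda>u v. sw q (\<lambda>x2 x3.
      B (u * x2 * antipode x5) (v * x3 * antipode x4))))))"
    unfolding G_def mult.assoc by (rule sw_cong, rule sw_cong, rule sw_cong, rule sw_swap)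
  also have "\<dots> = sw x (\<lambda>p s. sw p (\<lambda>x1 q. sw s (\<lambda>x4 x5. sw (antipode x1 * q) (\<lambda>u v.
      B (u * antipode x5) (v * antipode x4)))))"
    by (rule sw_cong, rule sw_cong, rule sw_cong, rule sw_mult[symmetric, where sW = sW]) (intro li)+
  also have "\<dots> = sw x (\<lambda>x4 x5. sw 1 (\<lambda>u v. B (u * antipode x5) (v * antipode x4)))"
    by (rule sw_cancel_left_left[where sW = sW and F = "\<lambda>w s. sw s (\<lambda>x4 x5. sw w (\<lambda>u v.
      B (u * antipode x5) (v * antipode x4)))"]) (intro li)+
  also have "\<dots> = sw x (\<lambda>x4 x5. B (1 * antipode x5) (1 * antipode x4))"
    by (rule sw_cong, rule sw_one[where sW = sW]) (intro li)+
  finally show ?thesis using 1 by simp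
qed

lemma antipode2_comult:
  assumes B1: "\<And>b. lin sW (\<lambda>a. B a b)" and B2: "\<And>a. lin sW (\<lambda>b. B a b)"
  shows "sw (antipode (antipode x)) B = sw x (\<lambda>a b. B (antipode (antipode a)) (antipode (antipode b)))"
proof -
  note li = lin_intros lin_compose[OF B1] lin_compose[OF B2]
  have "sw (antipode (antipode x)) B = sw (antipode x) (\<lambda>a b. B (antipode b) (antipode a))"
    by (rule antipode_comult[OF B1 B2])
  also have "\<dots> = sw x (\<lambda>a b. B (antipode (antipode a)) (antipode (antipode b)))"
    by (rule antipode_comult[where sW = sW]) (intro li)+
  finally show ?thesis .
qed

lemma counit_antipode: "counit (antipode x) = counit x"
proof -
  have "counit (antipode x) = sw x (\<lambda>a b. counit b * counit (antipode a))"
    by (rule sw_counit_right[symmetric]) (intro lin_intros)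
  also have "\<dots> = sw x (\<lambda>a b. counit (antipode a * b))"
    by (simp add: counit_mult mult.commute)
  also have "\<dots> = counit x"
    by (subst sw_antipode_left[OF counit_linear]) (simp add: counit_one)
  finally show ?thesis .
qed

end

section \<open>The Casimir tensor of the integral\<close>

locale hopf_integral = hopf_algebra scale comult counit antipode
  for scale :: "'k::field \<Rightarrow> 'h::ring_1 \<Rightarrow> 'h"
    and comult :: "'h \<Rightarrow> ('h \<times> 'h) list" and counit :: "'h \<Rightarrow> 'k" and antipode :: "'h \<Rightarrow> 'h" +
  fixes L :: 'h
  assumes integral: "idempotent_integral scale counit L"
begin

lemma L_left: "h * L = scale (counit h) L"
  and L_right: "L * h = scale (counit h) L"
  and counit_L: "counit L = 1"
  using integral by (auto simp: idempotent_integral_def)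

text \<open>
  An element passes from one leg of \<open>\<Delta>(\<Lambda>)\<close> to the other through the antipode: insert
  \<open>h\<^sub>2 S(h\<^sub>3)\<close>, respectively \<open>S(h\<^sub>1) h\<^sub>2\<close>, and use that \<open>\<Lambda>\<close> absorbs what multiplies both legs.
\<close>

lemma sw_L_shift_right:
  assumes F1: "\<And>b. lin sW (\<lambda>a. F a b)" and F2: "\<And>a. lin sW (\<lambda>b. F a b)"
  shows "sw L (\<lambda>a b. F (a * h) b) = sw L (\<lambda>a b. F a (b * antipode h))"
proof -
  note li = lin_intros lin_compose[OF F1] lin_compose[OF F2]
  have "sw L (\<lambda>a b. F a (b * antipode h))
      = sw h (\<lambda>h' h3. sW (counit h') (sw L (\<lambda>p q. F p (q * antipode h3))))"
    by (rule sw_counit_left[symmetric]) (intro li)+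
  also have "\<dots> = sw h (\<lambda>h' h3. sw (L * h') (\<lambda>p q. F p (q * antipode h3)))"
    unfolding L_right by (rule sw_cong, rule sw_scale[symmetric]) (intro li)+
  also have "\<dots> = sw h (\<lambda>h' h3. sw L (\<lambda>p q. sw h' (\<lambda>h1 h2. F (p * h1) (q * h2 * antipode h3))))"
    by (rule sw_cong, rule sw_mult[where sW = sW]) (intro li)+
  also have "\<dots> = sw L (\<lambda>p q. sw h (\<lambda>h' h3. sw h' (\<lambda>h1 h2. F (p * h1) (q * (h2 * antipode h3)))))"
    unfolding mult.assoc by (rule sw_swap)
  also have "\<dots> = sw L (\<lambda>p q. sw h (\<lambda>h1 r. sw r (\<lambda>h2 h3. F (p * h1) (q * (h2 * antipode h3)))))"
    by (rule sw_cong, rule sw_coassoc[where sW = sW]) (intro li)+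
  also have "\<dots> = sw L (\<lambda>p q. F (p * h) (q * 1))"
    by (rule sw_cong, rule sw_cancel_right_right[where sW = sW and F = "\<lambda>a b. F (_ * a) (_ * b)"])
      (intro li)+
  finally show ?thesis by simp
qed

lemma sw_L_shift_left:
  assumes F1: "\<And>b. lin sW (\<lambda>a. F a b)" and F2: "\<And>a. lin sW (\<lambda>b. F a b)"
  shows "sw L (\<lambda>a b. F a (h * b)) = sw L (\<lambda>a b. F (antipode h * a) b)"
proof -
  note li = lin_intros lin_compose[OF F1] lin_compose[OF F2]
  have "sw L (\<lambda>a b. F (antipode h * a) b)
      = sw h (\<lambda>h1 r. sW (counit r) (sw L (\<lambda>p q. F (antipode h1 * p) q)))"
    by (rule sw_counit_right[symmetric]) (intro li)+
  also have "\<dots> = sw h (\<lambda>h1 r. sw (r * L) (\<lambda>p q. F (antipode h1 * p) q))"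
    unfolding L_left by (rule sw_cong, rule sw_scale[symmetric]) (intro li)+
  also have "\<dots> = sw h (\<lambda>h1 r. sw r (\<lambda>h2 h3. sw L (\<lambda>p q. F (antipode h1 * (h2 * p)) (h3 * q))))"
    by (rule sw_cong, rule sw_mult[where sW = sW]) (intro li)+
  also have "\<dots> = sw h (\<lambda>r h3. sw r (\<lambda>h1 h2. sw L (\<lambda>p q. F (antipode h1 * (h2 * p)) (h3 * q))))"
    by (rule sw_coassoc[symmetric, where sW = sW]) (intro li)+
  also have "\<dots> = sw h (\<lambda>r h3. sw r (\<lambda>h1 h2. sw L (\<lambda>p q. F (antipode h1 * h2 * p) (h3 * q))))"
    by (simp add: mult.assoc)
  also have "\<dots> = sw L (\<lambda>p q. F (1 * p) (h * q))"
    by (rule sw_cancel_left_left[where sW = sW and F = "\<lambda>a b. sw L (\<lambda>p q. F (a * p) (b * q))"])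
      (intro li)+
  finally show ?thesis by simp
qed

text \<open>
  The element \<open>\<Sum> \<Lambda>\<^sub>1 \<otimes> S(\<Lambda>\<^sub>2)\<close> commutes with \<open>H\<close>; together with \<open>\<Sum> \<Lambda>\<^sub>1 S(\<Lambda>\<^sub>2) = 1\<close> this
  makes it a separability idempotent.
\<close>

lemma casimir_central:
  assumes F1: "\<And>b. lin sW (\<lambda>a. F a b)" and F2: "\<And>a. lin sW (\<lambda>b. F a b)"
  shows "sw L (\<lambda>a b. F (h * a) (antipode b)) = sw L (\<lambda>a b. F a (antipode b * h))"
proof -
  note li = lin_intros lin_compose[OF F1] lin_compose[OF F2]
  have "sw L (\<lambda>a b. F a (antipode b * h))
      = sw h (\<lambda>h' h3. sW (counit h') (sw L (\<lambda>p q. F p (antipode q * h3))))"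
    by (rule sw_counit_left[symmetric]) (intro li)+
  also have "\<dots> = sw h (\<lambda>h' h3. sw (h' * L) (\<lambda>p q. F p (antipode q * h3)))"
    unfolding L_left by (rule sw_cong, rule sw_scale[symmetric]) (intro li)+
  also have "\<dots> = sw h (\<lambda>h' h3. sw h' (\<lambda>h1 h2. sw L (\<lambda>p q. F (h1 * p) (antipode (h2 * q) * h3))))"
    by (rule sw_cong, rule sw_mult[where sW = sW]) (intro li)+
  also have "\<dots> = sw h (\<lambda>h' h3. sw h' (\<lambda>h1 h2. sw L (\<lambda>p q. F (h1 * p) (antipode q * (antipode h2 * h3)))))"
    by (simp add: antipode_mult mult.assoc)
  also have "\<dots> = sw h (\<lambda>h1 r. sw r (\<lambda>h2 h3. sw L (\<lambda>p q. F (h1 * p) (antipode q * (antipode h2 * h3)))))"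
    by (rule sw_coassoc[where sW = sW]) (intro li)+
  also have "\<dots> = sw L (\<lambda>p q. F (h * p) (antipode q * 1))"
    by (rule sw_cancel_right_left[where sW = sW and F = "\<lambda>a b. sw L (\<lambda>p q. F (a * p) (antipode q * b))"])
      (intro li)+
  finally show ?thesis by simp
qed

lemma casimir_mult: "sw L (\<lambda>a b. a * antipode b) = 1"
  by (subst sw_antipode_right[OF lin_id]) (simp add: counit_L)

definition u :: 'h where "u = sw L (\<lambda>a b. antipode b * a)"



lemma antipode2_u: "antipode (antipode h) * u = u * h"
proof -
  have "u * h = sw L (\<lambda>a b. antipode b * (a * h))"
    unfolding u_def by (subst linear_sw[OF lin_times_right[OF lin_id]]) (simp add: mult.assoc)
  also have "\<dots> = sw L (\<lambda>a b. antipode (b * antipode h) * a)"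
    by (rule sw_L_shift_right[where sW = scale and F = "\<lambda>a b. antipode b * a"]) (intro lin_intros)+
  also have "\<dots> = antipode (antipode h) * u"
    unfolding u_def by (subst linear_sw[OF lin_times_left[OF lin_id]]) (simp add: antipode_mult mult.assoc)
  finally show ?thesis by simp
qed

end

section \<open>Matrices of linear operators\<close>

text \<open>
  The family spans a subspace \<open>V\<close> of the ambient space, so that the results apply to left ideals
  as well as to the whole algebra.
\<close>

locale indexed_family = vector_space scale
  for scale :: "'k::field \<Rightarrow> 'v::ab_group_add \<Rightarrow> 'v" +
  fixes d :: nat and b :: "nat \<Rightarrow> 'v"
  assumes inj: "inj_on b {..<d}" and indep: "independent (b ` {..<d})"
begin

abbreviation V :: "'v set" where "V \<equiv> span (b ` {..<d})"

definition coord :: "'v \<Rightarrow> nat \<Rightarrow> 'k" where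
  "coord x i = representation (b ` {..<d}) x (b i)"

lemma coord_expand: "x \<in> V \<Longrightarrow> (\<Sum>i<d. scale (coord x i) (b i)) = x"
  using sum_representation_eq[OF indep, of x "b ` {..<d}"] inj
  by (simp add: coord_def sum.reindex)

lemma coord_unique:
  assumes "x = (\<Sum>i<d. scale (c i) (b i))" "i < d"
  shows "coord x i = c i"
proof -
  have x: "x \<in> V"
    unfolding assms(1) by (intro span_sum span_scale span_base) auto
  have "(\<Sum>i<d. scale (coord x i - c i) (b i)) = 0"
    using coord_expand[OF x] assms(1) by (simp add: scale_left_diff_distrib sum_subtractf)
  then have "(\<Sum>v\<in>b ` {..<d}. scale (coord x (the_inv_into {..<d} b v) - c (the_inv_into {..<d} b v)) v) = 0"
    using inj by (simp add: sum.reindex the_inv_into_f_f)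
  from independentD[OF indep _ _ this, of "b i"] show ?thesis
    using assms(2) inj by (simp add: the_inv_into_f_f)
qed

lemma coord_add: "x \<in> V \<Longrightarrow> y \<in> V \<Longrightarrow> coord (x + y) i = coord x i + coord y i"
  by (simp add: coord_def representation_add[OF indep])

lemma coord_scale: "x \<in> V \<Longrightarrow> coord (scale c x) i = c * coord x i"
  by (simp add: coord_def representation_scale[OF indep])

lemma coord_basis: "i < d \<Longrightarrow> j < d \<Longrightarrow> coord (b j) i = (if i = j then 1 else 0)"
  using inj by (auto simp: coord_def representation_basis[OF indep] inj_on_def)

lemma b_in_V: "i < d \<Longrightarrow> b i \<in> V"
  by (intro span_base) auto

definition op_mat :: "('v \<Rightarrow> 'v) \<Rightarrow> 'k mat" where
  "op_mat f = mat d d (\<lambda>(i, j). coord (f (b j)) i)"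

lemma op_mat_carrier: "op_mat f \<in> carrier_mat d d"
  by (simp add: op_mat_def)

lemma coord_op:
  assumes f: "Vector_Spaces.linear scale scale f" and fV: "\<And>x. x \<in> V \<Longrightarrow> f x \<in> V"
    and x: "x \<in> V" and i: "i < d"
  shows "coord (f x) i = (\<Sum>j<d. op_mat f $$ (i, j) * coord x j)"
proof -
  interpret f: Vector_Spaces.linear scale scale f by fact
  have "f x = (\<Sum>j<d. scale (coord x j) (f (b j)))"
    using coord_expand[OF x, symmetric] by (metis (no_types, lifting) f.scale f.sum sum.cong)
  also have "\<dots> = (\<Sum>j<d. scale (coord x j) (\<Sum>i<d. scale (coord (f (b j)) i) (b i)))"
    by (simp add: coord_expand fV b_in_V)
  also have "\<dots> = (\<Sum>i<d. scale (\<Sum>j<d. coord (f (b j)) i * coord x j) (b i))"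
    unfolding scale_sum_right scale_sum_left
    by (subst sum.swap) (simp add: mult.commute)
  finally show ?thesis
    using i by (simp add: coord_unique op_mat_def)
qed

lemma op_mat_compose:
  assumes f: "Vector_Spaces.linear scale scale f" and fV: "\<And>x. x \<in> V \<Longrightarrow> f x \<in> V"
    and gV: "\<And>x. x \<in> V \<Longrightarrow> g x \<in> V"
  shows "op_mat (\<lambda>x. f (g x)) = op_mat f * op_mat g"
proof (rule eq_matI)
  fix i j assume "i < dim_row (op_mat f * op_mat g)" "j < dim_col (op_mat f * op_mat g)"
  then have ij: "i < d" "j < d" by (simp_all add: op_mat_def)
  have "coord (f (g (b j))) i = (\<Sum>m<d. op_mat f $$ (i, m) * coord (g (b j)) m)"
    using ij by (intro coord_op[OF f fV] gV b_in_V)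
  then show "op_mat (\<lambda>x. f (g x)) $$ (i, j) = (op_mat f * op_mat g) $$ (i, j)"
    using ij by (simp add: op_mat_def scalar_prod_def atLeast0LessThan)
qed (simp_all add: op_mat_def)

lemma op_mat_id: "op_mat (\<lambda>x. x) = 1\<^sub>m d"
  by (rule eq_matI) (auto simp: op_mat_def coord_basis)

lemma eigenvalue_op_mat_iff:
  assumes f: "Vector_Spaces.linear scale scale f" and V: "V = UNIV"
  shows "eigenvalue (op_mat f) e \<longleftrightarrow> (\<exists>x. x \<noteq> 0 \<and> f x = scale e x)"
proof
  assume "eigenvalue (op_mat f) e"
  then obtain w where w: "w \<in> carrier_vec d" "w \<noteq> 0\<^sub>v d" "op_mat f *\<^sub>v w = e \<cdot>\<^sub>v w"
    by (auto simp: eigenvalue_def eigenvector_def op_mat_def)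
  define x where "x = (\<Sum>i<d. scale (w $ i) (b i))"
  have cx: "coord x i = w $ i" if "i < d" for i
    by (rule coord_unique[OF x_def that])
  have "coord (f x) i = coord (scale e x) i" if i: "i < d" for i
  proof -
    have "coord (f x) i = (op_mat f *\<^sub>v w) $ i"
      using i w(1) coord_op[OF f _ _ i, of x] op_mat_carrier[of f]
      by (simp add: V cx scalar_prod_def atLeast0LessThan)
    then show ?thesis using i w(1) by (simp add: w(3) coord_scale V cx)
  qed
  then have "(\<Sum>i<d. scale (coord (f x) i) (b i)) = (\<Sum>i<d. scale (coord (scale e x) i) (b i))"
    by (intro sum.cong) auto
  then have "f x = scale e x"
    by (simp only: coord_expand V UNIV_I)
  moreover have "x \<noteq> 0"
  proof
    assume "x = 0"
    then have "w $ i = 0" if "i < d" for i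
      using cx[OF that] coord_scale[of x 0 i] by (simp add: V)
    then show False using w by (metis carrier_vecD eq_vecI index_zero_vec)
  qed
  ultimately show "\<exists>x. x \<noteq> 0 \<and> f x = scale e x" by blast
next
  assume "\<exists>x. x \<noteq> 0 \<and> f x = scale e x"
  then obtain x where x: "x \<noteq> 0" "f x = scale e x" by blast
  define w where "w = vec d (coord x)"
  have "op_mat f *\<^sub>v w = e \<cdot>\<^sub>v w"
  proof (rule eq_vecI)
    fix i assume "i < dim_vec (e \<cdot>\<^sub>v w)"
    then have i: "i < d" by (simp add: w_def)
    have "(op_mat f *\<^sub>v w) $ i = coord (f x) i"
      using i coord_op[OF f _ _ i, of x] op_mat_carrier[of f]
      by (simp add: V w_def scalar_prod_def atLeast0LessThan)
    then show "(op_mat f *\<^sub>v w) $ i = (e \<cdot>\<^sub>v w) $ i"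
      using i by (simp add: x coord_scale V w_def)
  qed (simp add: w_def op_mat_def)
  moreover have "w \<noteq> 0\<^sub>v d"
  proof
    assume "w = 0\<^sub>v d"
    then have "coord x i = 0" if "i < d" for i
      using that by (metis index_vec index_zero_vec(1) w_def)
    then show False using coord_expand[of x] x by (simp add: V)
  qed
  ultimately show "eigenvalue (op_mat f) e"
    by (auto simp: eigenvalue_def eigenvector_def op_mat_def w_def intro!: exI[of _ "vec d (coord x)"])
qed

end

lemma (in vector_space) finite_if_independent:
  assumes "\<exists>B. finite B \<and> span B = UNIV" and "independent B"
  shows "finite B"
  using assms independent_span_bound by (metis subset_UNIV)

lemma (in vector_space) subspace_indexed_basis:
  assumes fin: "\<exists>B. finite B \<and> span B = UNIV" and I: "subspace I"
  obtains d b where "indexed_family scale d b" "span (b ` {..<d}) = I"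
proof -
  obtain B where B: "B \<subseteq> I" "independent B" "I \<subseteq> span B" "card B = dim I"
    by (rule basis_exists[of I])
  have "finite B" by (rule finite_if_independent[OF fin B(2)])
  then obtain b where b: "bij_betw b {0..<card B} B"
    using ex_bij_betw_nat_finite by blast
  then have img: "b ` {..<card B} = B" and inj: "inj_on b {..<card B}"
    by (auto simp: bij_betw_def atLeast0LessThan)
  show ?thesis
  proof
    show "indexed_family scale (card B) b"
      using B inj img by unfold_locales auto
    show "span (b ` {..<card B}) = I"
      using B img I by (simp add: span_subspace)
  qed
qed

section \<open>Schur's lemma\<close>

lemma mat_trace_commute:
  assumes "A \<in> carrier_mat n m" "B \<in> carrier_mat m n"
  shows "mat_trace (A * B) = mat_trace (B * A)"
proof -
  have "mat_trace (A * B) = (\<Sum>i<n. \<Sum>j<m. A $$ (i, j) * B $$ (j, i))"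
    using assms by (simp add: mat_trace_def scalar_prod_def lessThan_atLeast0)
  also have "\<dots> = (\<Sum>j<m. \<Sum>i<n. B $$ (j, i) * A $$ (i, j))"
    by (subst sum.swap) (simp add: mult.commute)
  also have "\<dots> = mat_trace (B * A)"
    using assms by (simp add: mat_trace_def scalar_prod_def lessThan_atLeast0)
  finally show ?thesis .
qed

lemma mat_trace_smult: "A \<in> carrier_mat n n \<Longrightarrow> mat_trace (c \<cdot>\<^sub>m A) = c * mat_trace A"
  by (simp add: mat_trace_def sum_distrib_left)

lemma irreducible_repD:
  assumes "irreducible_rep scale d \<rho>"
  shows "\<rho> h \<in> carrier_mat d d" "\<rho> (x + y) = \<rho> x + \<rho> y" "\<rho> (scale c x) = c \<cdot>\<^sub>m \<rho> x"
    "\<rho> (x * y) = \<rho> x * \<rho> y" "\<rho> 1 = 1\<^sub>m d" "d > 0" "dim_row (\<rho> h) = d" "dim_col (\<rho> h) = d"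
    "invariant_subspace d \<rho> W \<Longrightarrow> W = {0\<^sub>v d} \<or> W = carrier_vec d"
  using assms by (auto simp: irreducible_rep_def matrix_rep_def carrier_matD)

lemma mult_mat_zero_vec: "A \<in> carrier_mat n m \<Longrightarrow> A *\<^sub>v 0\<^sub>v m = 0\<^sub>v n"
  by (intro eq_vecI) auto

lemma zero_mat_mult_vec: "w \<in> carrier_vec m \<Longrightarrow> 0\<^sub>m n m *\<^sub>v w = 0\<^sub>v n"
  by (intro eq_vecI) auto

lemma mat_eq_by_unit_vec:
  fixes A B :: "'a::semiring_1 mat"
  assumes "A \<in> carrier_mat n m" "B \<in> carrier_mat n m"
    and "\<And>j. j < m \<Longrightarrow> A *\<^sub>v unit_vec m j = B *\<^sub>v unit_vec m j"
  shows "A = B"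
proof (rule eq_matI)
  fix i j assume "i < dim_row B" "j < dim_col B"
  then show "A $$ (i, j) = B $$ (i, j)"
    using arg_cong[OF assms(3)[of j], of "\<lambda>v. v $ i"] assms(1,2)
    by simp
qed (use assms in auto)

text \<open>
  An eigenspace of a commuting matrix is a non-zero invariant subspace.
\<close>

lemma commutant_scalar:
  fixes \<rho> :: "'h::ring_1 \<Rightarrow> 'k::alg_closed_field mat"
  assumes irr: "irreducible_rep scale d \<rho>" and X: "X \<in> carrier_mat d d"
    and comm: "\<And>h. \<rho> h * X = X * \<rho> h"
  shows "\<exists>c. X = c \<cdot>\<^sub>m 1\<^sub>m d"
proof -
  note D = irreducible_repD[OF irr]
  have "degree (char_poly X) > 0"
    using degree_monic_char_poly[OF X] D(6) by simp
  then obtain c where "poly (char_poly X) c = 0"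
    using alg_closed_imp_poly_has_root by blast
  then have "eigenvalue X c"
    using eigenvalue_root_char_poly[OF X] by simp
  then obtain v where v: "v \<in> carrier_vec d" "v \<noteq> 0\<^sub>v d" "X *\<^sub>v v = c \<cdot>\<^sub>v v"
    using X by (auto simp: eigenvalue_def eigenvector_def)
  define W where "W = {v \<in> carrier_vec d. X *\<^sub>v v = c \<cdot>\<^sub>v v}"
  have "invariant_subspace d \<rho> W"
    unfolding invariant_subspace_def
  proof (intro conjI ballI allI)
    fix h v assume v: "v \<in> W"
    have "X *\<^sub>v (\<rho> h *\<^sub>v v) = (X * \<rho> h) *\<^sub>v v"
      using v X D(1)[of h] by (simp add: W_def)
    also have "\<dots> = \<rho> h *\<^sub>v (X *\<^sub>v v)"
      unfolding comm[symmetric] using v X D(1)[of h] by (simp add: W_def)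
    also have "\<dots> = c \<cdot>\<^sub>v (\<rho> h *\<^sub>v v)"
      using v D(1)[of h] by (simp add: W_def mult_mat_vec)
    finally show "\<rho> h *\<^sub>v v \<in> W"
      using v D(1)[of h] by (simp add: W_def)
  next
    fix a v assume "v \<in> W"
    then show "a \<cdot>\<^sub>v v \<in> W"
      using X by (auto simp: W_def mult_mat_vec smult_smult_assoc mult.commute)
  qed (use X in \<open>auto simp: W_def mult_add_distrib_mat_vec smult_add_distrib_vec\<close>)
  moreover have "v \<in> W" using v by (simp add: W_def)
  ultimately have W: "W = carrier_vec d"
    using D(9)[of W] v(2) by auto
  have "X = c \<cdot>\<^sub>m 1\<^sub>m d"
  proof (rule mat_eq_by_unit_vec)
    fix j assume "j < d"
    have "unit_vec d j \<in> W" unfolding W by simp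
    moreover have "c \<cdot>\<^sub>m 1\<^sub>m d *\<^sub>v unit_vec d j = c \<cdot>\<^sub>v unit_vec d j"
      using \<open>j < d\<close> by (intro eq_vecI) auto
    ultimately show "X *\<^sub>v unit_vec d j = c \<cdot>\<^sub>m 1\<^sub>m d *\<^sub>v unit_vec d j"
      by (simp add: W_def)
  qed (use X in auto)
  then show ?thesis by blast
qed

text \<open>
  Kernel and image of the intertwiner are invariant subspaces, so it is bijective. With a
  two-sided inverse \<open>Y\<close> the characters agree by \<open>tr(\<rho>(h) X Y) = tr(X \<sigma>(h) Y) = tr(\<sigma>(h) Y X)\<close>.
\<close>

lemma intertwiner_characters_eq:
  fixes \<rho> \<sigma> :: "'h::ring_1 \<Rightarrow> 'k::field mat"
  assumes irr: "irreducible_rep scale d \<rho>" and irr': "irreducible_rep scale e \<sigma>"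
    and X: "X \<in> carrier_mat d e"
    and comm: "\<And>h. \<rho> h * X = X * \<sigma> h" and nz: "X \<noteq> 0\<^sub>m d e"
  shows "mat_trace (\<rho> h) = mat_trace (\<sigma> h)"
proof -
  note D = irreducible_repD[OF irr] and D' = irreducible_repD[OF irr']
  have swap: "X *\<^sub>v (\<sigma> h *\<^sub>v v) = \<rho> h *\<^sub>v (X *\<^sub>v v)" if "v \<in> carrier_vec e" for h v
    using that X D(1)[of h] D'(1)[of h] comm[of h]
    by (metis assoc_mult_mat_vec)
  define K where "K = {v \<in> carrier_vec e. X *\<^sub>v v = 0\<^sub>v d}"
  have "invariant_subspace e \<sigma> K"
    unfolding invariant_subspace_def using X D'(1) D(1)
    by (auto simp: K_def mult_add_distrib_mat_vec mult_mat_vec swap mult_mat_zero_vec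
        intro!: mult_mat_vec_carrier)
  moreover have "K \<noteq> carrier_vec e"
  proof
    assume "K = carrier_vec e"
    then have "unit_vec e j \<in> K" for j by simp
    then have "X = 0\<^sub>m d e"
      by (intro mat_eq_by_unit_vec[OF X]) (auto simp: K_def)
    with nz show False by simp
  qed
  ultimately have K: "K = {0\<^sub>v e}" using D'(9) by blast
  define R where "R = (\<lambda>v. X *\<^sub>v v) ` carrier_vec e"
  have "invariant_subspace d \<rho> R"
    unfolding invariant_subspace_def
  proof (intro conjI ballI allI)
    show "0\<^sub>v d \<in> R"
      unfolding R_def using X by (intro image_eqI[of _ _ "0\<^sub>v e"]) auto
    show "v + w \<in> R" if "v \<in> R" "w \<in> R" for v w
      using that X unfolding R_def by (auto simp flip: mult_add_distrib_mat_vec)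
    show "c \<cdot>\<^sub>v v \<in> R" if "v \<in> R" for c v
      using that X unfolding R_def by (auto simp flip: mult_mat_vec)
    show "\<rho> h *\<^sub>v v \<in> R" if "v \<in> R" for h v
      using that D'(1)[of h] unfolding R_def by (auto simp flip: swap)
  qed (use X in \<open>auto simp: R_def\<close>)
  moreover have "R \<noteq> {0\<^sub>v d}"
  proof
    assume "R = {0\<^sub>v d}"
    then have "K = carrier_vec e" by (auto simp: R_def K_def)
    then show False using \<open>K \<noteq> carrier_vec e\<close> by simp
  qed
  ultimately have R: "R = carrier_vec d" using D(9) by blast
  have "\<exists>v. v \<in> carrier_vec e \<and> X *\<^sub>v v = unit_vec d i" for i
    using R unit_vec_carrier[of d i] unfolding R_def by (metis imageE)
  then obtain v where v: "\<And>i. v i \<in> carrier_vec e" "\<And>i. X *\<^sub>v v i = unit_vec d i"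
    by metis
  define Y where "Y = mat e d (\<lambda>(i, j). v j $ i)"
  have Y: "Y \<in> carrier_mat e d" by (simp add: Y_def)
  have XY: "X * Y = 1\<^sub>m d"
  proof (rule mat_eq_by_unit_vec)
    fix j assume j: "j < d"
    have "Y *\<^sub>v unit_vec d j = v j"
      using j v(1)[of j] by (auto simp: Y_def)
    then show "X * Y *\<^sub>v unit_vec d j = 1\<^sub>m d *\<^sub>v unit_vec d j"
      using X Y v(2)[of j] by simp
  qed (use X Y in auto)
  have YX: "Y * X = 1\<^sub>m e"
  proof (rule mat_eq_by_unit_vec)
    fix j assume j: "j < e"
    let ?w = "(Y * X) *\<^sub>v unit_vec e j - unit_vec e j"
    have "X *\<^sub>v ?w = X *\<^sub>v (Y * X *\<^sub>v unit_vec e j) - X *\<^sub>v unit_vec e j"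
      using X Y by (intro mult_minus_distrib_mat_vec) auto
    also have "X *\<^sub>v (Y * X *\<^sub>v unit_vec e j) = (X * Y) *\<^sub>v (X *\<^sub>v unit_vec e j)"
      using X Y by simp
    finally have "?w \<in> K"
      using X Y by (simp add: K_def XY)
    then have w: "?w = 0\<^sub>v e" using K by simp
    have "(Y * X *\<^sub>v unit_vec e j) = unit_vec e j"
    proof (rule eq_vecI)
      fix i assume "i < dim_vec (unit_vec e j)"
      then show "(Y * X *\<^sub>v unit_vec e j) $ i = unit_vec e j $ i"
        using arg_cong[OF w, of "\<lambda>v. v $ i"] X Y by (simp del: index_mult_mat_vec assoc_mult_mat_vec)
    qed (use Y in auto)
    then show "Y * X *\<^sub>v unit_vec e j = 1\<^sub>m e *\<^sub>v unit_vec e j"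
      by simp
  qed (use X Y in auto)
  have "mat_trace (\<rho> h) = mat_trace (\<rho> h * X * Y)"
    using D(1)[of h] X Y by (simp add: XY)
  also have "\<dots> = mat_trace (X * (\<sigma> h * Y))"
    using X Y D'(1)[of h] by (simp add: comm)
  also have "\<dots> = mat_trace ((\<sigma> h * Y) * X)"
    using X Y D'(1)[of h] by (intro mat_trace_commute) auto
  also have "\<dots> = mat_trace (\<sigma> h)"
    using X Y D'(1)[of h] by (simp add: YX)
  finally show ?thesis .
qed

section \<open>Irreducible representations of a separable algebra\<close>

text \<open>
  The list \<open>E\<close> represents a separability idempotent \<open>\<Sum> x \<otimes> y\<close>. Centrality is required only under
  bilinear forms, which suffices because it is applied to products of matrix entries.
\<close>

locale separable_algebra = vector_space scale
  for scale :: "'k::{alg_closed_field, field_char_0} \<Rightarrow> 'h::ring_1 \<Rightarrow> 'h" +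
  fixes E :: "('h \<times> 'h) list"
  assumes finite_dim: "\<exists>B. finite B \<and> span B = UNIV"
    and scale_mult_left: "scale c x * y = scale c (x * y)"
    and scale_mult_right: "x * scale c y = scale c (x * y)"
    and semisimple: "semisimple_algebra scale"
    and E_mult: "(\<Sum>(x, y)\<leftarrow>E. x * y) = 1"
    and E_central: "\<lbrakk>\<And>y. Vector_Spaces.linear scale (*) (\<lambda>x. F x y);
        \<And>x. Vector_Spaces.linear scale (*) (\<lambda>y. F x y)\<rbrakk> \<Longrightarrow>
      (\<Sum>(x, y)\<leftarrow>E. F (h * x) y) = (\<Sum>(x, y)\<leftarrow>E. F x (y * h) :: 'k)"
begin



definition esum :: "('h \<Rightarrow> 'h \<Rightarrow> 'w::ab_group_add) \<Rightarrow> 'w" where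
  "esum F = (\<Sum>(x, y)\<leftarrow>E. F x y)"

lemma esum_central:
  assumes "\<And>y. Vector_Spaces.linear scale (*) (\<lambda>x. F x y)"
    and "\<And>x. Vector_Spaces.linear scale (*) (\<lambda>y. F x y :: 'k)"
  shows "esum (\<lambda>x y. F (h * x) y) = esum (\<lambda>x y. F x (y * h))"
  unfolding esum_def by (rule E_central[OF assms])

lemma esum_cong: "(\<And>x y. F x y = G x y) \<Longrightarrow> esum F = esum G"
  by (simp add: esum_def)

lemma esum_sum:
  fixes F :: "'a \<Rightarrow> 'h \<Rightarrow> 'h \<Rightarrow> 'w::ab_group_add"
  shows "esum (\<lambda>x y. \<Sum>i\<in>A. F i x y) = (\<Sum>i\<in>A. esum (F i))"
proof -
  have "(\<Sum>z\<leftarrow>zs. \<Sum>i\<in>A. F i (fst z) (snd z)) = (\<Sum>i\<in>A. \<Sum>z\<leftarrow>zs. F i (fst z) (snd z))" for zs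
    by (induction zs) (auto simp: sum.distrib)
  then show ?thesis by (simp add: esum_def case_prod_unfold)
qed

lemma esum_mult_left: "esum (\<lambda>x y. c * F x y) = c * esum F" for c :: "'a::ring"
  by (simp add: esum_def sum_list_const_mult case_prod_unfold)

lemma esum_mult_right: "esum (\<lambda>x y. F x y * c) = esum F * c" for c :: "'a::ring"
  by (simp add: esum_def sum_list_mult_const case_prod_unfold)

lemma esum_mult_middle: "esum (\<lambda>x y. F x y * (c * G x y)) = c * esum (\<lambda>x y. F x y * G x y)" for c :: 'k
  by (simp add: esum_mult_left[symmetric] mult.left_commute)

lemma linear_esum: "Vector_Spaces.linear scale sW f \<Longrightarrow> f (esum F) = esum (\<lambda>x y. f (F x y))"
proof -
  assume f: "Vector_Spaces.linear scale sW f"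
  interpret f: Vector_Spaces.linear scale sW f by fact
  have "f (\<Sum>(x, y)\<leftarrow>zs. F x y) = (\<Sum>(x, y)\<leftarrow>zs. f (F x y))" for zs
    by (induction zs) (auto simp: f.add f.zero)
  then show ?thesis by (simp add: esum_def)
qed

abbreviation irr :: "nat \<Rightarrow> ('h \<Rightarrow> 'k mat) \<Rightarrow> bool" where "irr \<equiv> irreducible_rep scale"

abbreviation chi :: "('h \<Rightarrow> 'k mat) \<Rightarrow> 'h \<Rightarrow> 'k" where "chi \<rho> \<equiv> \<lambda>h. mat_trace (\<rho> h)"



lemma entry_linear:
  "irr d \<rho> \<Longrightarrow> i < d \<Longrightarrow> j < d \<Longrightarrow> Vector_Spaces.linear scale (*) (\<lambda>h. \<rho> h $$ (i, j))"
  using irreducible_repD[of scale d \<rho>]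
  by (auto simp: Vector_Spaces.linear_iff vector_space_axioms vector_space_field)

lemma entry_mult:
  "irr d \<rho> \<Longrightarrow> i < d \<Longrightarrow> j < d \<Longrightarrow> \<rho> (x * y) $$ (i, j) = (\<Sum>m<d. \<rho> x $$ (i, m) * \<rho> y $$ (m, j))"
  using irreducible_repD[of scale d \<rho>] by (simp add: scalar_prod_def atLeast0LessThan)

lemma chi_sum: "irr d \<rho> \<Longrightarrow> chi \<rho> h = (\<Sum>i<d. \<rho> h $$ (i, i))"
  using irreducible_repD[of scale d \<rho>] by (simp add: mat_trace_def)

lemma chi_linear: "irr d \<rho> \<Longrightarrow> Vector_Spaces.linear scale (*) (chi \<rho>)"
  using irreducible_repD[of scale d \<rho>] vector_space_axioms vector_space_field
  by (auto simp: Vector_Spaces.linear_iff mat_trace_def sum.distrib sum_distrib_left)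

lemma linear_entry_prod:
  assumes "irr d \<rho>" "irr e \<sigma>" "i < d" "j < d" "k < e" "l < e"
  shows "Vector_Spaces.linear scale (*) (\<lambda>x. \<rho> x $$ (i, j) * \<sigma> y $$ (k, l))"
    and "Vector_Spaces.linear scale (*) (\<lambda>y. \<rho> x $$ (i, j) * \<sigma> y $$ (k, l))"
  using entry_linear[OF assms(1,3,4)] entry_linear[OF assms(2,5,6)]
  by (auto simp: Vector_Spaces.linear_iff algebra_simps)

text \<open>
  Averaging an elementary matrix over the Casimir tensor gives an intertwiner, so Schur's lemma
  determines the sums of products of matrix entries.
\<close>

lemma casimir_intertwiner:
  assumes \<rho>: "irr d \<rho>" and \<sigma>: "irr e \<sigma>" and jk: "j < d" "k < e"
  defines "X \<equiv> mat d e (\<lambda>(i, l). esum (\<lambda>x y. \<rho> x $$ (i, j) * \<sigma> y $$ (k, l)))"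
  shows "\<rho> h * X = X * \<sigma> h"
proof (rule eq_matI)
  note D = irreducible_repD[OF \<rho>] and D' = irreducible_repD[OF \<sigma>]
  fix i l assume "i < dim_row (X * \<sigma> h)" "l < dim_col (X * \<sigma> h)"
  then have il: "i < d" "l < e" using D'(7,8) by (simp_all add: X_def)
  have "(\<rho> h * X) $$ (i, l) = esum (\<lambda>x y. \<rho> (h * x) $$ (i, j) * \<sigma> y $$ (k, l))"
    using il jk D(7,8) D'(7,8)
    by (simp add: X_def scalar_prod_def atLeast0LessThan entry_mult[OF \<rho>] sum_distrib_right esum_sum
        mult.assoc esum_mult_left)
  also have "\<dots> = esum (\<lambda>x y. \<rho> x $$ (i, j) * \<sigma> (y * h) $$ (k, l))"
    using linear_entry_prod[OF \<rho> \<sigma> il(1) jk il(2)] by (rule esum_central)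
  also have "\<dots> = (X * \<sigma> h) $$ (i, l)"
    using il jk D(7,8) D'(7,8)
    by (simp add: X_def scalar_prod_def atLeast0LessThan entry_mult[OF \<sigma>] sum_distrib_left esum_sum
        mult.assoc[symmetric] esum_mult_right)
  finally show "(\<rho> h * X) $$ (i, l) = (X * \<sigma> h) $$ (i, l)" .
qed (use irreducible_repD(7,8)[OF \<rho>] irreducible_repD(7,8)[OF \<sigma>] in \<open>simp_all add: X_def\<close>)

lemma schur_orthogonal_ne:
  assumes \<rho>: "irr d \<rho>" and \<sigma>: "irr e \<sigma>" and ne: "chi \<rho> \<noteq> chi \<sigma>"
    and "i < d" "j < d" "k < e" "l < e"
  shows "esum (\<lambda>x y. \<rho> x $$ (i, j) * \<sigma> y $$ (k, l)) = 0"
proof -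
  define X where "X = mat d e (\<lambda>(i, l). esum (\<lambda>x y. \<rho> x $$ (i, j) * \<sigma> y $$ (k, l)))"
  have "X = 0\<^sub>m d e"
  proof (rule ccontr)
    assume "X \<noteq> 0\<^sub>m d e"
    then have "chi \<rho> h = chi \<sigma> h" for h
      using casimir_intertwiner[OF \<rho> \<sigma> assms(5,6)]
      by (intro intertwiner_characters_eq[OF \<rho> \<sigma>, of X]) (auto simp: X_def)
    with ne show False by auto
  qed
  then have "X $$ (i, l) = 0" using assms by simp
  then show ?thesis using assms by (simp add: X_def)
qed

text \<open>
  If the tensor \<open>E\<close> were symmetric, \<open>u\<close> would be \<open>\<Sum> x y = 1\<close>.
\<close>

definition u :: 'h where "u = esum (\<lambda>x y. y * x)"

text \<open>
  By Schur's lemma the sum is \<open>c\<close> for \<open>i = l\<close> and \<open>0\<close> otherwise, with \<open>c\<close> depending only on \<open>j\<close> and \<open>k\<close>.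
  Adding up the cases \<open>i = l\<close> gives \<open>d c = \<rho>(\<Sum> y x)\<^sub>k\<^sub>j\<close>.
\<close>

lemma schur_orthogonal_eq:
  assumes \<rho>: "irr d \<rho>" and "i < d" "j < d" "k < d" "l < d"
  shows "esum (\<lambda>x y. \<rho> x $$ (i, j) * \<rho> y $$ (k, l)) = (if i = l then \<rho> u $$ (k, j) / of_nat d else 0)"
proof -
  define X where "X = mat d d (\<lambda>(i, l). esum (\<lambda>x y. \<rho> x $$ (i, j) * \<rho> y $$ (k, l)))"
  obtain c where Xc: "X = c \<cdot>\<^sub>m 1\<^sub>m d"
    using commutant_scalar[OF \<rho>, of X] casimir_intertwiner[OF \<rho> \<rho> assms(3,4)]
    by (auto simp: X_def)
  have c: "esum (\<lambda>x y. \<rho> x $$ (i, j) * \<rho> y $$ (k, l)) = (if i = l then c else 0)"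
    if "i < d" "l < d" for i l
  proof -
    have "X $$ (i, l) = (c \<cdot>\<^sub>m 1\<^sub>m d) $$ (i, l)" by (simp only: Xc)
    then show ?thesis using that by (simp add: X_def)
  qed
  have "\<rho> u $$ (k, j) = esum (\<lambda>x y. \<Sum>i<d. \<rho> x $$ (i, j) * \<rho> y $$ (k, i))"
    unfolding u_def using assms
    by (subst linear_esum[OF entry_linear[OF \<rho>]]) (auto simp: entry_mult[OF \<rho>] mult.commute)
  also have "\<dots> = of_nat d * c"
    by (simp add: esum_sum c)
  finally show ?thesis
    using c[OF assms(2,5)] assms by simp
qed

lemma trace_u:
  assumes \<rho>: "irr d \<rho>"
  shows "chi \<rho> u = of_nat d"
proof -
  note D = irreducible_repD[OF \<rho>]
  have "1 = \<rho> (esum (\<lambda>x y. x * y)) $$ (0, 0)"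
    using D(5,6) by (simp add: esum_def E_mult)
  also have "\<dots> = (\<Sum>j<d. esum (\<lambda>x y. \<rho> x $$ (0, j) * \<rho> y $$ (j, 0)))"
    using D(6) by (subst linear_esum[OF entry_linear[OF \<rho>]]) (auto simp: entry_mult[OF \<rho>] esum_sum)
  also have "\<dots> = chi \<rho> u / of_nat d"
    using D(6) by (simp add: schur_orthogonal_eq[OF \<rho>] chi_sum[OF \<rho>] sum_divide_distrib)
  finally show ?thesis using D(6) by (simp add: field_simps)
qed

abbreviation Irr :: "('h \<Rightarrow> 'k) set" where "Irr \<equiv> irreducible_characters scale"

abbreviation deg :: "('h \<Rightarrow> 'k) \<Rightarrow> nat" where "deg \<equiv> character_degree scale"

lemma deg_eq:
  assumes "irr d \<rho>"
  shows "deg (chi \<rho>) = d"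
  unfolding character_degree_def
proof (rule the_equality)
  have one: "chi \<rho> 1 = of_nat d" if "irr d \<rho>" for d \<rho>
    using irreducible_repD[OF that] by (simp add: mat_trace_def)
  fix e assume "\<exists>\<sigma>. irr e \<sigma> \<and> chi \<rho> = chi \<sigma>"
  then obtain \<sigma> where \<sigma>: "irr e \<sigma>" "chi \<rho> = chi \<sigma>" by blast
  show "e = d"
    using one[OF assms] one[OF \<sigma>(1)] fun_cong[OF \<sigma>(2), of 1] by simp
qed (use assms in blast)

lemma IrrE:
  assumes "\<chi> \<in> Irr"
  obtains \<rho> where "irr (deg \<chi>) \<rho>" "\<chi> = chi \<rho>"
  using assms deg_eq by (auto simp: irreducible_characters_def)

lemma chi_in_Irr: "irr d \<rho> \<Longrightarrow> chi \<rho> \<in> Irr"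
  by (auto simp: irreducible_characters_def)

lemma character_orthogonality:
  assumes \<rho>: "irr d \<rho>" and \<sigma>: "irr e \<sigma>"
  shows "esum (\<lambda>x y. chi \<rho> x * chi \<sigma> y) = (if chi \<rho> = chi \<sigma> then 1 else 0)"
proof (cases "chi \<rho> = chi \<sigma>")
  case True
  have "esum (\<lambda>x y. chi \<rho> x * chi \<rho> y) = (\<Sum>i<d. \<Sum>k<d. esum (\<lambda>x y. \<rho> x $$ (i, i) * \<rho> y $$ (k, k)))"
    by (simp add: chi_sum[OF \<rho>] sum_product esum_sum)
  also have "\<dots> = (\<Sum>i<d. \<rho> u $$ (i, i)) / of_nat d"
    by (simp add: schur_orthogonal_eq[OF \<rho>] sum_divide_distrib)
  also have "\<dots> = 1"
    using trace_u[OF \<rho>] irreducible_repD(6)[OF \<rho>] by (simp add: chi_sum[OF \<rho>])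
  finally show ?thesis using True by (simp add: fun_cong[OF True, symmetric])
next
  case False
  then show ?thesis
    by (simp add: chi_sum[OF \<rho>] chi_sum[OF \<sigma>] sum_product esum_sum schur_orthogonal_ne[OF \<rho> \<sigma>])
qed

text \<open>
  The elements \<open>\<Sum> \<chi>(x) y\<close> are dual to the irreducible characters, hence linearly independent.
\<close>

lemma finite_Irr: "finite Irr"
proof -
  define c where "c \<chi> = esum (\<lambda>x y. scale (\<chi> x) y)" for \<chi> :: "'h \<Rightarrow> 'k"
  have lin: "Vector_Spaces.linear scale (*) \<chi>" if "\<chi> \<in> Irr" for \<chi>
    using that chi_linear by (auto elim: IrrE)
  have dual: "\<psi> (c \<chi>) = (if \<chi> = \<psi> then 1 else 0)" if "\<chi> \<in> Irr" "\<psi> \<in> Irr" for \<chi> \<psi>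
  proof -
    have "\<psi> (c \<chi>) = esum (\<lambda>x y. \<chi> x * \<psi> y)"
      unfolding c_def using lin[OF that(2)]
      by (subst linear_esum[OF lin[OF that(2)]]) (simp add: Vector_Spaces.linear_iff)
    then show ?thesis
      using that by (auto elim!: IrrE simp: character_orthogonality)
  qed
  have inj: "inj_on c Irr"
    by (rule inj_onI) (metis dual one_neq_zero)
  have "independent (c ` Irr)"
    unfolding independent_explicit_finite_subsets
  proof (intro allI impI ballI)
    fix S a v assume S: "S \<subseteq> c ` Irr" "finite S" "(\<Sum>v\<in>S. scale (a v) v) = 0" "v \<in> S"
    then obtain \<psi> where \<psi>: "\<psi> \<in> Irr" "v = c \<psi>" by auto
    interpret \<psi>: Vector_Spaces.linear scale "(*)" \<psi> by (rule lin[OF \<psi>(1)])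
    have "0 = (\<Sum>w\<in>S. a w * \<psi> w)"
      using arg_cong[OF S(3), of \<psi>] by (simp add: \<psi>.sum \<psi>.scale \<psi>.zero)
    also have "\<dots> = (\<Sum>w\<in>S. if w = v then a w else 0)"
      using S(1) by (intro sum.cong) (auto simp: dual \<psi> inj_on_eq_iff[OF inj])
    finally show "a v = 0" using S(2,4) by simp
  qed
  then have "finite (c ` Irr)"
    by (rule finite_if_independent[OF finite_dim])
  then show ?thesis using inj by (rule finite_imageD)
qed

lemma linear_mult: "Vector_Spaces.linear scale scale ((*) h)"
  by (simp add: Vector_Spaces.linear_iff vector_space_axioms distrib_left scale_mult_right)

lemma left_ideal_subspace: "left_ideal I \<Longrightarrow> subspace I"
proof -
  assume I: "left_ideal I"
  have "scale c x \<in> I" if "x \<in> I" for c x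
  proof -
    have "scale c x = scale c 1 * x" by (simp add: scale_mult_left)
    then show ?thesis using I that by (simp add: left_ideal_def)
  qed
  then show ?thesis using I by (simp add: left_ideal_def subspace_def)
qed



text \<open>
  An invariant subspace of coordinate vectors corresponds to a left ideal inside the minimal one,
  so it is trivial. The purpose of these representations is that an element killed by all of them
  annihilates every minimal left ideal, hence their span, which is the whole algebra.
\<close>

lemma irreducible_rep_of_minimal_left_ideal:
  assumes I: "minimal_left_ideal I"
  obtains d b where "indexed_family scale d b" "span (b ` {..<d}) = I"
    "irr d (\<lambda>h. indexed_family.op_mat scale d b ((*) h))"
proof -
  have lI: "left_ideal I" and I0: "I \<noteq> {0}"
    and Imin: "\<And>J. left_ideal J \<Longrightarrow> J \<subseteq> I \<Longrightarrow> J = {0} \<or> J = I"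
    using I by (auto simp: minimal_left_ideal_def)
  obtain d b where b: "indexed_family scale d b" and V: "span (b ` {..<d}) = I"
    using subspace_indexed_basis[OF finite_dim left_ideal_subspace[OF lI]] .
  interpret B: indexed_family scale d b by fact
  have mI: "h * x \<in> I" if "x \<in> I" for h x
    using lI that by (simp add: left_ideal_def)
  define \<rho> where "\<rho> h = B.op_mat ((*) h)" for h
  have \<rho>: "\<rho> h \<in> carrier_mat d d" for h by (simp add: \<rho>_def B.op_mat_carrier)
  have rep: "matrix_rep scale d \<rho>"
    unfolding matrix_rep_def
  proof (intro conjI allI)
    fix x y c
    show "\<rho> (x + y) = \<rho> x + \<rho> y"
      by (rule eq_matI) (auto simp: \<rho>_def B.op_mat_def distrib_right B.coord_add V mI B.b_in_V[unfolded V])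
    show "\<rho> (scale c x) = c \<cdot>\<^sub>m \<rho> x"
      by (rule eq_matI) (auto simp: \<rho>_def B.op_mat_def scale_mult_left B.coord_scale V mI B.b_in_V[unfolded V])
    show "\<rho> (x * y) = \<rho> x * \<rho> y"
      using B.op_mat_compose[OF linear_mult[of x], of "(*) y"]
      by (simp add: \<rho>_def V mI mult.assoc[abs_def])
    show "\<rho> 1 = 1\<^sub>m d"
      using B.op_mat_id by (simp add: \<rho>_def B.op_mat_def)
  qed (rule \<rho>)
  define comb where "comb v = (\<Sum>i<d. scale (v $ i) (b i))" for v
  have comb_I: "comb v \<in> I" for v
    unfolding comb_def V[symmetric] by (intro span_sum span_scale span_base) auto
  have coord_comb: "B.coord (comb v) i = v $ i" if "i < d" for v i
    by (rule B.coord_unique[OF _ that]) (simp add: comb_def)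
  have comb_eqI: "v = w" if "v \<in> carrier_vec d" "w \<in> carrier_vec d" "comb v = comb w" for v w
    using that coord_comb by (intro eq_vecI) (auto, metis)
  have comb_coord: "comb (vec d (B.coord x)) = x" if "x \<in> I" for x
    using B.coord_expand[of x] that by (simp add: comb_def V)
  have comb_0: "comb (0\<^sub>v d) = 0" by (simp add: comb_def)
  have comb_mult: "comb (\<rho> h *\<^sub>v v) = h * comb v" if "v \<in> carrier_vec d" for h v
  proof -
    have "\<rho> h *\<^sub>v v = vec d (B.coord (h * comb v))"
    proof (rule eq_vecI)
      fix i assume "i < dim_vec (vec d (B.coord (h * comb v)))"
      then have i: "i < d" by simp
      have "B.coord (h * comb v) i = (\<Sum>j<d. \<rho> h $$ (i, j) * B.coord (comb v) j)"
        unfolding \<rho>_def by (rule B.coord_op[OF linear_mult]) (auto simp: V mI comb_I i)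
      then show "(\<rho> h *\<^sub>v v) $ i = vec d (B.coord (h * comb v)) $ i"
        using i that \<rho>[of h] by (simp add: scalar_prod_def atLeast0LessThan coord_comb)
    qed (use \<rho>[of h] in simp)
    then show ?thesis by (simp add: comb_coord mI comb_I)
  qed
  have "W = {0\<^sub>v d} \<or> W = carrier_vec d" if W: "invariant_subspace d \<rho> W" for W
  proof -
    have Wd: "W \<subseteq> carrier_vec d" and W0: "0\<^sub>v d \<in> W"
      and Wadd: "\<And>v w. v \<in> W \<Longrightarrow> w \<in> W \<Longrightarrow> v + w \<in> W"
      and Winv: "\<And>h v. v \<in> W \<Longrightarrow> \<rho> h *\<^sub>v v \<in> W"
      using W by (auto simp: invariant_subspace_def)
    have "left_ideal (comb ` W)"
      unfolding left_ideal_def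
    proof (intro conjI ballI allI)
      show "0 \<in> comb ` W" using W0 comb_0 by (metis imageI)
      fix x assume "x \<in> comb ` W"
      then obtain v where v: "v \<in> W" "x = comb v" by blast
      show "h * x \<in> comb ` W" for h
      proof -
        have "v \<in> carrier_vec d" using v Wd by blast
        then show ?thesis
          using Winv[OF v(1), of h] comb_mult[of v h] v(2) by (metis imageI)
      qed
      fix y assume "y \<in> comb ` W"
      then obtain w where w: "w \<in> W" "y = comb w" by blast
      have "comb (v + w) = comb v + comb w"
        using v w Wd by (auto simp: comb_def sum.distrib[symmetric] scale_left_distrib intro!: sum.cong)
      then show "x + y \<in> comb ` W"
        using v w Wadd[OF v(1) w(1)] by (metis imageI)
    qed
    then consider "comb ` W = {0}" | "comb ` W = I"
      using Imin comb_I by (meson image_subsetI)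
    then show ?thesis
    proof cases
      case 1
      then have "v = 0\<^sub>v d" if "v \<in> W" for v
        using that Wd comb_0 by (intro comb_eqI) auto
      then show ?thesis using W0 by blast
    next
      case 2
      have "v \<in> W" if v: "v \<in> carrier_vec d" for v
      proof -
        obtain w where w: "w \<in> W" "comb v = comb w"
          using 2 comb_I[of v] by (auto simp: image_iff)
        then have "v = w" using v Wd by (intro comb_eqI) auto
        then show ?thesis using w by simp
      qed
      then show ?thesis using Wd by blast
    qed
  qed
  moreover have "d > 0"
  proof (rule ccontr)
    assume "\<not> d > 0"
    then have "I = {0}" using V by simp
    then show False using I0 by simp
  qed
  ultimately have "irr d \<rho>" using rep by (simp add: irreducible_rep_def)
  then show ?thesis using that[OF b V] by (simp add: \<rho>_def[abs_def])
qed

lemma separated_by_irreducibles: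
  assumes "\<And>d \<rho>. irr d \<rho> \<Longrightarrow> \<rho> h = 0\<^sub>m d d"
  shows "h = 0"
proof -
  have "h * x = 0" if I: "minimal_left_ideal I" and x: "x \<in> I" for I x
  proof -
    obtain d b where b: "indexed_family scale d b" and V: "span (b ` {..<d}) = I"
      and irr: "irr d (\<lambda>h. indexed_family.op_mat scale d b ((*) h))"
      using irreducible_rep_of_minimal_left_ideal[OF I] .
    interpret B: indexed_family scale d b by fact
    have hI: "h * x \<in> I" if "x \<in> I" for x
      using I that by (simp add: minimal_left_ideal_def left_ideal_def)
    have "B.coord (h * x) i = 0" if i: "i < d" for i
    proof -
      have "B.coord (h * x) i = (\<Sum>j<d. B.op_mat ((*) h) $$ (i, j) * B.coord x j)"
        by (rule B.coord_op[OF linear_mult]) (use hI V x i in auto)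
      then show ?thesis using assms[OF irr] i by simp
    qed
    then show ?thesis
      using B.coord_expand[of "h * x"] hI[OF x] V by simp
  qed
  then have "\<Union> {I. minimal_left_ideal I} \<subseteq> {x. h * x = 0}" by auto
  moreover have "subspace {x. h * x = 0}"
    by (auto simp: subspace_def distrib_left scale_mult_right)
  ultimately have "span (\<Union> {I. minimal_left_ideal I}) \<subseteq> {x. h * x = 0}"
    by (rule span_minimal)
  then have "UNIV \<subseteq> {x. h * x = 0}"
    using semisimple by (simp add: semisimple_algebra_def)
  then have "h * 1 = 0" by blast
  then show ?thesis by simp
qed

corollary eq_if_irreducibles_eq:
  assumes "\<And>d \<rho> i j. irr d \<rho> \<Longrightarrow> i < d \<Longrightarrow> j < d \<Longrightarrow> \<rho> x $$ (i, j) = \<rho> y $$ (i, j)"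
  shows "x = y"
proof -
  have "x - y = 0"
  proof (rule separated_by_irreducibles)
    fix d \<rho> assume \<rho>: "irr d \<rho>"
    note D = irreducible_repD[OF \<rho>]
    show "\<rho> (x - y) = 0\<^sub>m d d"
    proof (rule eq_matI)
      fix i j assume "i < dim_row (0\<^sub>m d d :: 'k mat)" "j < dim_col (0\<^sub>m d d :: 'k mat)"
      then have ij: "i < d" "j < d" by simp_all
      have "\<rho> (x - y) $$ (i, j) + \<rho> y $$ (i, j) = \<rho> x $$ (i, j)"
        using D(2)[of "x - y" y] D(7,8) ij by (metis diff_add_cancel index_add_mat(1))
      then show "\<rho> (x - y) $$ (i, j) = 0\<^sub>m d d $$ (i, j)"
        using assms[OF \<rho> ij] ij by simp
    qed (simp_all add: D)
  qed
  then show ?thesis by simp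
qed

lemma ex_irr: "\<exists>d \<rho>. irr d \<rho>"
  using separated_by_irreducibles[of 1] by auto

text \<open>
  For \<open>N = 1\<close> this is the character of the regular representation.
\<close>

definition weighted_char :: "nat \<Rightarrow> 'h \<Rightarrow> 'k" where
  "weighted_char N h = (\<Sum>\<chi>\<in>Irr. of_nat (deg \<chi>) ^ N * \<chi> h)"

lemma Irr_linear: "\<chi> \<in> Irr \<Longrightarrow> Vector_Spaces.linear scale (*) \<chi>"
  using chi_linear by (auto elim: IrrE)

lemma Irr_commute: "\<chi> \<in> Irr \<Longrightarrow> \<chi> (x * y) = \<chi> (y * x)"
  by (auto elim!: IrrE simp: irreducible_repD intro!: mat_trace_commute)

lemma weighted_char_linear: "Vector_Spaces.linear scale (*) (weighted_char N)"
  unfolding Vector_Spaces.linear_iff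
proof (intro conjI allI vector_space_axioms vector_space_field)
  have lin: "\<chi> (x + y) = \<chi> x + \<chi> y" "\<chi> (scale c x) = c * \<chi> x" if "\<chi> \<in> Irr" for \<chi> x y c
    using Irr_linear[OF that] by (auto simp: Vector_Spaces.linear_iff)
  show "weighted_char N (x + y) = weighted_char N x + weighted_char N y" for x y
    by (simp add: weighted_char_def lin distrib_left sum.distrib)
  show "weighted_char N (scale c x) = c * weighted_char N x" for c x
    by (simp add: weighted_char_def lin sum_distrib_left mult.left_commute)
qed

lemma weighted_char_commute: "weighted_char N (x * y) = weighted_char N (y * x)"
  by (auto simp: weighted_char_def Irr_commute[of _ x y] intro!: sum.cong)

text \<open>
  If \<open>\<chi>\<close> is the character of \<open>\<sigma>\<close>, it is expanded in the entries of \<open>\<sigma>\<close> itself, so that the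
  orthogonality relations for a single representation apply.
\<close>

lemma casimir_chi_left:
  assumes \<sigma>: "irr d \<sigma>" and \<chi>: "\<chi> \<in> Irr" and kl: "k < d" "l < d"
  shows "esum (\<lambda>x y. \<chi> (b * x) * \<sigma> y $$ (k, l)) = (if \<chi> = chi \<sigma> then \<sigma> (u * b) $$ (k, l) / of_nat d else 0)"
proof (cases "\<chi> = chi \<sigma>")
  case True
  have "esum (\<lambda>x y. \<chi> (b * x) * \<sigma> y $$ (k, l))
      = (\<Sum>i<d. \<Sum>j<d. \<sigma> b $$ (j, i) * esum (\<lambda>x y. \<sigma> x $$ (i, j) * \<sigma> y $$ (k, l)))"
    by (subst sum.swap)
      (simp add: True chi_sum[OF \<sigma>] entry_mult[OF \<sigma>] sum_distrib_right esum_sum mult.assoc esum_mult_left)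
  also have "\<dots> = (\<Sum>i<d. if i = l then (\<Sum>j<d. \<sigma> u $$ (k, j) * \<sigma> b $$ (j, l)) / of_nat d else 0)"
    using kl by (intro sum.cong refl)
      (simp add: schur_orthogonal_eq[OF \<sigma>] sum_divide_distrib mult.commute)
  finally show ?thesis
    using kl True by (simp add: entry_mult[OF \<sigma>])
next
  case False
  obtain e \<rho> where \<rho>: "irr e \<rho>" "\<chi> = chi \<rho>" using \<chi> by (auto elim: IrrE)
  then show ?thesis
    using False kl
    by (simp add: chi_sum[OF \<rho>(1)] entry_mult[OF \<rho>(1)] sum_distrib_right esum_sum mult.assoc esum_mult_left
        schur_orthogonal_ne[OF \<rho>(1) \<sigma>])
qed

lemma casimir_chi_right:
  assumes \<sigma>: "irr d \<sigma>" and \<chi>: "\<chi> \<in> Irr" and kl: "k < d" "l < d"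
  shows "esum (\<lambda>x y. \<sigma> x $$ (k, l) * \<chi> (y * b)) = (if \<chi> = chi \<sigma> then \<sigma> (b * u) $$ (k, l) / of_nat d else 0)"
proof (cases "\<chi> = chi \<sigma>")
  case True
  have "esum (\<lambda>x y. \<sigma> x $$ (k, l) * \<chi> (y * b))
      = (\<Sum>i<d. \<Sum>j<d. esum (\<lambda>x y. \<sigma> x $$ (k, l) * \<sigma> y $$ (i, j)) * \<sigma> b $$ (j, i))"
    by (simp add: True chi_sum[OF \<sigma>] entry_mult[OF \<sigma>] sum_distrib_left esum_sum mult.assoc[symmetric]
        esum_mult_right)
  also have "\<dots> = (\<Sum>i<d. \<Sum>j<d. if k = j then \<sigma> b $$ (k, i) * \<sigma> u $$ (i, l) / of_nat d else 0)"
    using kl by (intro sum.cong refl) (simp add: schur_orthogonal_eq[OF \<sigma>] mult.commute)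
  finally show ?thesis
    using kl True by (simp add: entry_mult[OF \<sigma>] sum_divide_distrib)
next
  case False
  obtain e \<rho> where \<rho>: "irr e \<rho>" "\<chi> = chi \<rho>" using \<chi> by (auto elim: IrrE)
  then show ?thesis
    using False kl
    by (simp add: chi_sum[OF \<rho>(1)] entry_mult[OF \<rho>(1)] sum_distrib_left esum_sum mult.assoc[symmetric]
        esum_mult_right schur_orthogonal_ne[OF \<sigma> \<rho>(1)])
qed

lemma casimir_weighted_char:
  assumes \<sigma>: "irr d \<sigma>" and kl: "k < d" "l < d"
  shows casimir_weighted_char_left:
      "esum (\<lambda>x y. weighted_char N (b * x) * \<sigma> y $$ (k, l)) = of_nat d ^ N * (\<sigma> (u * b) $$ (k, l) / of_nat d)"
    and casimir_weighted_char_right: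
      "esum (\<lambda>x y. \<sigma> x $$ (k, l) * weighted_char N (y * b)) = of_nat d ^ N * (\<sigma> (b * u) $$ (k, l) / of_nat d)"
proof -
  have "esum (\<lambda>x y. weighted_char N (b * x) * \<sigma> y $$ (k, l))
      = (\<Sum>\<chi>\<in>Irr. of_nat (deg \<chi>) ^ N * esum (\<lambda>x y. \<chi> (b * x) * \<sigma> y $$ (k, l)))"
    by (simp add: weighted_char_def sum_distrib_right esum_sum mult.assoc esum_mult_left)
  also have "\<dots> = (\<Sum>\<chi>\<in>Irr. if \<chi> = chi \<sigma> then of_nat d ^ N * (\<sigma> (u * b) $$ (k, l) / of_nat d) else 0)"
    by (rule sum.cong) (auto simp: casimir_chi_left[OF \<sigma> _ kl] deg_eq[OF \<sigma>])
  also have "\<dots> = of_nat d ^ N * (\<sigma> (u * b) $$ (k, l) / of_nat d)"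
    using finite_Irr chi_in_Irr[OF \<sigma>] by simp
  finally show "esum (\<lambda>x y. weighted_char N (b * x) * \<sigma> y $$ (k, l)) = of_nat d ^ N * (\<sigma> (u * b) $$ (k, l) / of_nat d)" .
  have "esum (\<lambda>x y. \<sigma> x $$ (k, l) * weighted_char N (y * b))
      = (\<Sum>\<chi>\<in>Irr. of_nat (deg \<chi>) ^ N * esum (\<lambda>x y. \<sigma> x $$ (k, l) * \<chi> (y * b)))"
    by (simp add: weighted_char_def sum_distrib_left esum_sum esum_mult_middle)
  also have "\<dots> = (\<Sum>\<chi>\<in>Irr. if \<chi> = chi \<sigma> then of_nat d ^ N * (\<sigma> (b * u) $$ (k, l) / of_nat d) else 0)"
    by (rule sum.cong) (auto simp: casimir_chi_right[OF \<sigma> _ kl] deg_eq[OF \<sigma>])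
  also have "\<dots> = of_nat d ^ N * (\<sigma> (b * u) $$ (k, l) / of_nat d)"
    using finite_Irr chi_in_Irr[OF \<sigma>] by simp
  finally show "esum (\<lambda>x y. \<sigma> x $$ (k, l) * weighted_char N (y * b)) = of_nat d ^ N * (\<sigma> (b * u) $$ (k, l) / of_nat d)" .
qed

end

section \<open>Traces of powers\<close>

text \<open>
  Take the permutation matrix of a transposition \<open>(0 i)\<close> with \<open>v\<^sub>i \<noteq> 0\<close> and replace its first
  column, the \<open>i\<close>-th unit vector, by \<open>v\<close>.
\<close>

lemma ex_invertible_first_column:
  fixes v :: "'k::field vec"
  assumes v: "v \<in> carrier_vec n" and v0: "v \<noteq> 0\<^sub>v n"
  obtains P Q where "P \<in> carrier_mat n n" "Q \<in> carrier_mat n n" "P * Q = 1\<^sub>m n" "Q * P = 1\<^sub>m n"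
    "P *\<^sub>v unit_vec n 0 = v"
proof -
  obtain i where i: "i < n" "v $ i \<noteq> 0"
    using v v0 by (metis carrier_vecD eq_vecI index_zero_vec)
  define s where "s = Transposition.transpose 0 i"
  have s: "s c < n" if "c < n" for c
    using that i by (auto simp: s_def Transposition.transpose_def)
  have ss: "s (s c) = c" for c by (simp add: s_def)
  define P where "P = mat n n (\<lambda>(r, c). if c = 0 then v $ r else if r = s c then 1 else 0)"
  have P: "P \<in> carrier_mat n n" by (simp add: P_def)
  have n0: "0 < n" using i by simp
  have row: "(P *\<^sub>v x) $ r = x $ 0 * v $ r + (if s r = 0 then 0 else x $ s r)"
    if x: "x \<in> carrier_vec n" and r: "r < n" for x r
  proof -
    have "(P *\<^sub>v x) $ r = (\<Sum>c<n. P $$ (r, c) * x $ c)"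
      using x r P by (simp add: scalar_prod_def atLeast0LessThan)
    also have "\<dots> = P $$ (r, 0) * x $ 0 + (\<Sum>c\<in>{..<n} - {0}. P $$ (r, c) * x $ c)"
      using n0 by (subst sum.remove[of _ 0]) auto
    also have "(\<Sum>c\<in>{..<n} - {0}. P $$ (r, c) * x $ c) = (\<Sum>c\<in>{..<n} - {0}. if c = s r then x $ c else 0)"
    proof (rule sum.cong)
      fix c assume c: "c \<in> {..<n} - {0}"
      have "r = s c \<longleftrightarrow> c = s r" by (metis ss)
      then show "P $$ (r, c) * x $ c = (if c = s r then x $ c else 0)"
        using c r by (simp add: P_def)
    qed simp
    also have "\<dots> = (if s r = 0 then 0 else x $ s r)"
      using s[OF r] by auto
    finally show ?thesis using r n0 by (simp add: P_def)
  qed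
  have "det P \<noteq> 0"
  proof
    assume "det P = 0"
    then obtain x where x: "x \<in> carrier_vec n" "x \<noteq> 0\<^sub>v n" "P *\<^sub>v x = 0\<^sub>v n"
      using det_0_iff_vec_prod_zero[OF P] by blast
    have x0: "x $ 0 = 0"
      using row[OF x(1) i(1)] x(3) i by (simp add: s_def)
    have "x $ c = 0" if "c < n" for c
      using row[OF x(1) s[OF that]] x(3) s[OF that] x0 by (auto simp: ss split: if_splits)
    then have "x = 0\<^sub>v n" using x(1) by (intro eq_vecI) auto
    with x(2) show False by simp
  qed
  from det_non_zero_imp_unit[OF P this, of "()"]
  obtain Q where "Q \<in> carrier_mat n n" "P * Q = 1\<^sub>m n" "Q * P = 1\<^sub>m n"
    by (auto simp: Units_def ring_mat_def)
  moreover have "P *\<^sub>v unit_vec n 0 = v"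
    using v s n0 P by (intro eq_vecI) (auto simp: row P_def)
  ultimately show ?thesis using P that by blast
qed

text \<open>
  A basis starting with an eigenvector splits off a \<open>1 \<times> 1\<close> block, and the induction applies to
  the complementary block.
\<close>

lemma similar_upper_triangular:
  fixes A :: "'k::alg_closed_field mat"
  assumes "A \<in> carrier_mat n n"
  shows "\<exists>B. B \<in> carrier_mat n n \<and> upper_triangular B \<and> similar_mat A B"
  using assms
proof (induction n arbitrary: A)
  case 0
  then show ?case by (intro exI[of _ A]) (auto intro!: similar_mat_refl)
next
  case (Suc n)
  note A = Suc.prems
  have "degree (char_poly A) > 0"
    using degree_monic_char_poly[OF A] by simp
  then obtain e where "poly (char_poly A) e = 0"
    using alg_closed_imp_poly_has_root by blast
  then have "eigenvalue A e"
    using eigenvalue_root_char_poly[OF A] by simp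
  then obtain v where v: "v \<in> carrier_vec (Suc n)" "v \<noteq> 0\<^sub>v (Suc n)" "A *\<^sub>v v = e \<cdot>\<^sub>v v"
    using A by (auto simp: eigenvalue_def eigenvector_def)
  obtain P Q where P: "P \<in> carrier_mat (Suc n) (Suc n)" and Q: "Q \<in> carrier_mat (Suc n) (Suc n)"
    and PQ: "P * Q = 1\<^sub>m (Suc n)" "Q * P = 1\<^sub>m (Suc n)" and Pv: "P *\<^sub>v unit_vec (Suc n) 0 = v"
    using ex_invertible_first_column[OF v(1,2)] .
  define C where "C = Q * A * P"
  have C: "C \<in> carrier_mat (Suc n) (Suc n)" using A P Q by (simp add: C_def)
  have "P * C * Q = (P * Q) * A * (P * Q)"
    using A P Q unfolding C_def by (simp add: assoc_mult_mat[of _ "Suc n" "Suc n" _ "Suc n" _ "Suc n"])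
  then have sim: "similar_mat A C"
    using A C P Q PQ by (auto simp: similar_mat_def intro!: exI similar_mat_witI)
  have "C *\<^sub>v unit_vec (Suc n) 0 = (Q * A) *\<^sub>v (P *\<^sub>v unit_vec (Suc n) 0)"
    unfolding C_def by (rule assoc_mult_mat_vec[of _ "Suc n" "Suc n" _ "Suc n"]) (use A P Q in auto)
  also have "\<dots> = Q *\<^sub>v (A *\<^sub>v v)"
    unfolding Pv by (rule assoc_mult_mat_vec[of _ "Suc n" "Suc n" _ "Suc n"]) (use A Q v in auto)
  also have "\<dots> = e \<cdot>\<^sub>v (Q *\<^sub>v (P *\<^sub>v unit_vec (Suc n) 0))"
    using Q v by (simp add: mult_mat_vec Pv)
  also have "Q *\<^sub>v (P *\<^sub>v unit_vec (Suc n) 0) = (Q * P) *\<^sub>v unit_vec (Suc n) 0"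
    using P Q by (intro assoc_mult_mat_vec[symmetric]) auto
  finally have col: "C *\<^sub>v unit_vec (Suc n) 0 = e \<cdot>\<^sub>v unit_vec (Suc n) 0"
    by (simp add: PQ)
  have C0: "C $$ (i, 0) = 0" if "0 < i" "i < Suc n" for i
    using arg_cong[OF col, of "\<lambda>w. w $ i"] that C by simp
  define A1 where "A1 = mat 1 1 (\<lambda>_. C $$ (0, 0))"
  define A0 where "A0 = mat 1 n (\<lambda>(i, j). C $$ (0, Suc j))"
  define A2 where "A2 = mat n n (\<lambda>(i, j). C $$ (Suc i, Suc j))"
  have C_block: "C = four_block_mat A1 A0 (0\<^sub>m n 1) A2"
    using C by (intro eq_matI) (auto simp: A1_def A0_def A2_def C0 less_Suc_eq_0_disj)
  obtain B2 where B2: "B2 \<in> carrier_mat n n" "upper_triangular B2" "similar_mat A2 B2"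
    using Suc.IH[of A2] by (auto simp: A2_def)
  have A1: "A1 \<in> carrier_mat 1 1" "upper_triangular A1" by (auto simp: A1_def)
  have "\<exists>B0. B0 \<in> carrier_mat 1 n \<and>
      similar_mat (four_block_mat A1 A0 (0\<^sub>m n 1) A2) (four_block_mat A1 B0 (0\<^sub>m n 1) B2)"
    using A1 B2 by (intro similar_mat_four_block_0_ex similar_mat_refl) (auto simp: A0_def A2_def)
  then obtain B0 where B0: "B0 \<in> carrier_mat 1 n"
    "similar_mat C (four_block_mat A1 B0 (0\<^sub>m n 1) B2)"
    unfolding C_block[symmetric] by blast
  have "upper_triangular (four_block_mat A1 B0 (0\<^sub>m n 1) B2)"
    by (rule upper_triangular_four_block[OF A1(1) B2(1) A1(2) B2(2)])
  moreover have "four_block_mat A1 B0 (0\<^sub>m n 1) B2 \<in> carrier_mat (Suc n) (Suc n)"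
    using four_block_carrier_mat[OF A1(1) B2(1)] by simp
  ultimately show ?case
    using similar_mat_trans[OF sim B0(2)] by blast
qed

lemma upper_triangular_mult:
  fixes A B :: "'k::semiring_0 mat"
  assumes A: "A \<in> carrier_mat n n" "upper_triangular A" and B: "B \<in> carrier_mat n n" "upper_triangular B"
  shows "upper_triangular (A * B)" and "i < n \<Longrightarrow> (A * B) $$ (i, i) = A $$ (i, i) * B $$ (i, i)"
proof -
  have entry: "(A * B) $$ (i, j) = (\<Sum>k<n. A $$ (i, k) * B $$ (k, j))" if "i < n" "j < n" for i j
    using that A B by (simp add: scalar_prod_def atLeast0LessThan)
  have zero: "A $$ (i, k) * B $$ (k, j) = 0" if "i < n" "k < n" "k < i \<or> j < k" for i j k
    using that A B by (auto dest: upper_triangularD)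
  show "upper_triangular (A * B)"
  proof (rule upper_triangularI)
    fix i j assume "j < i" "i < dim_row (A * B)"
    then have ij: "i < n" "j < n" "j < i" using A by auto
    show "(A * B) $$ (i, j) = 0"
      unfolding entry[OF ij(1,2)] using ij by (intro sum.neutral ballI zero) auto
  qed
  assume i: "i < n"
  have "(A * B) $$ (i, i) = (\<Sum>k<n. if k = i then A $$ (i, i) * B $$ (i, i) else 0)"
    unfolding entry[OF i i] using i zero[of i _ i] by (intro sum.cong) (auto simp: not_less_iff_gr_or_eq linorder_neq_iff)
  then show "(A * B) $$ (i, i) = A $$ (i, i) * B $$ (i, i)" using i by simp
qed

lemma trace_pow_eigenvalues:
  fixes A :: "'k::alg_closed_field mat"
  assumes A: "A \<in> carrier_mat n n"
  obtains es where "length es = n" "\<And>m. mat_trace (A ^\<^sub>m m) = (\<Sum>e\<leftarrow>es. e ^ m)"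
    "\<And>e. e \<in> set es \<longleftrightarrow> eigenvalue A e"
proof -
  obtain B where B: "B \<in> carrier_mat n n" "upper_triangular B" and sim: "similar_mat A B"
    using similar_upper_triangular[OF A] by blast
  obtain P Q where wit: "similar_mat_wit A B P Q"
    using sim by (auto simp: similar_mat_def)
  note W = similar_mat_witD2[OF A wit]
  have pow: "upper_triangular (B ^\<^sub>m m) \<and> (\<forall>i<n. (B ^\<^sub>m m) $$ (i, i) = (B $$ (i, i)) ^ m)" for m
  proof (induction m)
    case (Suc m)
    then show ?case
      using upper_triangular_mult[OF pow_carrier_mat[OF B(1), of m] _ B] by (simp add: mult.commute)
  qed (use B in auto)
  have "mat_trace (A ^\<^sub>m m) = (\<Sum>e\<leftarrow>diag_mat B. e ^ m)" for m
  proof -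
    have "mat_trace (A ^\<^sub>m m) = mat_trace (P * (B ^\<^sub>m m * Q))"
      using similar_mat_wit_pow_id[OF wit, of m] W(5-7) pow_carrier_mat[OF B(1), of m]
      by (simp add: assoc_mult_mat[of _ n n _ n _ n])
    also have "\<dots> = mat_trace (B ^\<^sub>m m * Q * P)"
      using W pow_carrier_mat[OF B(1), of m] by (intro mat_trace_commute) auto
    also have "\<dots> = mat_trace (B ^\<^sub>m m)"
      using W pow_carrier_mat[OF B(1), of m] by (simp add: assoc_mult_mat[of _ n n _ n _ n])
    also have "\<dots> = (\<Sum>e\<leftarrow>diag_mat B. e ^ m)"
      using B(1) pow_carrier_mat[OF B(1), of m] pow[of m]
      by (simp add: mat_trace_def diag_mat_def o_def interv_sum_list_conv_sum_set_nat atLeast0LessThan)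
    finally show ?thesis .
  qed
  moreover have "e \<in> set (diag_mat B) \<longleftrightarrow> eigenvalue A e" for e
    unfolding eigenvalue_root_char_poly[OF A] char_poly_similar[OF sim] char_poly_upper_triangular[OF B]
    by (auto simp: poly_prod_list prod_list_zero_iff o_def)
  moreover have "length (diag_mat B) = n" using B(1) by (simp add: diag_mat_def)
  ultimately show ?thesis using that by blast
qed

section \<open>Power sums of odd exponent\<close>

lemma sum_sum_list_fibres:
  fixes g :: "'a \<Rightarrow> 'k::semiring_0"
  assumes "finite \<Theta>" "f ` set xs \<subseteq> \<Theta>"
  shows "(\<Sum>\<theta>\<in>\<Theta>. (\<Sum>x\<leftarrow>xs. if f x = \<theta> then g x else 0) * h \<theta>) = (\<Sum>x\<leftarrow>xs. g x * h (f x))"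
  using assms(2)
proof (induction xs)
  case (Cons x xs)
  have "(\<Sum>\<theta>\<in>\<Theta>. (if f x = \<theta> then g x else 0) * h \<theta>) = g x * h (f x)"
    using assms(1) Cons.prems by (simp add: if_distrib[of "\<lambda>z. z * _"] cong: if_cong)
  then show ?case using Cons by (simp add: distrib_right sum.distrib)
qed simp

lemma ex_rat_linear_functional:
  fixes x :: "'k::field_char_0"
  assumes "x \<noteq> 0"
  obtains f :: "'k \<Rightarrow> rat" where "f x \<noteq> 0" "\<And>y z. f (y + z) = f y + f z" "\<And>q y. f (of_rat q * y) = q * f y"
proof -
  interpret vector_space_pair "\<lambda>q (y::'k). of_rat q * y" "(*) :: rat \<Rightarrow> rat \<Rightarrow> rat"
    by unfold_locales (auto simp: algebra_simps of_rat_add of_rat_mult)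
  have "vs1.independent {x}" using assms by simp
  then obtain f where "Vector_Spaces.linear (\<lambda>q (y::'k). of_rat q * y) ((*) :: rat \<Rightarrow> rat \<Rightarrow> rat) f" "f x = 1"
    using linear_independent_extend[of "{x}" "\<lambda>_. 1"] by auto
  then show ?thesis using that[of f] by (simp add: Vector_Spaces.linear_iff)
qed

text \<open>
  Vanishing for all odd exponents separates the values \<open>\<theta> = \<omega>\<^sup>2\<close>. For each of them the
  \<open>\<omega>\<close> with \<open>\<omega>\<^sup>2 = \<theta>\<close> are \<open>\<plusminus>r\<close> for one fixed root \<open>r\<close>, so the family of sums of these
  \<open>\<omega>\<close> is \<open>r\<close> times an integer vector \<open>b\<^sub>\<theta>\<close>. The vector of the full sums is a linear
  combination of the \<open>b\<^sub>\<theta>\<close> and orthogonal to all of them. Its image under a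
  \<open>\<rat>\<close>-linear functional has the same two properties over \<open>\<rat>\<close>, where they force it to be
  zero.
\<close>

lemma sums_zero_if_odd_power_sums_zero:
  fixes om :: "'i \<Rightarrow> 'k::field_char_0 list"
  assumes fin: "finite X"
    and zero: "\<And>j. (\<Sum>x\<in>X. (\<Sum>\<omega>\<leftarrow>om x. \<omega>) * (\<Sum>\<omega>\<leftarrow>om x. \<omega> ^ (2 * j + 1))) = 0"
    and x0: "x0 \<in> X"
  shows "(\<Sum>\<omega>\<leftarrow>om x0. \<omega>) = 0"
proof (rule ccontr)
  define T where "T x = (\<Sum>\<omega>\<leftarrow>om x. \<omega>)" for x
  assume "(\<Sum>\<omega>\<leftarrow>om x0. \<omega>) \<noteq> 0"
  then have Tx0: "T x0 \<noteq> 0" by (simp add: T_def)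
  define \<Theta> where "\<Theta> = (\<Union>x\<in>X. (\<lambda>\<omega>. \<omega>\<^sup>2) ` set (om x))"
  have fin\<Theta>: "finite \<Theta>" using fin by (simp add: \<Theta>_def)
  have sub: "(\<lambda>\<omega>. \<omega>\<^sup>2) ` set (om x) \<subseteq> \<Theta>" if "x \<in> X" for x
    using that by (auto simp: \<Theta>_def)
  define C where "C \<theta> = (\<Sum>x\<in>X. T x * (\<Sum>\<omega>\<leftarrow>om x. if \<omega>\<^sup>2 = \<theta> then \<omega> else 0))" for \<theta>
  have C_pow: "(\<Sum>\<theta>\<in>\<Theta>. C \<theta> * \<theta> ^ j) = 0" for j
  proof -
    have "(\<Sum>\<theta>\<in>\<Theta>. C \<theta> * \<theta> ^ j)
        = (\<Sum>x\<in>X. T x * (\<Sum>\<theta>\<in>\<Theta>. (\<Sum>\<omega>\<leftarrow>om x. if \<omega>\<^sup>2 = \<theta> then \<omega> else 0) * \<theta> ^ j))"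
      unfolding C_def sum_distrib_left sum_distrib_right by (subst sum.swap) (simp add: mult.assoc)
    also have "\<dots> = (\<Sum>x\<in>X. T x * (\<Sum>\<omega>\<leftarrow>om x. \<omega> ^ (2 * j + 1)))"
      by (intro sum.cong refl) (simp add: sum_sum_list_fibres[OF fin\<Theta> sub] power_mult)
    finally show ?thesis using zero by (simp add: T_def)
  qed
  \<comment> \<open>The values \<open>\<theta>\<close> are separated by a polynomial that vanishes at all but one of them.\<close>
  have C_poly: "(\<Sum>\<theta>\<in>\<Theta>. C \<theta> * poly p \<theta>) = 0" for p
  proof -
    have "(\<Sum>\<theta>\<in>\<Theta>. C \<theta> * poly p \<theta>) = (\<Sum>j\<le>degree p. coeff p j * (\<Sum>\<theta>\<in>\<Theta>. C \<theta> * \<theta> ^ j))"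
      unfolding poly_altdef sum_distrib_left by (subst sum.swap) (simp add: mult.left_commute)
    then show ?thesis by (simp add: C_pow)
  qed
  have C0: "C \<theta> = 0" if \<theta>: "\<theta> \<in> \<Theta>" for \<theta>
  proof -
    define p where "p = (\<Prod>\<theta>'\<in>\<Theta> - {\<theta>}. [:- \<theta>', 1:])"
    have p: "poly p \<theta>' = 0" if "\<theta>' \<in> \<Theta> - {\<theta>}" for \<theta>'
      using that fin\<Theta> by (auto simp: p_def poly_prod)
    have "poly p \<theta> \<noteq> 0" using fin\<Theta> by (auto simp: p_def poly_prod)
    moreover have "C \<theta> * poly p \<theta> = 0"
      using C_poly[of p] fin\<Theta> \<theta> p by (simp add: sum.remove)
    ultimately show ?thesis by simp
  qed
  define r where "r \<theta> = (SOME \<omega>::'k. \<omega>\<^sup>2 = \<theta>)" for \<theta>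
  define sg where "sg \<omega> = (if \<omega> = r (\<omega>\<^sup>2) then 1 else - 1 :: rat)" for \<omega>
  have r: "\<omega> = r (\<omega>\<^sup>2) * of_rat (sg \<omega>)" for \<omega>
  proof -
    have "(r (\<omega>\<^sup>2))\<^sup>2 = \<omega>\<^sup>2" unfolding r_def by (rule someI[of _ \<omega>]) simp
    then show ?thesis by (auto simp: sg_def power2_eq_iff of_rat_minus)
  qed
  define b where "b x \<theta> = (\<Sum>\<omega>\<leftarrow>om x. if \<omega>\<^sup>2 = \<theta> then sg \<omega> else 0)" for x \<theta>
  have fibre: "(\<Sum>\<omega>\<leftarrow>om x. if \<omega>\<^sup>2 = \<theta> then \<omega> else 0) = r \<theta> * of_rat (b x \<theta>)" for x \<theta>
  proof -
    have "(\<Sum>\<omega>\<leftarrow>xs. if \<omega>\<^sup>2 = \<theta> then \<omega> else 0)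
        = r \<theta> * of_rat (\<Sum>\<omega>\<leftarrow>xs. if \<omega>\<^sup>2 = \<theta> then sg \<omega> else 0)" for xs
    proof (induction xs)
      case (Cons \<omega> xs)
      then show ?case using r[of \<omega>] by (auto simp: of_rat_add distrib_left)
    qed simp
    then show ?thesis by (simp add: b_def)
  qed
  have T_eq: "T x = (\<Sum>\<theta>\<in>\<Theta>. of_rat (b x \<theta>) * r \<theta>)" if "x \<in> X" for x
    using sum_sum_list_fibres[OF fin\<Theta> sub[OF that], of "\<lambda>\<omega>. \<omega>" "\<lambda>_. 1"]
    by (simp add: fibre T_def mult.commute)
  obtain f :: "'k \<Rightarrow> rat" where f: "f (T x0) \<noteq> 0" and f_add: "\<And>y z. f (y + z) = f y + f z"
    and f_scale: "\<And>q y. f (of_rat q * y) = q * f y"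
    using ex_rat_linear_functional[OF Tx0] by metis
  have f_0: "f 0 = 0" using f_scale[of 0 0] by simp
  have f_sum: "f (sum F A) = (\<Sum>a\<in>A. f (F a))" for F and A :: "'z set"
    by (induction A rule: infinite_finite_induct) (auto simp: f_0 f_add)
  have orth: "f (r \<theta>) * (\<Sum>x\<in>X. f (T x) * b x \<theta>) = 0" if \<theta>: "\<theta> \<in> \<Theta>" for \<theta>
  proof (cases "r \<theta> = 0")
    case False
    have "r \<theta> * (\<Sum>x\<in>X. of_rat (b x \<theta>) * T x) = C \<theta>"
      by (simp add: C_def fibre sum_distrib_left algebra_simps)
    then have "(\<Sum>x\<in>X. of_rat (b x \<theta>) * T x) = 0" using C0[OF \<theta>] False by simp
    then have "(\<Sum>x\<in>X. b x \<theta> * f (T x)) = 0"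
      using f_0 by (metis (no_types, lifting) f_scale f_sum sum.cong)
    then show ?thesis by (simp add: mult.commute)
  qed (simp add: f_0)
  have "(\<Sum>x\<in>X. (f (T x))\<^sup>2) = (\<Sum>x\<in>X. f (T x) * (\<Sum>\<theta>\<in>\<Theta>. b x \<theta> * f (r \<theta>)))"
    by (intro sum.cong refl) (simp add: power2_eq_square T_eq f_sum f_scale)
  also have "\<dots> = (\<Sum>\<theta>\<in>\<Theta>. f (r \<theta>) * (\<Sum>x\<in>X. f (T x) * b x \<theta>))"
    unfolding sum_distrib_left by (subst sum.swap) (simp add: algebra_simps)
  finally have "(\<Sum>x\<in>X. (f (T x))\<^sup>2) = 0" by (simp add: orth)
  then have "f (T x0) = 0" using fin x0 by (simp add: sum_nonneg_eq_0_iff)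
  with f show False by simp
qed

section \<open>The integral on the algebra\<close>

locale semisimple_hopf = hopf_integral scale comult counit antipode L
  for scale :: "'k::{alg_closed_field, field_char_0} \<Rightarrow> 'h::ring_1 \<Rightarrow> 'h"
    and comult :: "'h \<Rightarrow> ('h \<times> 'h) list" and counit :: "'h \<Rightarrow> 'k" and antipode :: "'h \<Rightarrow> 'h"
    and L :: 'h +
  assumes semisimple: "semisimple_algebra scale"

sublocale semisimple_hopf \<subseteq> Sep: separable_algebra scale "map (\<lambda>(a, b). (a, antipode b)) (comult L)"
proof unfold_locales
  show "\<exists>B. finite B \<and> span B = UNIV" by (rule finite_dim)
  show "scale c x * y = scale c (x * y)" for c x y by (rule scale_mult_left)
  show "x * scale c y = scale c (x * y)" for c x y by (rule scale_mult_right)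
  show "semisimple_algebra scale" by (rule semisimple)
  show "(\<Sum>(x, y)\<leftarrow>map (\<lambda>(a, b). (a, antipode b)) (comult L). x * y) = 1"
    using casimir_mult by (simp add: sw_def o_def case_prod_unfold)
  fix F :: "'h \<Rightarrow> 'h \<Rightarrow> 'k" and h
  assume "\<And>y. lin (*) (\<lambda>x. F x y)" "\<And>x. lin (*) (\<lambda>y. F x y)"
  from casimir_central[OF this, of h]
  show "(\<Sum>(x, y)\<leftarrow>map (\<lambda>(a, b). (a, antipode b)) (comult L). F (h * x) y) =
      (\<Sum>(x, y)\<leftarrow>map (\<lambda>(a, b). (a, antipode b)) (comult L). F x (y * h))"
    by (simp add: sw_def o_def case_prod_unfold)
qed

context semisimple_hopf
begin

lemma esum_sw: "Sep.esum F = sw L (\<lambda>a b. F a (antipode b))"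
  unfolding Sep.esum_def sw_def by (simp add: o_def case_prod_unfold)

lemma Sep_u: "Sep.u = u"
  by (simp add: Sep.u_def u_def esum_sw)

text \<open>
  The kernel of \<open>\<rho>(u)\<close> is a subrepresentation because of \<open>u h = S\<^sup>2(h) u\<close>, and it is proper because
  the trace of \<open>\<rho>(u)\<close> is not zero.
\<close>

lemma u_mult_eq_0: 
  assumes "u * h = 0"
  shows "h = 0"
proof (rule Sep.separated_by_irreducibles)
  fix d \<rho> assume \<rho>: "Sep.irr d \<rho>"
  note D = irreducible_repD[OF \<rho>]
  define K where "K = {w \<in> carrier_vec d. \<rho> u *\<^sub>v w = 0\<^sub>v d}"
  have "invariant_subspace d \<rho> K"
    unfolding invariant_subspace_def
  proof (intro conjI ballI allI)
    fix k w assume w: "w \<in> K"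
    have "\<rho> u *\<^sub>v (\<rho> k *\<^sub>v w) = (\<rho> u * \<rho> k) *\<^sub>v w"
      using w D(1) by (intro assoc_mult_mat_vec[of _ d d _ d, symmetric]) (auto simp: K_def)
    also have "\<rho> u * \<rho> k = \<rho> (antipode (antipode k)) * \<rho> u"
      by (simp add: D(4)[symmetric] antipode2_u)
    also have "\<dots> *\<^sub>v w = \<rho> (antipode (antipode k)) *\<^sub>v (\<rho> u *\<^sub>v w)"
      using w D(1) by (intro assoc_mult_mat_vec[of _ d d _ d]) (auto simp: K_def)
    also have "\<dots> = 0\<^sub>v d"
      using w D(1) by (simp add: K_def mult_mat_zero_vec)
    finally show "\<rho> k *\<^sub>v w \<in> K"
      using w D(1)[of k] by (simp add: K_def)
  qed (use D(1)[of u] in \<open>auto simp: K_def mult_add_distrib_mat_vec mult_mat_vec mult_mat_zero_vec\<close>)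
  moreover have "K \<noteq> carrier_vec d"
  proof
    assume K: "K = carrier_vec d"
    have "\<rho> u = 0\<^sub>m d d"
    proof (rule mat_eq_by_unit_vec)
      fix j assume "j < d"
      have "unit_vec d j \<in> K" unfolding K by simp
      then show "\<rho> u *\<^sub>v unit_vec d j = 0\<^sub>m d d *\<^sub>v unit_vec d j"
        by (simp add: K_def zero_mat_mult_vec)
    qed (use D(1)[of u] in auto)
    then have "Sep.chi \<rho> u = 0" by (simp add: mat_trace_def)
    then show False using Sep.trace_u[OF \<rho>] D(6) by (simp add: Sep_u)
  qed
  ultimately have K: "K = {0\<^sub>v d}" using D(9) by blast
  show "\<rho> h = 0\<^sub>m d d"
  proof (rule mat_eq_by_unit_vec)
    fix j assume "j < d"
    have "\<rho> 0 = 0 \<cdot>\<^sub>m \<rho> 0" using D(3)[of 0 0] by simp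
    also have "\<dots> = 0\<^sub>m d d" using D(1)[of 0] by (intro eq_matI) auto
    finally have "\<rho> 0 = 0\<^sub>m d d" .
    then have "\<rho> u * \<rho> h = 0\<^sub>m d d" by (simp add: D(4)[symmetric] assms)
    then have "\<rho> u *\<^sub>v (\<rho> h *\<^sub>v unit_vec d j) = 0\<^sub>v d"
      using assoc_mult_mat_vec[OF D(1)[of u] D(1)[of h], of "unit_vec d j"]
      by (simp add: zero_mat_mult_vec)
    then have "\<rho> h *\<^sub>v unit_vec d j \<in> K"
      using D(1)[of h] by (simp add: K_def)
    then show "\<rho> h *\<^sub>v unit_vec d j = 0\<^sub>m d d *\<^sub>v unit_vec d j"
      by (simp add: K zero_mat_mult_vec)
  qed (use D(1)[of h] in auto)
qed

lemma ex_u_inverse: "\<exists>v. u * v = 1 \<and> v * u = 1"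
proof -
  obtain d b where b: "indexed_family scale d b" and V: "span (b ` {..<d}) = UNIV"
    using subspace_indexed_basis[OF finite_dim subspace_UNIV] .
  interpret B: indexed_family scale d b by fact
  interpret FD: finite_dimensional_vector_space scale "b ` {..<d}"
    using B.indep V by unfold_locales auto
  have "inj ((*) u)"
  proof (rule injI)
    fix x y assume "u * x = u * y"
    then have "u * (x - y) = 0" by (simp add: right_diff_distrib)
    then show "x = y" using u_mult_eq_0 by force
  qed
  then have "surj ((*) u)"
    by (rule FD.linear_inj_imp_surj[OF Sep.linear_mult])
  then obtain v where v: "u * v = 1" by (metis surjD)
  have "u * (v * u - 1) = 0" by (simp add: right_diff_distrib mult.assoc[symmetric] v)
  then have "v * u = 1" using u_mult_eq_0 by force
  with v show ?thesis by blast
qed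

definition v :: 'h where "v = (SOME v. u * v = 1 \<and> v * u = 1)"

lemma uv: "u * v = 1" and vu: "v * u = 1"
  using someI_ex[OF ex_u_inverse] by (auto simp: v_def)

lemma uvx: "u * (v * x) = x" and vux: "v * (u * x) = x"
  by (simp_all add: mult.assoc[symmetric] uv vu)

lemma antipode2: "antipode (antipode h) = u * h * v"
proof -
  have "antipode (antipode h) = antipode (antipode h) * u * v" by (simp add: mult.assoc uv)
  then show ?thesis by (simp add: antipode2_u)
qed

lemma antipode_injective: "antipode x = antipode y \<Longrightarrow> x = y"
proof -
  assume "antipode x = antipode y"
  then have "u * x * v = u * y * v" by (simp add: antipode2[symmetric])
  then have "v * (u * x * v) * u = v * (u * y * v) * u" by simp
  then show ?thesis by (simp add: mult.assoc vu vux)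
qed

lemma antipode2_L: "antipode (antipode L) = L"
proof -
  have "counit u * counit v = 1" by (simp add: counit_mult[symmetric] uv counit_one)
  then show ?thesis by (simp add: antipode2 L_left L_right scale_mult_left)
qed

abbreviation t :: "'h \<Rightarrow> 'k" where "t \<equiv> Sep.weighted_char 1"

lemma t_casimir_left: "sw L (\<lambda>a b. scale (t (h * a)) (antipode b)) = u * h"
proof (rule Sep.eq_if_irreducibles_eq)
  fix d \<rho> i j assume \<rho>: "Sep.irr d \<rho>" and ij: "i < d" "j < d"
  have "\<rho> (sw L (\<lambda>a b. scale (t (h * a)) (antipode b))) $$ (i, j)
      = Sep.esum (\<lambda>x y. t (h * x) * \<rho> y $$ (i, j))"
    using irreducible_repD[OF \<rho>] ij
    by (subst linear_sw[OF Sep.entry_linear[OF \<rho> ij]]) (simp add: esum_sw)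
  then show "\<rho> (sw L (\<lambda>a b. scale (t (h * a)) (antipode b))) $$ (i, j) = \<rho> (u * h) $$ (i, j)"
    using irreducible_repD(6)[OF \<rho>] by (simp add: Sep.casimir_weighted_char_left[OF \<rho> ij] Sep_u)
qed

lemma t_casimir_right: "sw L (\<lambda>a b. scale (t (antipode b * h)) a) = h * u"
proof (rule Sep.eq_if_irreducibles_eq)
  fix d \<rho> i j assume \<rho>: "Sep.irr d \<rho>" and ij: "i < d" "j < d"
  have "\<rho> (sw L (\<lambda>a b. scale (t (antipode b * h)) a)) $$ (i, j)
      = Sep.esum (\<lambda>x y. \<rho> x $$ (i, j) * t (y * h))"
    using irreducible_repD[OF \<rho>] ij
    by (subst linear_sw[OF Sep.entry_linear[OF \<rho> ij]]) (simp add: esum_sw mult.commute)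
  then show "\<rho> (sw L (\<lambda>a b. scale (t (antipode b * h)) a)) $$ (i, j) = \<rho> (h * u) $$ (i, j)"
    using irreducible_repD(6)[OF \<rho>] by (simp add: Sep.casimir_weighted_char_right[OF \<rho> ij] Sep_u)
qed

text \<open>
  The functional whose form \<open>(x, y) \<mapsto> \<lambda>(x y)\<close> has the dual bases \<open>\<Lambda>\<^sub>1, S(\<Lambda>\<^sub>2)\<close>. It turns out to be
  the integral of the dual Hopf algebra normalised by \<open>\<lambda>(\<Lambda>) = 1\<close>.
\<close>

definition lam :: "'h \<Rightarrow> 'k" where "lam h = t (v * h)"

lemma lam_linear: "lin (*) lam"
  unfolding lam_def[abs_def]
  by (rule lin_compose[OF Sep.weighted_char_linear]) (intro lin_intros)

lemmas lin_lam = lin_compose[OF lam_linear]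
lemmas lam_scale = lin_scaleD[OF lam_linear]

text \<open>
  The factor \<open>u\<^sup>-\<^sup>1\<close> in \<open>\<lambda>\<close> is there to cancel the \<open>u\<close> in the corresponding sums for the regular
  character.
\<close>

lemma lam_dual_left: "sw L (\<lambda>a b. scale (lam (h * a)) (antipode b)) = h"
  using t_casimir_left[of "v * h"] by (simp add: lam_def mult.assoc uvx)

lemma lam_dual_right: "sw L (\<lambda>a b. scale (lam (antipode b * h)) a) = h"
proof -
  have "lam (antipode b * h) = t (antipode b * (h * v))" for b
    unfolding lam_def by (subst Sep.weighted_char_commute) (simp add: mult.assoc)
  then show ?thesis using t_casimir_right[of "h * v"] by (simp add: mult.assoc vu)
qed

lemma lam_twist: "lam (a * b) = lam (antipode (antipode b) * a)"
proof -
  have "lam (a * b) = t (b * (v * a))"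
    unfolding lam_def by (subst Sep.weighted_char_commute[of _ b]) (simp add: mult.assoc[symmetric])
  also have "\<dots> = lam (antipode (antipode b) * a)"
    by (simp add: lam_def antipode2 mult.assoc vux)
  finally show ?thesis .
qed

lemma lam_L_left: "sw L (\<lambda>a b. scale (lam a) b) = 1"
proof -
  have "antipode (sw L (\<lambda>a b. scale (lam a) b)) = antipode 1"
    using lam_dual_left[of 1]
    by (simp add: linear_sw[OF antipode_linear] lin_scaleD[OF antipode_linear] antipode_one)
  then show ?thesis by (rule antipode_injective)
qed

lemma lam_L: "lam L = 1"
proof -
  have "lam L = sw L (\<lambda>a b. counit b * lam a)"
    by (rule sw_counit_right[OF lam_linear, symmetric])
  also have "\<dots> = counit (sw L (\<lambda>a b. scale (lam a) b))"
    by (simp add: linear_sw[OF counit_linear] lin_scaleD[OF counit_linear] mult.commute)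
  finally show ?thesis by (simp add: lam_L_left counit_one)
qed

text \<open>
  Every \<open>h\<close> is of the form \<open>\<Sum> \<Lambda>\<^sub>1 f(\<Lambda>\<^sub>2)\<close>, so by coassociativity the integral property of \<open>\<lambda>\<close>
  follows from the case \<open>h = \<Lambda>\<close>.
\<close>

lemma lam_right_integral: "sw h (\<lambda>a b. scale (lam a) b) = scale (lam h) 1"
proof -
  define R where "R x = sw x (\<lambda>a b. scale (lam a) b)" for x
  define F where "F r = sw r (\<lambda>a b. scale (lam (antipode b * h)) a)" for r
  note li = lin_intros lin_lam
  have lR: "lin scale R" unfolding R_def by (intro li)
  have lF: "lin scale F" unfolding F_def by (intro li)
  have "R h = R (sw L (\<lambda>a b. scale (lam (antipode b * h)) a))" by (simp add: lam_dual_right)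
  also have "\<dots> = sw L (\<lambda>a b. scale (lam (antipode b * h)) (R a))"
    by (simp add: linear_sw[OF lR] lin_scaleD[OF lR])
  also have "\<dots> = sw L (\<lambda>a b. sw a (\<lambda>a1 a2. scale (lam (antipode b * h)) (scale (lam a1) a2)))"
    unfolding R_def by (rule sw_cong, rule linear_sw[where sV = scale and sW = scale]) (intro li)
  also have "\<dots> = sw L (\<lambda>a1 r. sw r (\<lambda>a2 b. scale (lam (antipode b * h)) (scale (lam a1) a2)))"
    by (rule sw_coassoc[where sW = scale]) (intro li)+
  also have "\<dots> = sw L (\<lambda>a1 r. sw r (\<lambda>a2 b. scale (lam a1) (scale (lam (antipode b * h)) a2)))"
    by (simp add: mult.commute)
  also have "\<dots> = sw L (\<lambda>a1 r. scale (lam a1) (F r))"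
    unfolding F_def by (rule sw_cong, rule linear_sw[symmetric, where sV = scale and sW = scale]) (intro li)
  also have "\<dots> = F (sw L (\<lambda>a1 r. scale (lam a1) r))"
    by (simp add: linear_sw[OF lF] lin_scaleD[OF lF])
  also have "\<dots> = scale (lam (antipode 1 * h)) 1"
    unfolding lam_L_left F_def by (rule sw_one[where sW = scale]) (intro li)+
  finally show ?thesis by (simp add: R_def antipode_one)
qed

lemma lam_right_integral_apply: "lin sW f \<Longrightarrow> sw h (\<lambda>a b. sW (lam a) (f b)) = sW (lam h) (f 1)"
  using linear_sw[of scale sW f h "\<lambda>a b. scale (lam a) b"] lam_right_integral[of h]
  by (simp add: lin_scaleD)

text \<open>
  The distinguished grouplike element: \<open>\<lambda>\<close> is a right integral, and \<open>g\<close> measures how far it is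
  from being a left one.
\<close>

definition g :: 'h where "g = sw L (\<lambda>a b. scale (lam b) a)"

lemma lam_left_integral: "sw h (\<lambda>a b. scale (lam b) a) = scale (lam h) g"
proof -
  define K where "K x = sw x (\<lambda>a b. scale (lam b) a)" for x
  note li = lin_intros lin_lam
  have lK: "lin scale K" unfolding K_def by (intro li)
  have "K h = K (sw L (\<lambda>a b. scale (lam (antipode b * h)) a))" by (simp add: lam_dual_right)
  also have "\<dots> = sw L (\<lambda>a b. scale (lam (antipode b * h)) (K a))"
    by (simp add: linear_sw[OF lK] lin_scaleD[OF lK])
  also have "\<dots> = sw L (\<lambda>a b. sw a (\<lambda>a1 a2. scale (lam (antipode b * h)) (scale (lam a2) a1)))"
    unfolding K_def by (rule sw_cong, rule linear_sw[where sV = scale and sW = scale]) (intro li)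
  also have "\<dots> = sw L (\<lambda>a1 r. sw r (\<lambda>a2 b. scale (lam (antipode b * h)) (scale (lam a2) a1)))"
    by (rule sw_coassoc[where sW = scale]) (intro li)+
  also have "\<dots> = sw L (\<lambda>a1 r. sw r (\<lambda>a2 b. scale (lam a2) (scale (lam (antipode b * h)) a1)))"
    by (simp add: mult.commute)
  also have "\<dots> = sw L (\<lambda>a1 r. scale (lam r) (scale (lam (antipode 1 * h)) a1))"
    by (rule sw_cong, rule lam_right_integral_apply) (intro li)
  also have "\<dots> = scale (lam h) g"
    unfolding g_def
    by (subst linear_sw[where sV = scale and sW = scale and f = "scale (lam h)"])
      ((intro li), simp add: antipode_one mult.commute)
  finally show ?thesis by (simp add: K_def)
qed

lemma sw_g:
  assumes B1: "\<And>b. lin sW (\<lambda>a. B a b)" and B2: "\<And>a. lin sW (\<lambda>b. B a b)"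
  shows "sw g B = B g g"
proof -
  note li = lin_intros lin_lam lin_compose[OF B1] lin_compose[OF B2]
  have lB: "lin sW (\<lambda>x. sw x B)" by (intro li)
  have W: "lin sW (\<lambda>x. sW (\<phi> x) c)" if "lin (*) \<phi>" for \<phi> c
  proof -
    interpret W: vector_space sW using lin_vs[OF lB] .
    show ?thesis using that lB by (simp add: Vector_Spaces.linear_iff W.scale_left_distrib)
  qed
  have "sw g B = sw L (\<lambda>a b. sW (lam b) (sw a B))"
    unfolding g_def by (simp add: linear_sw[OF lB] lin_scaleD[OF lB])
  also have "\<dots> = sw L (\<lambda>a b. sw a (\<lambda>a1 a2. sW (lam b) (B a1 a2)))"
  proof (rule sw_cong)
    fix a b
    interpret W: vector_space sW using lin_vs[OF lB] .
    show "sW (lam b) (sw a B) = sw a (\<lambda>a1 a2. sW (lam b) (B a1 a2))"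
      by (rule linear_sw[where sV = sW and sW = sW])
        (auto simp: Vector_Spaces.linear_iff W.vector_space_axioms W.scale_right_distrib mult.commute)
  qed
  also have "\<dots> = sw L (\<lambda>a1 r. sw r (\<lambda>a2 b. sW (lam b) (B a1 a2)))"
    by (rule sw_coassoc[where sW = sW]) (intro li W)+
  also have "\<dots> = sw L (\<lambda>a1 r. B a1 (sw r (\<lambda>a2 b. scale (lam b) a2)))"
    by (simp add: linear_sw[OF B2] lin_scaleD[OF B2])
  also have "\<dots> = sw L (\<lambda>a1 r. sW (lam r) (B a1 g))"
    by (simp add: lam_left_integral lin_scaleD[OF B2])
  also have "\<dots> = B g g"
    unfolding g_def by (simp add: linear_sw[OF B1] lin_scaleD[OF B1])
  finally show ?thesis .
qed

lemma counit_g: "counit g = 1"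
proof -
  have "counit g = sw L (\<lambda>a b. counit a * lam b)"
    unfolding g_def by (simp add: linear_sw[OF counit_linear] lin_scaleD[OF counit_linear] mult.commute)
  also have "\<dots> = lam L" by (rule sw_counit_left[OF lam_linear])
  finally show ?thesis by (simp add: lam_L)
qed

lemma g_antipode: "g * antipode g = 1"
proof -
  have "g * antipode g = sw g (\<lambda>a b. a * antipode b)"
    by (rule sw_g[symmetric, where sW = scale]) (intro lin_intros)+
  then show ?thesis by (simp add: sw_antipode_right[OF lin_id] counit_g)
qed

lemma sw_g_power:
  assumes B1: "\<And>b. lin sW (\<lambda>a. B a b)" and B2: "\<And>a. lin sW (\<lambda>b. B a b)"
  shows "sw (g ^ j) B = B (g ^ j) (g ^ j)"
  using assms
proof (induction j arbitrary: B)
  case 0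
  then show ?case using sw_one[OF 0] by simp
next
  case (Suc j)
  note li = lin_intros lin_compose[OF Suc.prems(1)] lin_compose[OF Suc.prems(2)]
  have "sw (g * g ^ j) B = sw g (\<lambda>a b. sw (g ^ j) (\<lambda>a' b'. B (a * a') (b * b')))"
    by (rule sw_mult[where sW = sW]) (intro li)+
  also have "\<dots> = sw g (\<lambda>a b. B (a * g ^ j) (b * g ^ j))"
    by (rule sw_cong, rule Suc.IH) (intro li)+
  also have "\<dots> = B (g * g ^ j) (g * g ^ j)"
    by (rule sw_g[where sW = sW]) (intro li)+
  finally show ?case by simp
qed

text \<open>
  Radford's formula \<open>S\<^sup>4(c) = g c g\<^sup>-\<^sup>1\<close>: shifting \<open>c\<close> across the two legs of \<open>\<Delta>(\<Lambda>)\<close> evaluates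
  \<open>\<Sum> \<Lambda>\<^sub>1 \<lambda>(S(c) \<Lambda>\<^sub>2)\<close> as \<open>S\<^sup>2(c) g\<close> and \<open>\<Sum> \<Lambda>\<^sub>1 \<lambda>(\<Lambda>\<^sub>2 S(c))\<close> as \<open>g c\<close>, and the twisted
  trace property \<open>lam_twist\<close> exchanges the two up to \<open>S\<^sup>2\<close>, under which \<open>\<Delta>(\<Lambda>)\<close> is invariant.
\<close>

lemma antipode4: "antipode (antipode (antipode (antipode c) * g)) = g * c"
proof -
  note li = lin_intros lin_lam
  have "antipode (antipode c) * g = sw L (\<lambda>a b. scale (lam b) (antipode (antipode c) * a))"
    unfolding g_def by (subst linear_sw[OF lin_times_left[OF lin_id]]) (simp add: scale_mult_right)
  also have "\<dots> = sw L (\<lambda>a b. scale (lam (antipode c * b)) a)"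
    by (rule sw_L_shift_left[symmetric, where sW = scale and F = "\<lambda>a b. scale (lam b) a"]) (intro li)+
  finally have "antipode (antipode (antipode (antipode c) * g)) =
      sw L (\<lambda>a b. scale (lam (antipode c * b)) (antipode (antipode a)))"
    by (simp add: linear_sw[OF antipode_linear] lin_scaleD[OF antipode_linear])
  also have "\<dots> = sw L (\<lambda>a b. scale (lam (antipode (antipode b) * antipode c)) (antipode (antipode a)))"
    by (rule sw_cong, subst lam_twist, rule refl)
  also have "\<dots> = sw (antipode (antipode L)) (\<lambda>a b. scale (lam (b * antipode c)) a)"
    by (rule antipode2_comult[symmetric, where sW = scale]) (intro li)+
  also have "\<dots> = sw L (\<lambda>a b. scale (lam (b * antipode c)) a)"
    by (simp add: antipode2_L)
  also have "\<dots> = sw L (\<lambda>a b. scale (lam b) (a * c))"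
    by (rule sw_L_shift_right[symmetric, where sW = scale and F = "\<lambda>a b. scale (lam b) a"]) (intro li)+
  also have "\<dots> = g * c"
    unfolding g_def by (subst linear_sw[OF lin_times_right[OF lin_id]]) (simp add: scale_mult_left)
  finally show ?thesis .
qed

lemma g_u_commute: "g * u = u * g"
proof -
  have "g = u * g * v"
    using antipode4[of 1] by (simp add: antipode2 uv)
  then have "g * u = u * g * v * u" by simp
  then show ?thesis by (simp add: mult.assoc vu)
qed

lemma g_v_commute: "g * v = v * g"
proof -
  have "v * (g * u) * v = v * (u * g) * v" by (simp add: g_u_commute)
  then show ?thesis by (simp add: mult.assoc uv vux)
qed

text \<open>
  \<open>S\<^sup>4\<close> is conjugation with \<open>u\<^sup>2\<close> as well as with \<open>g\<close>, so \<open>u\<^sup>-\<^sup>2 g\<close> is central.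
\<close>

definition cent :: 'h where "cent = v * v * g"

lemma cent_central: "c * cent = cent * c"
proof -
  have "u * (u * c * v * g) * v = g * c"
    using antipode4[of c] by (simp add: antipode2)
  then have "v * (v * (u * (u * c * v * g) * v)) = v * (v * (g * c))" by simp
  then have "c * v * g * v = v * v * g * c" by (simp add: mult.assoc vux)
  then show ?thesis by (simp add: cent_def mult.assoc g_v_commute)
qed

lemma g_eq: "g = u * u * cent"
  by (simp add: cent_def mult.assoc uvx)

lemma v_g_power: "v * g ^ Suc j = u ^ (2 * j + 1) * cent ^ Suc j"
proof -
  have "g ^ n = u ^ (2 * n) * cent ^ n" for n
  proof (induction n)
    case (Suc n)
    have "g ^ Suc n = u * u * (cent * u ^ (2 * n)) * cent ^ n" using Suc by (simp add: g_eq mult.assoc)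
    also have "cent * u ^ (2 * n) = u ^ (2 * n) * cent" by (rule cent_central[symmetric])
    finally show ?case by (simp add: mult.assoc)
  qed simp
  from this[of "Suc j"] show ?thesis by (simp add: mult.assoc vux)
qed

text \<open>
  At the grouplike element \<open>g\<^sup>j\<close> the integral property reads \<open>\<lambda>(g\<^sup>j) g\<^sup>j = \<lambda>(g\<^sup>j) 1\<close>, so
  \<open>\<lambda>(g\<^sup>j) \<noteq> 0\<close> would imply \<open>g\<^sup>j = 1\<close> and \<open>\<lambda>(g\<^sup>j) = \<lambda>(1)\<close>.
\<close>

lemma lam_g_power:
  assumes "lam 1 = 0"
  shows "lam (g ^ j) = 0"
proof (rule ccontr)
  assume nz: "lam (g ^ j) \<noteq> 0"
  have "scale (lam (g ^ j)) (g ^ j) = scale (lam (g ^ j)) 1"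
    using sw_g_power[where sW = scale and B = "\<lambda>a b. scale (lam a) b" and j = j]
    by (simp add: lam_right_integral lin_intros lin_lam)
  then have "g ^ j = 1" using nz by simp
  then show False using nz assms by simp
qed

lemma rep_power: "Sep.irr d \<rho> \<Longrightarrow> \<rho> (x ^ m) = \<rho> x ^\<^sub>m m"
proof (induction m)
  case (Suc m)
  note D = irreducible_repD[OF Suc.prems]
  have "\<rho> (x ^ Suc m) = \<rho> (x ^ m * x)" by (simp only: power_Suc2)
  then show ?case using Suc D by simp
qed (auto simp: irreducible_repD)

text \<open>
  The scalar by which the central element \<open>cent = u\<^sup>-\<^sup>2 g\<close> acts has a square root \<open>s\<close>, so
  \<open>w = s \<rho>(u)\<close> is a square root of \<open>\<rho>(g)\<close>. The list consists of the eigenvalues of \<open>w\<close>.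
\<close>

lemma ex_odd_power_sums:
  assumes \<chi>: "\<chi> \<in> Sep.Irr"
  shows "\<exists>om. (\<Sum>\<omega>\<leftarrow>om. \<omega>) \<noteq> 0 \<and>
    (\<forall>j. (\<Sum>\<omega>\<leftarrow>om. \<omega>) * (\<Sum>\<omega>\<leftarrow>om. \<omega> ^ (2 * j + 1)) = of_nat (Sep.deg \<chi>) * \<chi> (v * g ^ Suc j))"
proof -
  obtain \<rho> where \<rho>: "Sep.irr (Sep.deg \<chi>) \<rho>" and \<chi>_eq: "\<chi> = Sep.chi \<rho>"
    using \<chi> by (rule Sep.IrrE)
  define d where "d = Sep.deg \<chi>"
  note \<rho> = \<rho>[folded d_def]
  note D = irreducible_repD[OF \<rho>]
  obtain c where c: "\<rho> cent = c \<cdot>\<^sub>m 1\<^sub>m d"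
    using commutant_scalar[OF \<rho> D(1)[of cent]] D(4) cent_central by metis
  obtain s where s: "s ^ 2 = c" using nth_root_exists[of 2 c] by auto
  have "c \<noteq> 0"
  proof
    assume "c = 0"
    have "cent * (antipode g * (u * u)) = 1"
      by (simp add: cent_def mult.assoc) (simp add: mult.assoc[symmetric] g_antipode, simp add: mult.assoc vux vu)
    then have "\<rho> 1 = \<rho> cent * \<rho> (antipode g * (u * u))" by (simp add: D(4)[symmetric])
    also have "\<rho> cent = 0\<^sub>m d d" using c \<open>c = 0\<close> by (intro eq_matI) auto
    finally have "1\<^sub>m d = (0\<^sub>m d d :: 'k mat)"
      by (simp add: D(5) left_mult_zero_mat[OF D(1)])
    then have "1\<^sub>m d $$ (0, 0) = (0\<^sub>m d d :: 'k mat) $$ (0, 0)" by simp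
    then show False using D(6) by simp
  qed
  then have s0: "s \<noteq> 0" using s by auto
  obtain es where es: "\<And>m. mat_trace (\<rho> u ^\<^sub>m m) = (\<Sum>e\<leftarrow>es. e ^ m)"
    using trace_pow_eigenvalues[OF D(1)[of u]] by metis
  define om where "om = map ((*) s) es"
  have om_pow: "(\<Sum>\<omega>\<leftarrow>om. \<omega> ^ m) = s ^ m * (\<Sum>e\<leftarrow>es. e ^ m)" for m
    by (simp add: om_def o_def power_mult_distrib sum_list_const_mult)
  have es1: "(\<Sum>e\<leftarrow>es. e) = of_nat d"
    using es[of 1] Sep.trace_u[OF \<rho>] D(1)[of u] by (simp add: Sep_u)
  have om1: "(\<Sum>\<omega>\<leftarrow>om. \<omega>) = s * of_nat d"
    using om_pow[of 1] es1 by simp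
  have cent_pow: "\<rho> (cent ^ n) = c ^ n \<cdot>\<^sub>m 1\<^sub>m d" for n
  proof (induction n)
    case (Suc n)
    have "\<rho> (cent ^ Suc n) = \<rho> cent * \<rho> (cent ^ n)" by (simp add: D(4))
    then show ?case by (simp add: Suc c) (intro eq_matI; auto)
  qed (use D(5) in \<open>auto intro!: eq_matI\<close>)
  have "(\<Sum>\<omega>\<leftarrow>om. \<omega>) * (\<Sum>\<omega>\<leftarrow>om. \<omega> ^ (2 * j + 1)) = of_nat d * \<chi> (v * g ^ Suc j)" for j
  proof -
    have "\<chi> (v * g ^ Suc j) = mat_trace (\<rho> u ^\<^sub>m (2 * j + 1) * (c ^ Suc j \<cdot>\<^sub>m 1\<^sub>m d))"
      unfolding v_g_power \<chi>_eq D(4) cent_pow rep_power[OF \<rho>, of u] ..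
    also have "\<dots> = c ^ Suc j * mat_trace (\<rho> u ^\<^sub>m (2 * j + 1))"
    proof -
      have C: "\<rho> u ^\<^sub>m (2 * j + 1) \<in> carrier_mat d d" by (rule pow_carrier_mat[OF D(1)])
      then have "\<rho> u ^\<^sub>m (2 * j + 1) * (c ^ Suc j \<cdot>\<^sub>m 1\<^sub>m d) = c ^ Suc j \<cdot>\<^sub>m (\<rho> u ^\<^sub>m (2 * j + 1))"
        by (metis mult_smult_distrib one_carrier_mat right_mult_one_mat)
      then show ?thesis by (simp only: mat_trace_smult[OF C])
    qed
    also have "c ^ Suc j = s * s ^ (2 * j + 1)"
      by (simp add: s[symmetric] power_mult[symmetric] power2_eq_square flip: power_Suc)
        (simp add: power_mult power2_eq_square power_mult_distrib)
    finally show ?thesis by (simp only: om1 om_pow es mult_ac)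
  qed
  moreover have "(\<Sum>\<omega>\<leftarrow>om. \<omega>) \<noteq> 0" unfolding om1 using s0 D(6) by simp
  ultimately show ?thesis by (auto simp: d_def)
qed

text \<open>
  If \<open>\<lambda>(1)\<close> vanished, so would all \<open>\<lambda>(g\<^sup>j\<^sup>+\<^sup>1)\<close>, which are the sums of products of odd power sums in
  the hypothesis of \<open>sums_zero_if_odd_power_sums_zero\<close>.
\<close>

lemma lam_1_nonzero: "lam 1 \<noteq> 0"
proof
  assume lam1: "lam 1 = 0"
  obtain om where om: "\<And>\<chi>. \<chi> \<in> Sep.Irr \<Longrightarrow> (\<Sum>\<omega>\<leftarrow>om \<chi>. \<omega>) \<noteq> 0"
    and om_pow: "\<And>\<chi> j. \<chi> \<in> Sep.Irr \<Longrightarrow> (\<Sum>\<omega>\<leftarrow>om \<chi>. \<omega>) * (\<Sum>\<omega>\<leftarrow>om \<chi>. \<omega> ^ (2 * j + 1)) =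
      of_nat (Sep.deg \<chi>) * \<chi> (v * g ^ Suc j)"
    using bchoice[of Sep.Irr, OF ballI[OF ex_odd_power_sums]] by metis
  have eq: "(\<Sum>\<chi>\<in>Sep.Irr. (\<Sum>\<omega>\<leftarrow>om \<chi>. \<omega>) * (\<Sum>\<omega>\<leftarrow>om \<chi>. \<omega> ^ (2 * j + 1))) = lam (g ^ Suc j)" for j
    unfolding lam_def Sep.weighted_char_def by (intro sum.cong refl) (simp only: om_pow power_one_right)
  have "(\<Sum>\<chi>\<in>Sep.Irr. (\<Sum>\<omega>\<leftarrow>om \<chi>. \<omega>) * (\<Sum>\<omega>\<leftarrow>om \<chi>. \<omega> ^ (2 * j + 1))) = 0" for j
    unfolding eq by (rule lam_g_power[OF lam1])
  from sums_zero_if_odd_power_sums_zero[OF Sep.finite_Irr this] om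
  have "Sep.Irr = {}" by blast
  then show False using Sep.ex_irr Sep.chi_in_Irr by blast
qed

lemma g_eq_1: "g = 1"
proof -
  have "scale (lam 1) 1 = scale (lam 1) g"
    using lam_left_integral[of 1]
    by (subst (asm) sw_one[where sW = scale]) (intro lin_intros lin_lam | simp)+
  then show ?thesis using lam_1_nonzero by simp
qed

lemma antipode4_id: "antipode (antipode (antipode (antipode c))) = c"
  using antipode4[of c] by (simp add: g_eq_1)

end

section \<open>The antipode is an involution\<close>

lemma sum_list_roots_of_one_bounds:
  fixes es :: "'k::field_char_0 list"
  assumes "\<And>e. e \<in> set es \<Longrightarrow> e = 1 \<or> e = - 1"
  shows "\<exists>z. sum_list es = of_int z \<and> \<bar>z\<bar> \<le> int (length es) \<and>
    (1 \<in> set es \<longrightarrow> z > - int (length es)) \<and> (- 1 \<in> set es \<longrightarrow> z < int (length es))"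
  using assms
proof (induction es)
  case (Cons e es)
  then obtain z where z: "sum_list es = of_int z" "\<bar>z\<bar> \<le> int (length es)"
    "1 \<in> set es \<longrightarrow> z > - int (length es)" "- 1 \<in> set es \<longrightarrow> z < int (length es)"
    by auto
  have ne: "(1::'k) \<noteq> - 1" by simp
  consider "e = 1" | "e = - 1" using Cons.prems by auto
  then show ?case
  proof cases
    case 1
    then show ?thesis using z ne by (intro exI[of _ "z + 1"]) auto
  next
    case 2
    then show ?thesis using z ne by (intro exI[of _ "z - 1"]) auto
  qed
qed simp

lemma sum_list_multiples:
  fixes es :: "'k::field_char_0 list"
  assumes "\<And>e. e \<in> set es \<Longrightarrow> e = 0 \<or> e = of_nat D \<or> e = - of_nat D"
  shows "\<exists>z::int. sum_list es = of_nat D * of_int z"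
  using assms
proof (induction es)
  case (Cons e es)
  then obtain z :: int where z: "sum_list es = of_nat D * of_int z" by auto
  consider "e = 0" | "e = of_nat D" | "e = - of_nat D" using Cons.prems by auto
  then show ?case
  proof cases
    case 1
    then show ?thesis using z by auto
  next
    case 2
    then show ?thesis using z by (intro exI[of _ "z + 1"]) (simp add: algebra_simps)
  next
    case 3
    then show ?thesis using z by (intro exI[of _ "z - 1"]) (simp add: algebra_simps)
  qed
qed (auto intro: exI[of _ 0])

context semisimple_hopf
begin

lemma linear_field:
  "Vector_Spaces.linear (*) (*) ((*) (c :: 'k))" "Vector_Spaces.linear (*) (*) (\<lambda>x. x * (c :: 'k))"
  by (auto simp: Vector_Spaces.linear_iff vector_space_field algebra_simps)

text \<open>
  By \<open>h = \<Sum> \<lambda>(S(\<Lambda>\<^sub>2) h) \<Lambda>\<^sub>1\<close> the elements \<open>\<Lambda>\<^sub>1\<close> and the functionals \<open>\<lambda>(S(\<Lambda>\<^sub>2) -)\<close> behave like dual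
  bases in the computation of a trace.
\<close>

lemma op_trace:
  assumes b: "indexed_family scale D b" and V: "span (b ` {..<D}) = UNIV" and f: "lin scale f"
  shows "mat_trace (indexed_family.op_mat scale D b f) = sw L (\<lambda>a c. lam (antipode c * f a))"
proof -
  interpret B: indexed_family scale D b by fact
  have lc: "lin (*) (\<lambda>x. B.coord x i)" for i
    by (simp add: Vector_Spaces.linear_iff vector_space_axioms vector_space_field B.coord_add B.coord_scale V)

  have "B.coord (f (b i)) i = sw L (\<lambda>a c. lam (antipode c * b i) * B.coord (f a) i)" for i
  proof -
    have "f (b i) = f (sw L (\<lambda>a c. scale (lam (antipode c * b i)) a))" by (simp add: lam_dual_right)
    also have "\<dots> = sw L (\<lambda>a c. scale (lam (antipode c * b i)) (f a))"
      by (simp add: linear_sw[OF f] lin_scaleD[OF f])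
    finally show ?thesis by (simp add: linear_sw[OF lc] lin_scaleD[OF lc])
  qed
  then have "mat_trace (B.op_mat f) = (\<Sum>i<D. sw L (\<lambda>a c. lam (antipode c * b i) * B.coord (f a) i))"
    by (simp add: mat_trace_def B.op_mat_def)
  also have "\<dots> = sw L (\<lambda>a c. \<Sum>i<D. lam (antipode c * b i) * B.coord (f a) i)"
    by (rule sw_sum)
  also have "\<dots> = sw L (\<lambda>a c. lam (antipode c * f a))"
  proof (rule sw_cong)
    fix a c
    interpret lam: Vector_Spaces.linear scale "(*)" lam by (rule lam_linear)
    have "lam (antipode c * f a) = lam (antipode c * (\<Sum>i<D. scale (B.coord (f a) i) (b i)))"
      by (simp add: B.coord_expand V)
    also have "\<dots> = (\<Sum>i<D. lam (antipode c * b i) * B.coord (f a) i)"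
      by (simp add: sum_distrib_left lam.sum scale_mult_right lam.scale mult.commute)
    finally show "(\<Sum>i<D. lam (antipode c * b i) * B.coord (f a) i) = lam (antipode c * f a)" by simp
  qed
  finally show ?thesis .
qed

text \<open>
  By the trace formula this is the character of the regular representation.
\<close>

definition tau :: "'h \<Rightarrow> 'k" where "tau h = sw L (\<lambda>a b. lam (antipode b * h * a))"

lemma tau_linear: "lin (*) tau"
  unfolding tau_def[abs_def] by (intro lin_intros lin_lam)

lemmas lin_tau = lin_compose[OF tau_linear]

lemma tau_commute: "tau (h * k) = tau (k * h)"
proof -
  note li = lin_intros lin_lam
  have "tau (h * k) = sw L (\<lambda>a b. lam (antipode b * h * (k * a)))"
    by (simp add: tau_def mult.assoc)
  also have "\<dots> = sw L (\<lambda>a b. lam (antipode b * k * h * a))"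
    by (rule casimir_central[where sW = "(*)" and F = "\<lambda>x y. lam (y * h * x)", THEN trans])
      ((intro li)+, simp)
  finally show ?thesis by (simp add: tau_def mult.assoc)
qed

lemma tau_L: "tau L = 1"
proof -
  have "tau L = sw L (\<lambda>a b. counit a * counit b)"
    by (simp add: tau_def mult.assoc L_left L_right scale_mult_left scale_mult_right lam_scale lam_L counit_antipode
        mult.commute)
  also have "\<dots> = 1"
    using sw_counit_left[OF counit_linear, of L] by (simp add: counit_L)
  finally show ?thesis .
qed

text \<open>
  Tensoring a representation with the regular one gives a multiple of the regular one; in terms
  of characters, \<open>\<tau> f = f(1) \<tau>\<close> in the dual algebra.
\<close>

lemma tau_convolution:
  assumes f: "lin (*) f" and f_comm: "\<And>x y. f (x * y) = f (y * x)"
  shows "sw h (\<lambda>a b. tau a * f b) = f 1 * tau h"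
proof -
  \<comment> \<open>Apply the integral property of \<open>\<lambda>\<close> to \<open>S(\<Lambda>\<^sub>2) h \<Lambda>\<^sub>1\<close>. In the second factor
    \<open>f(S(\<Lambda>\<^sub>3) h\<^sub>2 \<Lambda>\<^sub>2) = f(h\<^sub>2 \<Lambda>\<^sub>2 S(\<Lambda>\<^sub>3))\<close>, where the inner legs of \<open>\<Lambda>\<close> cancel.\<close>
  note li = lin_intros lin_lam lin_compose[OF f]
  define K where "K h1 h2 a1 w b2 = lam (antipode b2 * h1 * a1) * f (h2 * w)" for h1 h2 a1 w b2
  have "f 1 * tau h = sw L (\<lambda>a b. lam (antipode b * h * a) * f 1)"
    unfolding tau_def by (subst linear_sw[OF linear_field(1)]) (simp add: mult.commute)
  also have "\<dots> = sw L (\<lambda>a b. sw (antipode b * h * a) (\<lambda>p q. lam p * f q))"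
    by (simp add: lam_right_integral_apply[OF f])
  also have "\<dots> = sw L (\<lambda>a b. sw (antipode b) (\<lambda>s1 s2. sw (h * a) (\<lambda>p q. lam (s1 * p) * f (s2 * q))))"
    unfolding mult.assoc by (rule sw_cong, rule sw_mult[where sW = "(*)"]) (intro li)+
  also have "\<dots> = sw L (\<lambda>a b. sw b (\<lambda>b1 b2. sw (h * a) (\<lambda>p q. lam (antipode b2 * p) * f (antipode b1 * q))))"
    by (rule sw_cong, rule antipode_comult[where sW = "(*)"]) (intro li)+
  also have "\<dots> = sw L (\<lambda>a b. sw b (\<lambda>b1 b2. sw h (\<lambda>h1 h2. sw a (\<lambda>a1 a2.
      lam (antipode b2 * (h1 * a1)) * f (antipode b1 * (h2 * a2))))))"
    by (rule sw_cong, rule sw_cong, rule sw_mult[where sW = "(*)"]) (intro li)+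
  also have "\<dots> = sw L (\<lambda>a b. sw b (\<lambda>b1 b2. sw h (\<lambda>h1 h2. sw a (\<lambda>a1 a2.
      K h1 h2 a1 (a2 * antipode b1) b2))))"
    unfolding K_def by (subst f_comm) (simp add: mult.assoc)
  also have "\<dots> = sw L (\<lambda>a b. sw h (\<lambda>h1 h2. sw a (\<lambda>a1 a2. sw b (\<lambda>b1 b2.
      K h1 h2 a1 (a2 * antipode b1) b2))))"
    by (rule sw_cong, subst sw_swap, rule sw_cong, rule sw_swap)
  also have "\<dots> = sw h (\<lambda>h1 h2. sw L (\<lambda>a b. sw a (\<lambda>a1 a2. sw b (\<lambda>b1 b2.
      K h1 h2 a1 (a2 * antipode b1) b2))))"
    by (rule sw_swap)
  also have "\<dots> = sw h (\<lambda>h1 h2. sw L (\<lambda>a1 r. sw r (\<lambda>a2 b. sw b (\<lambda>b1 b2.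
      K h1 h2 a1 (a2 * antipode b1) b2))))"
    unfolding K_def by (rule sw_cong, rule sw_coassoc[where sW = "(*)"]) (intro li)+
  also have "\<dots> = sw h (\<lambda>h1 h2. sw L (\<lambda>a1 r. sw r (\<lambda>p b2. sw p (\<lambda>a2 b1.
      K h1 h2 a1 (a2 * antipode b1) b2))))"
    unfolding K_def by (rule sw_cong, rule sw_cong, rule sw_coassoc[symmetric, where sW = "(*)"]) (intro li)+
  also have "\<dots> = sw h (\<lambda>h1 h2. sw L (\<lambda>a1 r. K h1 h2 a1 1 r))"
    unfolding K_def
    by (rule sw_cong, rule sw_cong, rule sw_cancel_left_right[where sW = "(*)"
        and F = "\<lambda>w b2. lam (antipode b2 * _ * _) * f (_ * w)"]) (intro li)+
  also have "\<dots> = sw h (\<lambda>h1 h2. tau h1 * f h2)"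
  proof (rule sw_cong)
    fix h1 h2
    show "sw L (\<lambda>a1 r. K h1 h2 a1 1 r) = tau h1 * f h2"
      unfolding tau_def K_def
      by (subst linear_sw[OF linear_field(2)]) simp
  qed
  finally show ?thesis by simp
qed

text \<open>
  With \<open>D = dim H\<close>, the operator \<open>h \<mapsto> \<Sum> \<tau>(h\<^sub>1) S\<^sup>2(h\<^sub>2)\<close> is \<open>D\<close> times a commuting product of \<open>S\<^sup>2\<close>
  and a projection, so its trace is a multiple of \<open>D\<close>. This trace equals that of the
  involution \<open>S\<^sup>2\<close>, both being \<open>\<lambda>(1)\<close>. A non-zero sum of \<open>D\<close> signs can be divisible by \<open>D\<close> only if
  the signs agree.
\<close>

theorem antipode_involution: "antipode (antipode x) = x"
proof -
  note li = lin_intros lin_lam lin_tau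
  obtain D b where b: "indexed_family scale D b" and V: "span (b ` {..<D}) = UNIV"
    using subspace_indexed_basis[OF finite_dim subspace_UNIV] .
  interpret B: indexed_family scale D b by fact
  define S2 where "S2 h = antipode (antipode h)" for h
  define P where "P h = sw h (\<lambda>a b. scale (tau a) b)" for h
  define G where "G h = S2 (P h)" for h
  have lS2: "lin scale S2" unfolding S2_def by (intro li)
  have lP: "lin scale P" unfolding P_def by (intro li)
  have lG: "lin scale G" unfolding G_def by (rule lin_compose[OF lS2 lP])
  have G_eq: "G h = sw h (\<lambda>a b. scale (tau a) (S2 b))" for h
    by (simp add: G_def P_def linear_sw[OF lS2] lin_scaleD[OF lS2])
  have S2_S2: "S2 (S2 h) = h" for h by (simp add: S2_def antipode4_id)
  have tau_1: "tau 1 = of_nat D"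
  proof -
    have "tau 1 = mat_trace (B.op_mat (\<lambda>x. x))"
      by (simp add: op_trace[OF b V lin_id] tau_def)
    then show ?thesis by (simp add: B.op_mat_id mat_trace_def)
  qed
  have PP: "P (P h) = scale (of_nat D) (P h)" for h
  proof -
    have "P (P h) = sw h (\<lambda>a b. scale (tau a) (sw b (\<lambda>b1 b2. scale (tau b1) b2)))"
      unfolding P_def[of h] by (simp add: linear_sw[OF lP] lin_scaleD[OF lP]) (simp add: P_def)
    also have "\<dots> = sw h (\<lambda>a b. sw b (\<lambda>b1 b2. scale (tau a * tau b1) b2))"
      by (rule sw_cong, subst linear_sw[where sV = scale and sW = scale and f = "scale (tau _)"])
        ((intro li), simp)
    also have "\<dots> = sw h (\<lambda>p c. sw p (\<lambda>a b. scale (tau a * tau b) c))"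
      by (rule sw_coassoc[symmetric, where sW = scale]) (intro li)+
    also have "\<dots> = sw h (\<lambda>p c. scale (sw p (\<lambda>a b. tau a * tau b)) c)"
      by (rule sw_cong, rule linear_sw[symmetric, where sV = "(*)" and sW = scale])
        (simp add: Vector_Spaces.linear_iff vector_space_axioms vector_space_field scale_left_distrib)
    also have "\<dots> = sw h (\<lambda>p c. scale (tau 1) (scale (tau p) c))"
      by (simp add: tau_convolution[OF tau_linear tau_commute])
    also have "\<dots> = scale (of_nat D) (P h)"
      unfolding P_def tau_1
      by (rule linear_sw[symmetric, where sV = scale and sW = scale]) (intro li)
    finally show ?thesis .
  qed
  have tau_S2: "tau (S2 h) = tau h" for h
  proof -
    have "tau (S2 h) = tau (h * v * u)"
      unfolding S2_def antipode2 by (subst tau_commute[of "h * v"]) (simp add: mult.assoc)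
    then show ?thesis by (simp add: mult.assoc vu)
  qed
  have PS2: "P (S2 h) = S2 (P h)" for h
  proof -
    have "P (S2 h) = sw h (\<lambda>a b. scale (tau (S2 a)) (S2 b))"
      unfolding P_def S2_def by (rule antipode2_comult[where sW = scale]) (intro li)+
    then show ?thesis
      by (simp add: tau_S2 P_def linear_sw[OF lS2] lin_scaleD[OF lS2])
  qed
  have GGG: "G (G (G h)) = scale (of_nat D * of_nat D) (G h)" for h
    by (simp add: G_def PS2 S2_S2 PP lin_scaleD[OF lP] lin_scaleD[OF lS2])
  have trace_S2: "mat_trace (B.op_mat S2) = lam 1"
  proof -
    have "mat_trace (B.op_mat S2) = sw L (\<lambda>a c. lam (antipode (antipode a * c)))"
      by (simp add: op_trace[OF b V lS2] S2_def antipode_mult)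
    also have "\<dots> = counit L * lam (antipode 1)"
      by (rule sw_antipode_left) (intro li)
    finally show ?thesis by (simp add: counit_L antipode_one)
  qed
  have trace_G: "mat_trace (B.op_mat G) = lam 1"
  proof -
    have "mat_trace (B.op_mat G) = sw L (\<lambda>a c. sw a (\<lambda>a1 a2. tau a1 * lam (antipode (antipode a2 * c))))"
      unfolding op_trace[OF b V lG]
    proof (rule sw_cong)
      fix a c
      have l: "lin (*) (\<lambda>w. lam (antipode c * w))" by (intro li)
      show "lam (antipode c * G a) = sw a (\<lambda>a1 a2. tau a1 * lam (antipode (antipode a2 * c)))"
        unfolding G_eq by (simp add: linear_sw[OF l] lin_scaleD[OF l] S2_def antipode_mult)
    qed
    also have "\<dots> = sw L (\<lambda>a1 r. sw r (\<lambda>a2 c. tau a1 * lam (antipode (antipode a2 * c))))"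
      by (rule sw_coassoc[where sW = "(*)"]) (intro li)+
    also have "\<dots> = tau L * lam (antipode 1)"
      by (rule sw_cancel_right_left[where sW = "(*)" and F = "\<lambda>a w. tau a * lam (antipode w)"]) (intro li)+
    finally show ?thesis by (simp add: tau_L antipode_one)
  qed
  obtain es where es: "length es = D" "mat_trace (B.op_mat S2 ^\<^sub>m 1) = (\<Sum>e\<leftarrow>es. e ^ 1)"
    "\<And>e. e \<in> set es \<longleftrightarrow> eigenvalue (B.op_mat S2) e"
    using trace_pow_eigenvalues[OF B.op_mat_carrier[of S2]] by metis
  obtain fs where fs: "mat_trace (B.op_mat G ^\<^sub>m 1) = (\<Sum>e\<leftarrow>fs. e ^ 1)"
    "\<And>e. e \<in> set fs \<longleftrightarrow> eigenvalue (B.op_mat G) e"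
    using trace_pow_eigenvalues[OF B.op_mat_carrier[of G]] by metis
  have es_eigen: "e \<in> set es \<longleftrightarrow> (\<exists>x. x \<noteq> 0 \<and> S2 x = scale e x)" for e
    by (simp add: es(3) B.eigenvalue_op_mat_iff[OF lS2 V])
  have "e = 1 \<or> e = - 1" if "e \<in> set es" for e
  proof -
    obtain x where x: "x \<noteq> 0" "S2 x = scale e x" using \<open>e \<in> set es\<close> es_eigen by blast
    have "scale 1 x = scale (e * e) x" using S2_S2[of x] x(2) by (simp add: lin_scaleD[OF lS2])
    then have "e * e = 1" using x(1) by (metis scale_cancel_right)
    then show ?thesis by (simp add: square_eq_1_iff)
  qed
  then obtain z where z: "sum_list es = of_int z" "\<bar>z\<bar> \<le> int D"
    "1 \<in> set es \<longrightarrow> z > - int D" "- 1 \<in> set es \<longrightarrow> z < int D"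
    using sum_list_roots_of_one_bounds[of es] es(1) by auto
  have "e = 0 \<or> e = of_nat D \<or> e = - of_nat D" if "e \<in> set fs" for e
  proof -
    obtain x where x: "x \<noteq> 0" "G x = scale e x"
      using \<open>e \<in> set fs\<close> by (auto simp: fs(2) B.eigenvalue_op_mat_iff[OF lG V])
    have "scale (e * (e * e)) x = scale (of_nat D * of_nat D * e) x"
      using GGG[of x] x(2) by (simp add: lin_scaleD[OF lG])
    then have "e * (e * e) = of_nat D * of_nat D * e" using x(1) by (metis scale_cancel_right)
    then have "e = 0 \<or> e * e = of_nat D * of_nat D" by auto
    then show ?thesis by (simp add: square_eq_iff)
  qed
  then obtain k :: int where k: "sum_list fs = of_nat D * of_int k"
    using sum_list_multiples[of fs D] by auto
  have "of_int z = (of_int (int D * k) :: 'k)"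
    using trace_S2 trace_G es(2) fs(1) z(1) k B.op_mat_carrier[of S2] B.op_mat_carrier[of G] by simp
  then have zk: "z = int D * k" by (simp only: of_int_eq_iff)
  have "z \<noteq> 0"
    using lam_1_nonzero trace_S2 es(2) z(1) B.op_mat_carrier[of S2] by auto
  have "(1::'h) \<noteq> 0" using counit_one lin_zero[OF counit_linear] by auto
  then have "1 \<in> set es"
    unfolding es_eigen by (intro exI[of _ 1]) (simp add: S2_def antipode_one)
  then have "z > - int D" using z(3) by blast
  have "- 1 \<notin> set es"
  proof
    assume "- 1 \<in> set es"
    then have "\<bar>z\<bar> < int D" using z(4) \<open>z > - int D\<close> by auto
    moreover have "\<bar>z\<bar> = int D * \<bar>k\<bar>" using zk by (simp add: abs_mult)
    moreover have "\<bar>k\<bar> \<ge> 1" using \<open>z \<noteq> 0\<close> zk by auto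
    ultimately show False using mult_left_mono[of 1 "\<bar>k\<bar>" "int D"] by auto
  qed
  moreover have "S2 (S2 x - x) = scale (- 1) (S2 x - x)"
    by (simp add: lin_diff[OF lS2] S2_S2)
  ultimately have "S2 x - x = 0" using es_eigen by blast
  then show ?thesis by (simp add: S2_def)
qed

lemma u_eq_1: "u = 1"
proof -
  have "u = sw L (\<lambda>a b. antipode (antipode a * b))"
    by (simp add: u_def antipode_mult antipode_involution)
  also have "\<dots> = scale (counit L) (antipode 1)"
    by (rule sw_antipode_left) (intro lin_intros)
  finally show ?thesis by (simp add: counit_L antipode_one)
qed

end

section \<open>Dual bases of a symmetric form\<close>

text \<open>
  A tensor \<open>\<Sum> X(\<Lambda>\<^sub>1) \<otimes> Y(\<Lambda>\<^sub>2)\<close> that reproduces every \<open>h\<close> through \<open>\<beta>\<close> is the Casimir tensor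
  \<open>\<Sum> r\<^sub>i \<otimes> l\<^sub>i\<close> of every pair of dual bases: expand each \<open>l\<^sub>i\<close> by the tensor and contract the sum over \<open>i\<close>.
  A pair of dual bases is obtained by expanding the first legs in an arbitrary basis.
\<close>

context hopf_algebra
begin

context
  fixes \<beta> :: "'h \<Rightarrow> 'h \<Rightarrow> 'k" and X Y :: "'h \<Rightarrow> 'h" and L :: 'h
  assumes \<beta>1: "\<And>y. lin (*) (\<lambda>x. \<beta> x y)" and \<beta>2: "\<And>x. lin (*) (\<beta> x)" and sym: "\<And>x y. \<beta> x y = \<beta> y x"
    and dual: "\<And>h. sw L (\<lambda>a b. scale (\<beta> h (X a)) (Y b)) = h"
    and dual': "\<And>h. sw L (\<lambda>a b. scale (\<beta> (Y b) h) (X a)) = h"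
begin

lemma nondegenerate: "(\<And>y. \<beta> x y = 0) \<Longrightarrow> x = 0"
  using dual[of x] by (simp add: sw_def case_prod_unfold)

lemma dual_bases_sum:
  assumes rl: "dual_bases scale \<beta> N r l"
  shows "(\<Sum>i<N. r i * c * l i) = sw L (\<lambda>a b. X a * c * Y b)"
proof -
  interpret R: indexed_family scale N r
    using rl by unfold_locales (auto simp: dual_bases_def indexed_basis_def)
  have V: "span (r ` {..<N}) = UNIV" using rl by (simp add: dual_bases_def indexed_basis_def)
  have \<beta>_rl: "\<beta> (r i) (l j) = (if i = j then 1 else 0)" if "i < N" "j < N" for i j
    using rl that by (simp add: dual_bases_def)
  have coord: "\<beta> x (l j) = R.coord x j" if j: "j < N" for x j
  proof -
    interpret \<beta>: Vector_Spaces.linear scale "(*)" "\<lambda>x. \<beta> x (l j)" by (rule \<beta>1)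
    have "\<beta> x (l j) = \<beta> (\<Sum>i<N. scale (R.coord x i) (r i)) (l j)"
      by (simp add: R.coord_expand V)
    also have "\<dots> = (\<Sum>i<N. if i = j then R.coord x i else 0)"
      unfolding \<beta>.sum \<beta>.scale using j by (intro sum.cong) (auto simp: \<beta>_rl)
    finally show ?thesis using j by simp
  qed
  have "(\<Sum>i<N. r i * c * l i) = (\<Sum>i<N. sw L (\<lambda>a b. scale (\<beta> (l i) (X a)) (r i * c * Y b)))"
  proof (rule sum.cong)
    fix i
    have "r i * c * l i = r i * c * sw L (\<lambda>a b. scale (\<beta> (l i) (X a)) (Y b))" by (simp add: dual)
    then show "r i * c * l i = sw L (\<lambda>a b. scale (\<beta> (l i) (X a)) (r i * c * Y b))"
      by (simp add: linear_sw[OF lin_times_left[OF lin_id]] scale_mult_right)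
  qed simp
  also have "\<dots> = sw L (\<lambda>a b. (\<Sum>i<N. scale (R.coord (X a) i) (r i)) * c * Y b)"
    by (simp add: sw_sum sym[of "l _"] coord sum_distrib_right scale_mult_left)
  finally show ?thesis by (simp add: R.coord_expand V)
qed

lemma ex_dual_bases: "\<exists>N r l. dual_bases scale \<beta> N r l"
proof -
  obtain N r where r: "indexed_family scale N r" and V: "span (r ` {..<N}) = UNIV"
    using subspace_indexed_basis[OF finite_dim subspace_UNIV] .
  interpret R: indexed_family scale N r by fact
  have lc: "lin (*) (\<lambda>x. R.coord x i)" for i
    by (simp add: Vector_Spaces.linear_iff vector_space_axioms vector_space_field R.coord_add R.coord_scale V)
  define l where "l j = sw L (\<lambda>a b. scale (R.coord (X a) j) (Y b))" for j
  have \<beta>_rl: "\<beta> (r i) (l j) = (if i = j then 1 else 0)" if "i < N" "j < N" for i j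
  proof -
    have "\<beta> (r i) (l j) = R.coord (sw L (\<lambda>a b. scale (\<beta> (Y b) (r i)) (X a))) j"
      by (simp add: l_def linear_sw[OF \<beta>2] lin_scaleD[OF \<beta>2] linear_sw[OF lc] lin_scaleD[OF lc]
          sym[of "r i"] mult.commute)
    also have "\<dots> = (if i = j then 1 else 0)"
      using that by (auto simp: dual' R.coord_basis)
    finally show ?thesis .
  qed
  have inj_l: "inj_on l {..<N}"
  proof (rule inj_onI)
    fix i j assume "i \<in> {..<N}" "j \<in> {..<N}" "l i = l j"
    then show "i = j" using \<beta>_rl[of i i] \<beta>_rl[of i j] by (auto split: if_splits)
  qed
  have "independent (l ` {..<N})"
    unfolding independent_explicit_finite_subsets
  proof (intro allI impI ballI)
    fix S c w assume S: "S \<subseteq> l ` {..<N}" "finite S" "(\<Sum>w\<in>S. scale (c w) w) = 0" "w \<in> S"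
    then obtain i where i: "i < N" "w = l i" by auto
    interpret \<beta>: Vector_Spaces.linear scale "(*)" "\<beta> (r i)" by (rule \<beta>2)
    have "0 = (\<Sum>w'\<in>S. c w' * \<beta> (r i) w')"
      using arg_cong[OF S(3), of "\<beta> (r i)"] by (simp add: \<beta>.sum \<beta>.scale \<beta>.zero)
    also have "\<dots> = (\<Sum>w'\<in>S. if w' = w then c w' else 0)"
      using S(1) i by (intro sum.cong) (auto simp: \<beta>_rl inj_on_eq_iff[OF inj_l])
    finally show "c w = 0" using S(2,4) by simp
  qed
  moreover have "h \<in> span (l ` {..<N})" for h
  proof -
    have "(\<Sum>j<N. scale (\<beta> h (r j)) (l j))
        = sw L (\<lambda>a b. \<Sum>j<N. scale (\<beta> h (r j)) (scale (R.coord (X a) j) (Y b)))"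
    proof -
      have "scale (\<beta> h (r j)) (l j) = sw L (\<lambda>a b. scale (\<beta> h (r j)) (scale (R.coord (X a) j) (Y b)))" for j
        unfolding l_def by (rule linear_sw[where sV = scale and sW = scale]) (intro lin_intros)
      then show ?thesis by (simp add: sw_sum)
    qed
    also have "\<dots> = sw L (\<lambda>a b. scale (\<beta> h (X a)) (Y b))"
    proof (rule sw_cong)
      fix a b
      interpret \<beta>: Vector_Spaces.linear scale "(*)" "\<beta> h" by (rule \<beta>2)
      have "\<beta> h (X a) = \<beta> h (\<Sum>j<N. scale (R.coord (X a) j) (r j))"
        by (simp add: R.coord_expand V)
      then show "(\<Sum>j<N. scale (\<beta> h (r j)) (scale (R.coord (X a) j) (Y b))) = scale (\<beta> h (X a)) (Y b)"
        by (simp add: \<beta>.sum \<beta>.scale scale_sum_left mult.commute)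
    qed
    finally have "h = (\<Sum>j<N. scale (\<beta> h (r j)) (l j))" by (simp add: dual)
    moreover have "(\<Sum>j<N. scale (\<beta> h (r j)) (l j)) \<in> span (l ` {..<N})"
      by (intro span_sum span_scale span_base) auto
    ultimately show ?thesis by metis
  qed
  ultimately have "indexed_basis scale N l"
    using inj_l by (auto simp: indexed_basis_def)
  moreover have "indexed_basis scale N r"
    using R.inj R.indep V by (simp add: indexed_basis_def)
  ultimately have "dual_bases scale \<beta> N r l"
    using \<beta>_rl by (simp add: dual_bases_def)
  then show ?thesis by blast
qed

end

end

section \<open>Casimir elements and Higman maps\<close>

context semisimple_hopf
begin

text \<open>
  This is the map \<open>Z\<^sub>1\<close>.
\<close>

definition avg :: "'h \<Rightarrow> 'h" where "avg k = sw L (\<lambda>a b. a * k * antipode b)"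

lemma avg_one: "avg 1 = 1"
  by (simp add: avg_def casimir_mult)

lemma avg_central: "h * avg k = avg k * h"
proof -
  have "h * avg k = sw L (\<lambda>a b. h * a * k * antipode b)"
    unfolding avg_def by (subst linear_sw[OF lin_times_left[OF lin_id]]) (simp add: mult.assoc)
  also have "\<dots> = sw L (\<lambda>a b. a * k * (antipode b * h))"
    by (rule casimir_central[where sW = scale and F = "\<lambda>x y. x * k * y"]) (intro lin_intros)+
  also have "\<dots> = avg k * h"
    unfolding avg_def by (subst linear_sw[OF lin_times_right[OF lin_id]]) (simp add: mult.assoc)
  finally show ?thesis .
qed

lemma rep_avg:
  assumes \<rho>: "Sep.irr d \<rho>" and ij: "i < d" "j < d"
  shows "\<rho> (avg k) $$ (i, j) = (if i = j then Sep.chi \<rho> k / of_nat d else 0)"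
proof -
  have "\<rho> (avg k) $$ (i, j) = Sep.esum (\<lambda>x y. \<rho> (x * k * y) $$ (i, j))"
    by (simp add: avg_def linear_sw[OF Sep.entry_linear[OF \<rho> ij]] esum_sw)
  also have "\<dots> = Sep.esum (\<lambda>x y. \<Sum>m<d. \<Sum>n<d. \<rho> k $$ (m, n) * (\<rho> x $$ (i, m) * \<rho> y $$ (n, j)))"
    using ij by (intro Sep.esum_cong)
      (simp add: Sep.entry_mult[OF \<rho>] sum_distrib_left sum_distrib_right mult_ac)
  also have "\<dots> = (\<Sum>m<d. \<Sum>n<d. if n = m then if i = j then \<rho> k $$ (m, m) / of_nat d else 0 else 0)"
    unfolding Sep.esum_sum Sep.esum_mult_left using ij irreducible_repD(5)[OF \<rho>]
    by (intro sum.cong refl) (simp add: Sep.schur_orthogonal_eq[OF \<rho>] Sep_u u_eq_1)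
  also have "\<dots> = (if i = j then Sep.chi \<rho> k / of_nat d else 0)"
    by (simp add: Sep.chi_sum[OF \<rho>] sum_divide_distrib)
  finally show ?thesis .
qed

text \<open>
  The map \<open>Z\<^sub>2\<close>. Because the two copies of \<open>\<Lambda>\<close> are interleaved and not nested, it does not project to
  the centre like \<open>Z\<^sub>1\<close> but multiplies by a central element.
\<close>

definition avg2 :: "'h \<Rightarrow> 'h" where
  "avg2 k = sw L (\<lambda>a b. sw L (\<lambda>a' b'. a * a' * k * antipode b * antipode b'))"

lemma avg2_eq: "avg2 k = sw L (\<lambda>a b. a * avg (k * antipode b))"
  unfolding avg2_def avg_def
  by (rule sw_cong, subst linear_sw[OF lin_times_left[OF lin_id]]) (simp add: mult.assoc)

lemma rep_avg2:
  assumes \<rho>: "Sep.irr d \<rho>" and ij: "i < d" "j < d"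
  shows "\<rho> (avg2 k) $$ (i, j) = \<rho> k $$ (i, j) / (of_nat d)\<^sup>2"
proof -
  have "\<rho> (avg2 k) $$ (i, j) = Sep.esum (\<lambda>x y. \<rho> (x * avg (k * y)) $$ (i, j))"
    by (simp add: avg2_eq linear_sw[OF Sep.entry_linear[OF \<rho> ij]] esum_sw)
  also have "\<dots> = Sep.esum (\<lambda>x y. inverse (of_nat d) * (\<rho> x $$ (i, j) * Sep.chi \<rho> (y * k)))"
  proof (rule Sep.esum_cong)
    fix x y
    have "\<rho> (x * avg (k * y)) $$ (i, j) = (\<Sum>m<d. if m = j then \<rho> x $$ (i, m) * (Sep.chi \<rho> (k * y) / of_nat d) else 0)"
      unfolding Sep.entry_mult[OF \<rho> ij] using ij by (intro sum.cong) (auto simp: rep_avg[OF \<rho>])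
    then show "\<rho> (x * avg (k * y)) $$ (i, j) = inverse (of_nat d) * (\<rho> x $$ (i, j) * Sep.chi \<rho> (y * k))"
      using ij Sep.Irr_commute[OF Sep.chi_in_Irr[OF \<rho>], of k y] by (simp add: field_simps)
  qed
  also have "\<dots> = \<rho> k $$ (i, j) / (of_nat d)\<^sup>2"
    unfolding Sep.esum_mult_left Sep.casimir_chi_right[OF \<rho> Sep.chi_in_Irr[OF \<rho>] ij]
    by (simp add: Sep_u u_eq_1 power2_eq_square field_simps)
  finally show ?thesis .
qed

abbreviation z2 :: 'h where "z2 \<equiv> avg2 1"

lemma rep_z2_mult:
  assumes \<rho>: "Sep.irr d \<rho>" and ij: "i < d" "j < d"
  shows "\<rho> (z2 * k) $$ (i, j) = \<rho> k $$ (i, j) / (of_nat d)\<^sup>2"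
    and "\<rho> (k * z2) $$ (i, j) = \<rho> k $$ (i, j) / (of_nat d)\<^sup>2"
proof -
  have z2: "\<rho> z2 $$ (i, j) = (if i = j then 1 / (of_nat d)\<^sup>2 else 0)" if "i < d" "j < d" for i j
    using that irreducible_repD(5)[OF \<rho>] by (simp add: rep_avg2[OF \<rho>])
  have "\<rho> (z2 * k) $$ (i, j) = (\<Sum>m<d. if m = i then \<rho> k $$ (m, j) / (of_nat d)\<^sup>2 else 0)"
    unfolding Sep.entry_mult[OF \<rho> ij] using ij by (intro sum.cong) (auto simp: z2)
  then show "\<rho> (z2 * k) $$ (i, j) = \<rho> k $$ (i, j) / (of_nat d)\<^sup>2" using ij by simp
  have "\<rho> (k * z2) $$ (i, j) = (\<Sum>m<d. if m = j then \<rho> k $$ (i, m) / (of_nat d)\<^sup>2 else 0)"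
    unfolding Sep.entry_mult[OF \<rho> ij] using ij by (intro sum.cong) (auto simp: z2)
  then show "\<rho> (k * z2) $$ (i, j) = \<rho> k $$ (i, j) / (of_nat d)\<^sup>2" using ij by simp
qed

lemma avg2_mult: "avg2 k = z2 * k"
  by (rule Sep.eq_if_irreducibles_eq) (simp add: rep_avg2 rep_z2_mult(1))

lemma z2_central: "z2 * k = k * z2"
  by (rule Sep.eq_if_irreducibles_eq) (simp add: rep_z2_mult)

lemma z2_power_central: "z2 ^ j * k = k * z2 ^ j"
  by (induction j) (simp_all add: mult.assoc, metis mult.assoc z2_central)

lemma rep_z2_power:
  assumes \<rho>: "Sep.irr d \<rho>" and ij: "i < d" "j < d"
  shows "\<rho> (z2 ^ m * k) $$ (i, j) = \<rho> k $$ (i, j) / of_nat d ^ (2 * m)"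
  by (induction m) (simp_all add: mult.assoc rep_z2_mult(1)[OF \<rho> ij] power2_eq_square)

text \<open>
  The letters of all other copies of \<open>\<Lambda>\<close> lie either between \<open>\<Lambda>\<^sup>1\<^sub>1 \<Lambda>\<^sup>2\<^sub>1\<close> and \<open>S(\<Lambda>\<^sup>1\<^sub>2) S(\<Lambda>\<^sup>2\<^sub>2)\<close>, around \<open>h\<close>, or
  to the right of both. The first two copies thus apply \<open>Z\<^sub>2\<close> to a prefix of the remaining product.
\<close>

lemma Z_map_Suc_Suc: "Z_map comult antipode L (Suc (Suc m)) h = z2 * Z_map comult antipode L m h"
proof -
  define PL where "PL = product_lists (replicate m (comult L))"
  define A where "A ps = prod_list (map fst ps)" for ps :: "('h \<times> 'h) list"
  define B where "B ps = prod_list (map (\<lambda>p. antipode (snd p)) ps)" for ps :: "('h \<times> 'h) list"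
  have swap: "sw L (\<lambda>a b. \<Sum>ps\<leftarrow>qs. F a b ps) = (\<Sum>ps\<leftarrow>qs. sw L (\<lambda>a b. F a b ps))"
    for F :: "'h \<Rightarrow> 'h \<Rightarrow> ('h \<times> 'h) list \<Rightarrow> 'h" and qs
    by (induction qs) (simp_all add: sw_def case_prod_unfold sum_list_addf)
  have "Z_map comult antipode L (Suc (Suc m)) h
      = sw L (\<lambda>a b. sw L (\<lambda>a' b'. \<Sum>ps\<leftarrow>PL. a * a' * (A ps * h) * antipode b * antipode b' * B ps))"
    by (simp add: Z_map_def sw_def case_prod_unfold sum_list_concat_map o_def PL_def A_def B_def mult.assoc)
  also have "\<dots> = (\<Sum>ps\<leftarrow>PL. sw L (\<lambda>a b. sw L (\<lambda>a' b'. a * a' * (A ps * h) * antipode b * antipode b' * B ps)))"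
    by (simp add: swap)
  also have "\<dots> = (\<Sum>ps\<leftarrow>PL. avg2 (A ps * h) * B ps)"
    by (simp add: avg2_def linear_sw[OF lin_times_right[OF lin_id]])
  also have "\<dots> = (\<Sum>ps\<leftarrow>PL. z2 * (A ps * h * B ps))"
    by (subst avg2_mult) (simp add: mult.assoc)
  also have "\<dots> = z2 * Z_map comult antipode L m h"
    by (simp add: Z_map_def PL_def A_def B_def sum_list_const_mult)
  finally show ?thesis .
qed

lemma Z_map_even: "Z_map comult antipode L (2 * j) h = z2 ^ j * h"
proof (induction j)
  case 0
  then show ?case by (simp add: Z_map_def)
next
  case (Suc j)
  then show ?case by (simp add: Z_map_Suc_Suc mult.assoc)
qed

lemma Z_map_odd: "Z_map comult antipode L (2 * j + 1) h = z2 ^ j * avg h"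
proof (induction j)
  case 0
  then show ?case
    by (simp add: Z_map_def avg_def sw_def case_prod_unfold sum_list_concat_map o_def)
next
  case (Suc j)
  then show ?case by (simp add: Z_map_Suc_Suc mult.assoc)
qed

lemma z_elem_eq: "z_elem comult antipode L n = z2 ^ (n div 2)"
proof -
  have "z_elem comult antipode L n = Z_map comult antipode L n 1"
    by (simp add: z_elem_def Z_map_def)
  also have "\<dots> = z2 ^ (n div 2)"
  proof (cases "even n")
    case True
    then show ?thesis using Z_map_even[of "n div 2" 1] by simp
  next
    case False
    then show ?thesis using Z_map_odd[of "n div 2" 1] by (simp add: avg_one)
  qed
  finally show ?thesis .
qed

context
  fixes j :: nat and \<beta> :: "'h \<Rightarrow> 'h \<Rightarrow> 'k"
  defines "\<beta> \<equiv> \<lambda>x y. Sep.weighted_char (2 * j + 1) (x * y)"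
begin

lemma \<beta>_linear: "lin (*) (\<lambda>x. \<beta> x y)" "lin (*) (\<beta> x)"
  unfolding \<beta>_def by (rule lin_compose[OF Sep.weighted_char_linear], intro lin_intros)+

lemma \<beta>_sym: "\<beta> x y = \<beta> y x"
  unfolding \<beta>_def by (rule Sep.weighted_char_commute)

text \<open>
  On an irreducible representation of degree \<open>d\<close> the form is \<open>d\<^sup>2\<^sup>j\<^sup>+\<^sup>1\<close> times the trace form, whose
  Casimir tensor is \<open>d\<close> times that of \<open>\<Lambda>\<close>, and \<open>z\<^sub>2\<^sup>j\<close> acts by \<open>d\<^sup>-\<^sup>2\<^sup>j\<close>.
\<close>

lemma \<beta>_dual: "sw L (\<lambda>a b. scale (\<beta> h (a * z2 ^ j)) (antipode b)) = h"
proof (rule Sep.eq_if_irreducibles_eq)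
  fix d \<rho> k l assume \<rho>: "Sep.irr d \<rho>" and kl: "k < d" "l < d"
  have "\<beta> h (x * z2 ^ j) = Sep.weighted_char (2 * j + 1) (z2 ^ j * h * x)" for x
    unfolding \<beta>_def mult.assoc[symmetric] by (subst Sep.weighted_char_commute) (simp add: mult.assoc)
  then have "\<rho> (sw L (\<lambda>a b. scale (\<beta> h (a * z2 ^ j)) (antipode b))) $$ (k, l)
      = Sep.esum (\<lambda>x y. Sep.weighted_char (2 * j + 1) (z2 ^ j * h * x) * \<rho> y $$ (k, l))"
    by (simp add: linear_sw[OF Sep.entry_linear[OF \<rho> kl]] lin_scaleD[OF Sep.entry_linear[OF \<rho> kl]] esum_sw)
  also have "\<dots> = \<rho> h $$ (k, l)"
    using irreducible_repD(6)[OF \<rho>]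
    by (simp add: Sep.casimir_weighted_char_left[OF \<rho> kl] Sep_u u_eq_1 rep_z2_power[OF \<rho> kl])
  finally show "\<rho> (sw L (\<lambda>a b. scale (\<beta> h (a * z2 ^ j)) (antipode b))) $$ (k, l) = \<rho> h $$ (k, l)" .
qed

lemma \<beta>_dual': "sw L (\<lambda>a b. scale (\<beta> (antipode b) h) (a * z2 ^ j)) = h"
proof (rule Sep.eq_if_irreducibles_eq)
  fix d \<rho> k l assume \<rho>: "Sep.irr d \<rho>" and kl: "k < d" "l < d"
  have "\<rho> (sw L (\<lambda>a b. scale (\<beta> (antipode b) h) (a * z2 ^ j))) $$ (k, l)
      = Sep.esum (\<lambda>x y. inverse (of_nat d ^ (2 * j)) *
          (\<rho> x $$ (k, l) * Sep.weighted_char (2 * j + 1) (y * h)))"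
    by (simp add: linear_sw[OF Sep.entry_linear[OF \<rho> kl]] lin_scaleD[OF Sep.entry_linear[OF \<rho> kl]] esum_sw
        z2_power_central[symmetric] rep_z2_power[OF \<rho> kl] \<beta>_def field_simps)
  also have "\<dots> = \<rho> h $$ (k, l)"
    using irreducible_repD(6)[OF \<rho>]
    by (simp add: Sep.esum_mult_left Sep.casimir_weighted_char_right[OF \<rho> kl] Sep_u u_eq_1)
  finally show "\<rho> (sw L (\<lambda>a b. scale (\<beta> (antipode b) h) (a * z2 ^ j))) $$ (k, l) = \<rho> h $$ (k, l)" .
qed

lemmas \<beta>_facts = \<beta>_linear \<beta>_sym \<beta>_dual \<beta>_dual'

lemma \<beta>_nondegenerate_symmetric: "nondegenerate_symmetric_form scale \<beta>"
  unfolding nondegenerate_symmetric_form_def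
proof (intro conjI allI impI)
  show "\<beta> (x * y) w = \<beta> x (y * w)" for x y w by (simp add: \<beta>_def mult.assoc)
  show "x = 0" if "\<forall>y. \<beta> x y = 0" for x
    by (rule nondegenerate[OF \<beta>_facts]) (use that in blast)
qed (rule \<beta>_linear \<beta>_sym)+

lemma \<beta>_sum:
  assumes "dual_bases scale \<beta> N r l"
  shows "(\<Sum>i<N. r i * c * l i) = z2 ^ j * avg c"
proof -
  have "(\<Sum>i<N. r i * c * l i) = sw L (\<lambda>a b. a * z2 ^ j * c * antipode b)"
    by (rule dual_bases_sum[OF \<beta>_facts assms])
  also have "\<dots> = z2 ^ j * avg c"
    unfolding avg_def z2_power_central[symmetric]
    by (simp add: linear_sw[OF lin_times_left[OF lin_id]] mult.assoc)
  finally show ?thesis .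
qed

lemma \<beta>_ex_dual_bases: "\<exists>N r l. dual_bases scale \<beta> N r l"
  by (rule ex_dual_bases[OF \<beta>_facts])

lemma \<beta>_casimir: "is_central_casimir_element scale \<beta> (z2 ^ j)"
  unfolding is_central_casimir_element_def
proof (intro conjI allI impI \<beta>_ex_dual_bases)
  show "z2 ^ j \<in> center" by (simp add: center_def z2_power_central)
  show "z2 ^ j = (\<Sum>i<N. r i * l i)" if "dual_bases scale \<beta> N r l" for N r l
    using \<beta>_sum[OF that, of 1] by (simp add: avg_one)
qed

lemma \<beta>_higman: "is_higman_map scale \<beta> (\<lambda>h. z2 ^ j * avg h)"
  unfolding is_higman_map_def
proof (intro conjI allI impI \<beta>_ex_dual_bases)
  show "range (\<lambda>h. z2 ^ j * avg h) \<subseteq> center"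
    by (auto simp: center_def mult.assoc avg_central[symmetric]) (metis mult.assoc z2_power_central)
  show "z2 ^ j * avg h = (\<Sum>i<N. r i * h * l i)" if "dual_bases scale \<beta> N r l" for N r l h
    by (rule \<beta>_sum[OF that, symmetric])
qed

end

end

theorem proposition3p6:
  fixes scale :: "'k::{alg_closed_field, field_char_0} \<Rightarrow> 'h::ring_1 \<Rightarrow> 'h"
    and comult :: "'h \<Rightarrow> ('h \<times> 'h) list"
    and counit :: "'h \<Rightarrow> 'k"
    and antipode :: "'h \<Rightarrow> 'h"
    and L :: 'h
    and n :: nat
  assumes "hopf_algebra scale comult counit antipode"
    and "semisimple_algebra scale"
    and "idempotent_integral scale counit L"
    and "n \<ge> 2"
  shows "finite (irreducible_characters scale) \<and>
         nondegenerate_symmetric_form scale (beta_tilde scale n) \<and>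
         is_central_casimir_element scale (beta_tilde scale n) (z_elem comult antipode L n) \<and>
         is_higman_map scale (beta_tilde scale n)
           (Z_map comult antipode L (n + 1 - n mod 2))"
proof -
  interpret semisimple_hopf scale comult counit antipode L
    using assms
    by (simp add: semisimple_hopf_def semisimple_hopf_axioms_def hopf_integral_def hopf_integral_axioms_def)
  have N: "n + 1 - n mod 2 = 2 * (n div 2) + 1"
    by presburger
  have \<beta>: "beta_tilde scale n = (\<lambda>x y. Sep.weighted_char (2 * (n div 2) + 1) (x * y))"
    by (intro ext) (simp only: beta_tilde_def t_tilde_def Sep.weighted_char_def N)
  have Z: "Z_map comult antipode L (2 * (n div 2) + 1) = (\<lambda>h. z2 ^ (n div 2) * avg h)"
    by (rule ext) (rule Z_map_odd)
  show ?thesis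
    unfolding N \<beta> Z z_elem_eq
    using Sep.finite_Irr \<beta>_nondegenerate_symmetric \<beta>_casimir \<beta>_higman by blast
qed

end
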